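(* Let $K/K_0$ be a proper separable algebraic field extension which is PAC. Then the Galois closure of $K/K_0$ is the separable closure of $K_0$.
   Context: A field extension $K/K_0$ is called PAC if for every absolutely irreducible variety $V$ of dimension $e\ge 1$ defined over $K$ and every separable dominant rational map $\nu\colon V\to\mathbb{A}^e$ defined over $K$ there exists $\mathbf b\in V(K)$ with $\nu(\mathbf b)\in K_0^e$. *)

theory Defs
  imports "HOL-Algebra.Algebraic_Closure_Type" "HOL-Algebra.Generated_Fields" "HOL-Library.Poly_Mapping"
begin

section \<open>Subfields of a field type\<close>

abbreviation is_subfield :: "'a::field set \<Rightarrow> bool" where
  "is_subfield F \<equiv> subfield F ring_of_type_algebra"

abbreviation adjoin :: "'a::field set \<Rightarrow> 'a set \<Rightarrow> 'a set" where
  "adjoin F S \<equiv> generate_field ring_of_type_algebra (F \<union> S)"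

definition field_extension :: "'a::field set \<Rightarrow> 'a set \<Rightarrow> bool" where
  "field_extension F L \<longleftrightarrow> is_subfield F \<and> is_subfield L \<and> F \<subseteq> L"

definition polys_over :: "'a::field set \<Rightarrow> 'a poly set" where
  "polys_over F = {p. \<forall>i. Polynomial.coeff p i \<in> F}"

definition algebraic_over :: "'a::field set \<Rightarrow> 'a \<Rightarrow> bool" where
  "algebraic_over F x \<longleftrightarrow> (\<exists>p \<in> polys_over F. p \<noteq> 0 \<and> poly p x = 0)"

definition is_min_poly :: "'a::field set \<Rightarrow> 'a \<Rightarrow> 'a poly \<Rightarrow> bool" where
  "is_min_poly F x p \<longleftrightarrow>
     p \<in> polys_over F \<and> Polynomial.lead_coeff p = 1 \<and> poly p x = 0 \<and>
     (\<forall>q \<in> polys_over F. q \<noteq> 0 \<and> poly q x = 0 \<longrightarrow> Polynomial.degree p \<le> Polynomial.degree q)"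

text \<open>The ambient field is algebraically closed, so \<open>rsquarefree\<close> says that the minimal
  polynomial has no multiple root in an algebraic closure of \<open>F\<close>.\<close>

definition separable_over :: "'a::alg_closed_field set \<Rightarrow> 'a \<Rightarrow> bool" where
  "separable_over F x \<longleftrightarrow> (\<exists>p. is_min_poly F x p \<and> rsquarefree p)"

definition separable_algebraic_extension :: "'a::alg_closed_field set \<Rightarrow> 'a set \<Rightarrow> bool" where
  "separable_algebraic_extension F L \<longleftrightarrow>
     field_extension F L \<and> (\<forall>x \<in> L. separable_over F x)"

definition normal_extension :: "'a::alg_closed_field set \<Rightarrow> 'a set \<Rightarrow> bool" where
  "normal_extension F L \<longleftrightarrow>
     field_extension F L \<and> (\<forall>x \<in> L. algebraic_over F x) \<and>
     (\<forall>x \<in> L. \<forall>p y. is_min_poly F x p \<and> poly p y = 0 \<longrightarrow> y \<in> L)"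

definition galois_extension :: "'a::alg_closed_field set \<Rightarrow> 'a set \<Rightarrow> bool" where
  "galois_extension F L \<longleftrightarrow> separable_algebraic_extension F L \<and> normal_extension F L"

definition galois_closure :: "'a::alg_closed_field set \<Rightarrow> 'a set \<Rightarrow> 'a set" where
  "galois_closure F L = \<Inter> {N. galois_extension F N \<and> L \<subseteq> N}"

definition separable_closure :: "'a::alg_closed_field set \<Rightarrow> 'a set" where
  "separable_closure F = {x. separable_over F x}"

section \<open>Polynomials in several variables\<close>

text \<open>A monomial maps each variable index to its exponent; a polynomial maps each monomial
  to its coefficient.\<close>

type_synonym 'a mpoly = "(nat \<Rightarrow>\<^sub>0 nat) \<Rightarrow>\<^sub>0 'a"

definition mpolys_over :: "'a::zero set \<Rightarrow> nat \<Rightarrow> 'a mpoly set" where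
  "mpolys_over F n =
     {p. (\<forall>m. Poly_Mapping.lookup p m \<in> F) \<and> (\<forall>m \<in> Poly_Mapping.keys p. Poly_Mapping.keys m \<subseteq> {..<n})}"

text \<open>The argument \<open>h\<close> is the embedding of the coefficient field into the field of values.\<close>

definition mpoly_eval_hom ::
    "('a::zero \<Rightarrow> 'b::comm_semiring_1) \<Rightarrow> (nat \<Rightarrow> 'b) \<Rightarrow> 'a mpoly \<Rightarrow> 'b" where
  "mpoly_eval_hom h x p =
     (\<Sum>m \<in> Poly_Mapping.keys p. h (Poly_Mapping.lookup p m) * (\<Prod>i \<in> Poly_Mapping.keys m. x i ^ Poly_Mapping.lookup m i))"

abbreviation mpoly_eval :: "(nat \<Rightarrow> 'a::comm_semiring_1) \<Rightarrow> 'a mpoly \<Rightarrow> 'a" where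
  "mpoly_eval \<equiv> mpoly_eval_hom (\<lambda>a. a)"

definition alg_independent :: "'a::field set \<Rightarrow> nat \<Rightarrow> (nat \<Rightarrow> 'a) \<Rightarrow> bool" where
  "alg_independent F e x \<longleftrightarrow> (\<forall>p \<in> mpolys_over F e. mpoly_eval x p = 0 \<longrightarrow> p = 0)"

definition has_trdeg :: "'a::field set \<Rightarrow> 'a set \<Rightarrow> nat \<Rightarrow> bool" where
  "has_trdeg F L e \<longleftrightarrow>
     (\<exists>x. (\<forall>i < e. x i \<in> L) \<and> alg_independent F e x \<and>
          (\<forall>y \<in> L. algebraic_over (adjoin F (x ` {..<e})) y))"

section \<open>Affine varieties\<close>

text \<open>Varieties are Zariski closed sets of points with coordinates in the ambient
  algebraically closed field.\<close>

definition affine_space :: "nat \<Rightarrow> 'a set \<Rightarrow> (nat \<Rightarrow> 'a) set" where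
  "affine_space n F = ({..<n} \<rightarrow>\<^sub>E F)"

definition zariski_closed :: "nat \<Rightarrow> (nat \<Rightarrow> 'a::field) set \<Rightarrow> bool" where
  "zariski_closed n V \<longleftrightarrow>
     (\<exists>S \<subseteq> mpolys_over UNIV n. V = {x \<in> affine_space n UNIV. \<forall>p \<in> S. mpoly_eval x p = 0})"

definition irreducible_closed :: "nat \<Rightarrow> (nat \<Rightarrow> 'a::field) set \<Rightarrow> bool" where
  "irreducible_closed n V \<longleftrightarrow>
     zariski_closed n V \<and> V \<noteq> {} \<and>
     (\<forall>A B. zariski_closed n A \<and> zariski_closed n B \<and> V = A \<union> B \<longrightarrow> V = A \<or> V = B)"

definition vanishing_ideal :: "'a::field set \<Rightarrow> nat \<Rightarrow> (nat \<Rightarrow> 'a) set \<Rightarrow> 'a mpoly set" where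
  "vanishing_ideal F n V = {p \<in> mpolys_over F n. \<forall>x \<in> V. mpoly_eval x p = 0}"

text \<open>\<open>V\<close> is defined over \<open>F\<close> if its ideal over the ambient field is generated by polynomials
  with coefficients in \<open>F\<close>; being the zero set of such polynomials is weaker when \<open>F\<close> is
  imperfect.\<close>

definition defined_over :: "'a::field set \<Rightarrow> nat \<Rightarrow> (nat \<Rightarrow> 'a) set \<Rightarrow> bool" where
  "defined_over F n V \<longleftrightarrow>
     (\<forall>p \<in> vanishing_ideal UNIV n V.
        \<exists>Q c. finite Q \<and> Q \<subseteq> vanishing_ideal F n V \<and>
              (\<forall>q \<in> Q. c q \<in> mpolys_over UNIV n) \<and> p = (\<Sum>q \<in> Q. c q * q))"

definition abs_irreducible_variety ::
    "'a::alg_closed_field set \<Rightarrow> nat \<Rightarrow> (nat \<Rightarrow> 'a) set \<Rightarrow> bool" where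
  "abs_irreducible_variety F n V \<longleftrightarrow> irreducible_closed n V \<and> defined_over F n V"

section \<open>Function fields and rational maps\<close>

text \<open>The algebraic closure of the field of rational functions in countably many variables over
  the ambient field serves as a universal domain: it is algebraically closed and has infinite
  transcendence degree over the ambient field, so it contains a generic point of every
  irreducible variety. The function field of \<open>V\<close> over \<open>F\<close> is realised inside it as the field
  generated over \<open>F\<close> by the coordinates of a generic point.\<close>

type_synonym 'a universal_domain = "'a mpoly fract alg_closure"

definition const_embed :: "'a::field \<Rightarrow> 'a universal_domain" where
  "const_embed a = to_ac (Fract (Poly_Mapping.single 0 a) 1)"

abbreviation generic_eval ::
    "(nat \<Rightarrow> 'a::field universal_domain) \<Rightarrow> 'a mpoly \<Rightarrow> 'a universal_domain" where
  "generic_eval \<equiv> mpoly_eval_hom const_embed"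

definition generic_point ::
    "'a::field set \<Rightarrow> nat \<Rightarrow> (nat \<Rightarrow> 'a) set \<Rightarrow> (nat \<Rightarrow> 'a universal_domain) \<Rightarrow> bool" where
  "generic_point F n V \<xi> \<longleftrightarrow>
     (\<forall>p \<in> mpolys_over F n. generic_eval \<xi> p = 0 \<longleftrightarrow> p \<in> vanishing_ideal F n V)"

definition function_field ::
    "'a::field set \<Rightarrow> nat \<Rightarrow> (nat \<Rightarrow> 'a universal_domain) \<Rightarrow> 'a universal_domain set" where
  "function_field F n \<xi> = adjoin (const_embed ` F) (\<xi> ` {..<n})"

definition has_dimension ::
    "'a::field set \<Rightarrow> nat \<Rightarrow> (nat \<Rightarrow> 'a universal_domain) \<Rightarrow> nat \<Rightarrow> bool" where
  "has_dimension F n \<xi> e \<longleftrightarrow> has_trdeg (const_embed ` F) (function_field F n \<xi>) e"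

text \<open>The rational function \<open>\<phi>\<close> is defined at the point \<open>b\<close> of the variety and has value \<open>c\<close>
  there: some representation of \<open>\<phi>\<close> as a quotient of polynomials over \<open>F\<close> has a denominator
  that does not vanish at \<open>b\<close>.\<close>

definition rational_function_value ::
    "'a::field set \<Rightarrow> nat \<Rightarrow> (nat \<Rightarrow> 'a universal_domain) \<Rightarrow> 'a universal_domain \<Rightarrow>
     (nat \<Rightarrow> 'a) \<Rightarrow> 'a \<Rightarrow> bool" where
  "rational_function_value F n \<xi> \<phi> b c \<longleftrightarrow>
     (\<exists>p \<in> mpolys_over F n. \<exists>q \<in> mpolys_over F n.
        generic_eval \<xi> q \<noteq> 0 \<and> \<phi> = generic_eval \<xi> p / generic_eval \<xi> q \<and>
        mpoly_eval b q \<noteq> 0 \<and> c = mpoly_eval b p / mpoly_eval b q)"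

text \<open>A rational map from \<open>V\<close> to affine \<open>e\<close>-space over \<open>F\<close> is given by its coordinates
  \<open>\<nu> 0, \<dots>, \<nu> (e - 1)\<close> in the function field of \<open>V\<close>.\<close>

definition rational_map ::
    "'a::field set \<Rightarrow> nat \<Rightarrow> (nat \<Rightarrow> 'a universal_domain) \<Rightarrow> nat \<Rightarrow>
     (nat \<Rightarrow> 'a universal_domain) \<Rightarrow> bool" where
  "rational_map F n \<xi> e \<nu> \<longleftrightarrow> (\<forall>i < e. \<nu> i \<in> function_field F n \<xi>)"

definition rational_map_value ::
    "'a::field set \<Rightarrow> nat \<Rightarrow> (nat \<Rightarrow> 'a universal_domain) \<Rightarrow> nat \<Rightarrow>
     (nat \<Rightarrow> 'a universal_domain) \<Rightarrow> (nat \<Rightarrow> 'a) \<Rightarrow> (nat \<Rightarrow> 'a) \<Rightarrow> bool" where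
  "rational_map_value F n \<xi> e \<nu> b y \<longleftrightarrow>
     (\<forall>i < e. rational_function_value F n \<xi> (\<nu> i) b (y i))"

definition dominant ::
    "'a::field set \<Rightarrow> nat \<Rightarrow> (nat \<Rightarrow> 'a) set \<Rightarrow> (nat \<Rightarrow> 'a universal_domain) \<Rightarrow> nat \<Rightarrow>
     (nat \<Rightarrow> 'a universal_domain) \<Rightarrow> bool" where
  "dominant F n V \<xi> e \<nu> \<longleftrightarrow>
     (\<forall>Z. zariski_closed e Z \<and>
          {y \<in> affine_space e UNIV. \<exists>b \<in> V. rational_map_value F n \<xi> e \<nu> b y} \<subseteq> Z
          \<longrightarrow> Z = affine_space e UNIV)"

text \<open>This is used only for dominant maps with \<open>e\<close> equal to the dimension of the variety,
  where the extension of function fields is algebraic.\<close>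

definition separable_map ::
    "'a::field set \<Rightarrow> nat \<Rightarrow> (nat \<Rightarrow> 'a universal_domain) \<Rightarrow> nat \<Rightarrow>
     (nat \<Rightarrow> 'a universal_domain) \<Rightarrow> bool" where
  "separable_map F n \<xi> e \<nu> \<longleftrightarrow>
     separable_algebraic_extension
       (adjoin (const_embed ` F) (\<nu> ` {..<e})) (function_field F n \<xi>)"

section \<open>PAC extensions\<close>

definition PAC_extension :: "'a::alg_closed_field set \<Rightarrow> 'a set \<Rightarrow> bool" where
  "PAC_extension K0 K \<longleftrightarrow>
     field_extension K0 K \<and>
     (\<forall>n V \<xi> e \<nu>.
        abs_irreducible_variety K n V \<and> generic_point K n V \<xi> \<and>
        e \<ge> 1 \<and> has_dimension K n \<xi> e \<and>
        rational_map K n \<xi> e \<nu> \<and> dominant K n V \<xi> e \<nu> \<and> separable_map K n \<xi> e \<nu> \<longrightarrow>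
        (\<exists>b \<in> V \<inter> affine_space n K. \<exists>a \<in> affine_space e K0.
           rational_map_value K n \<xi> e \<nu> b a))"

end

theory Submission
  imports Defs
begin

text \<open>Let \<open>\<theta> \<in> K - K0\<close> have minimal polynomial \<open>p\<close> over \<open>K0\<close>, let \<open>\<alpha>\<close> be separable over \<open>K0\<close> with
  minimal polynomial \<open>f\<close> of degree \<open>m\<close> and conjugates \<open>\<alpha>\<^sub>j\<close>, and let \<open>N\<close> be a Galois extension of
  \<open>K0\<close> containing \<open>K\<close>. We look for a monic polynomial \<open>F\<close> of degree \<open>m\<close> in \<open>Z\<close> whose coefficients
  are polynomials in \<open>x\<close> over \<open>K0\<close>, such that \<open>F(\<theta>, Z) = \<Prod>\<^sub>j (Z - w(\<alpha>\<^sub>j))\<close> has distinct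
  roots for some polynomial \<open>w\<close> over \<open>K\<close>, while \<open>F(\<theta>', Z)\<close> has the root \<open>y(\<theta>')\<close> for every conjugate
  \<open>\<theta>' \<noteq> \<theta>\<close>, for some polynomial \<open>y\<close> over \<open>K\<close>. Prescribing \<open>w\<close>, \<open>y\<close> and the remaining coefficients
  of \<open>F\<close> modulo \<open>p / (x - \<theta>)\<close> arbitrarily and recovering the coefficients of \<open>F\<close> by the
  Chinese remainder theorem is a separable dominant rational map of an affine space to itself,
  defined over \<open>K\<close>, so the PAC property supplies \<open>F\<close>. An embedding \<open>\<sigma>\<close> of a subfield of
  \<open>K\<close> over \<open>K0\<close>, extended to the \<open>\<alpha>\<^sub>j\<close>, with \<open>\<sigma> \<theta> = \<theta>' \<noteq> \<theta>\<close> shows that the roots of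
  \<open>F(\<theta>', Z)\<close> are the distinct elements \<open>w\<^sup>\<sigma>(\<alpha>\<^sub>j)\<close>. As one of them is \<open>y(\<theta>') \<in> N\<close>, and \<open>w\<^sup>\<sigma>\<close> is a
  polynomial over \<open>N\<close>, some \<open>\<alpha>\<^sub>j\<close> and hence \<open>\<alpha>\<close> lies in \<open>N\<close>.\<close>

text \<open>PAC supplies values in \<open>K0\<close>, but only along a separable dominant map from
  an absolutely irreducible variety. Using affine space on both sides makes irreducibility
  immediate; the price is that the condition on the root \<open>y\<close> must be solved outright,
  which works because the constant coefficient of a monic polynomial is determined by one root and
  the other coefficients. Dimensions then agree: \<open>m\<close> coefficients of \<open>w\<close>
  and \<open>d - 1\<close> for each of \<open>y\<close> and the \<open>m - 1\<close> free residues
  make \<open>m * d\<close>, where \<open>d\<close> is the degree of \<open>p\<close>, as many as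
  the coefficients of \<open>F\<close>. Separability in every characteristic comes from simple
  roots: a generic \<open>w\<close> separates the conjugates of \<alpha>, and the derivative of
  \<open>F(\<theta>', Z)\<close> at \<open>y\<close> contains the coefficient of \<open>Z\<close>
  with factor one. A point supplied by PAC might lie where values of \<open>w\<close> coincide, so
  one extra coordinate, shifted by the inverse of a discriminant, excludes that locus.\<close>

section \<open>Subfields of a field type\<close>

lemma ring_of_type_algebra_simps [simp]:
  "carrier (ring_of_type_algebra :: 'a::field ring) = UNIV"
  "x \<otimes>\<^bsub>ring_of_type_algebra\<^esub> y = (x * y :: 'a)"
  "x \<oplus>\<^bsub>ring_of_type_algebra\<^esub> y = (x + y :: 'a)"
  "\<one>\<^bsub>ring_of_type_algebra\<^esub> = (1 :: 'a)"
  "\<zero>\<^bsub>ring_of_type_algebra\<^esub> = (0 :: 'a)"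
  by (simp_all add: ring_of_type_algebra_def)

lemma ring_of_type_algebra_a_inv [simp]:
  "\<ominus>\<^bsub>ring_of_type_algebra\<^esub> x = (- x :: 'a::field)"
proof -
  interpret R: field "ring_of_type_algebra :: 'a ring" by (rule field_from_type_algebra)
  have "x \<oplus>\<^bsub>ring_of_type_algebra\<^esub> (- x) = \<zero>\<^bsub>ring_of_type_algebra\<^esub>" by simp
  then show ?thesis using R.sum_zero_eq_neg[of "-x" x] by simp
qed

lemma ring_of_type_algebra_m_inv [simp]:
  "x \<noteq> 0 \<Longrightarrow> inv\<^bsub>ring_of_type_algebra\<^esub> x = inverse (x :: 'a::field)"
proof -
  assume x: "x \<noteq> 0"
  interpret R: field "ring_of_type_algebra :: 'a ring" by (rule field_from_type_algebra)
  show ?thesis using R.comm_inv_char[of x "inverse x"] x by simp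
qed

declare Un_insert_right [simp del] \<comment> \<open>would destroy the shape \<open>F \<union> {x}\<close> in \<open>adjoin F {x}\<close>\<close>

lemma is_subfieldI:
  fixes F :: "'a::field set"
  assumes "1 \<in> F" "\<And>x y. x \<in> F \<Longrightarrow> y \<in> F \<Longrightarrow> x + y \<in> F" "\<And>x. x \<in> F \<Longrightarrow> - x \<in> F"
    "\<And>x y. x \<in> F \<Longrightarrow> y \<in> F \<Longrightarrow> x * y \<in> F" "\<And>x. x \<in> F \<Longrightarrow> x \<noteq> 0 \<Longrightarrow> inverse x \<in> F"
  shows "is_subfield F"
proof -
  interpret R: field "ring_of_type_algebra :: 'a ring" by (rule field_from_type_algebra)
  show ?thesis
    by (rule R.subfieldI'[OF R.subringI]) (use assms in auto)
qed

context
  fixes F :: "'a::field set"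
  assumes F: "is_subfield F"
begin

interpretation R: field "ring_of_type_algebra :: 'a ring" by (rule field_from_type_algebra)

lemma subfield_zero: "0 \<in> F"
  and subfield_one: "1 \<in> F"
  and subfield_uminus: "x \<in> F \<Longrightarrow> - x \<in> F"
  and subfield_add: "x \<in> F \<Longrightarrow> y \<in> F \<Longrightarrow> x + y \<in> F"
  and subfield_mult: "x \<in> F \<Longrightarrow> y \<in> F \<Longrightarrow> x * y \<in> F"
  using subringE[OF subfieldE(1)[OF F]] by auto

lemma subfield_inverse: "x \<in> F \<Longrightarrow> inverse x \<in> F"
  using R.subfield_m_inv(1)[OF F, of x] by (cases "x = 0") auto

lemma subfield_diff: "x \<in> F \<Longrightarrow> y \<in> F \<Longrightarrow> x - y \<in> F"
  using subfield_add[of x "- y"] subfield_uminus[of y] by simp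

lemma subfield_divide: "x \<in> F \<Longrightarrow> y \<in> F \<Longrightarrow> x / y \<in> F"
  unfolding divide_inverse by (intro subfield_mult subfield_inverse)

lemma subfield_power: "x \<in> F \<Longrightarrow> x ^ n \<in> F"
  by (induction n) (auto intro: subfield_one subfield_mult)

lemma subfield_sum: "(\<And>i. i \<in> I \<Longrightarrow> g i \<in> F) \<Longrightarrow> sum g I \<in> F"
  by (induction I rule: infinite_finite_induct) (auto intro: subfield_zero subfield_add)

lemma subfield_prod: "(\<And>i. i \<in> I \<Longrightarrow> g i \<in> F) \<Longrightarrow> prod g I \<in> F"
  by (induction I rule: infinite_finite_induct) (auto intro: subfield_one subfield_mult)

lemma subfield_of_nat: "of_nat n \<in> F"
  by (induction n) (auto intro: subfield_zero subfield_one subfield_add)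

end

lemmas subfield_intros = subfield_zero subfield_one subfield_uminus subfield_add subfield_mult
  subfield_inverse subfield_diff subfield_divide subfield_power subfield_sum subfield_prod
  subfield_of_nat

lemma is_subfield_UNIV [simp]: "is_subfield (UNIV :: 'a::field set)"
  by (rule is_subfieldI) auto

lemma is_subfield_adjoin: "is_subfield (adjoin F S :: 'a::field set)"
proof -
  interpret R: field "ring_of_type_algebra :: 'a ring" by (rule field_from_type_algebra)
  show ?thesis by (rule R.generate_field_is_subfield) auto
qed

lemma adjoin_base: "x \<in> F \<Longrightarrow> x \<in> adjoin F S"
  and adjoin_gen: "x \<in> S \<Longrightarrow> x \<in> adjoin F S"
  by (auto intro: generate_field.incl)

lemma adjoin_subset:
  fixes E :: "'a::field set"
  assumes "is_subfield E" "F \<subseteq> E" "S \<subseteq> E"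
  shows "adjoin F S \<subseteq> E"
proof -
  interpret R: field "ring_of_type_algebra :: 'a ring" by (rule field_from_type_algebra)
  show ?thesis by (rule R.generate_field_min_subfield1) (use assms in auto)
qed

lemma adjoin_mono: "F \<subseteq> F' \<Longrightarrow> S \<subseteq> S' \<Longrightarrow> adjoin F S \<subseteq> adjoin F' (S' :: 'a::field set)"
  by (rule adjoin_subset[OF is_subfield_adjoin]) (auto intro: adjoin_base adjoin_gen)

lemma adjoin_adjoin: "adjoin (adjoin F S) T = adjoin F (S \<union> T :: 'a::field set)"
proof
  show "adjoin (adjoin F S) T \<subseteq> adjoin F (S \<union> T)"
    by (intro adjoin_subset is_subfield_adjoin) (auto intro: adjoin_base adjoin_gen)
  show "adjoin F (S \<union> T) \<subseteq> adjoin (adjoin F S) T"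
    by (intro adjoin_subset is_subfield_adjoin) (auto intro: adjoin_base adjoin_gen)
qed

lemma adjoin_trivial:
  assumes "is_subfield F" "S \<subseteq> F"
  shows "adjoin F S = (F :: 'a::field set)"
proof
  show "adjoin F S \<subseteq> F" by (rule adjoin_subset) (use assms in auto)
qed (auto intro: adjoin_base)

section \<open>Polynomials over a subfield\<close>

lemma polys_overI: "(\<And>i. Polynomial.coeff p i \<in> F) \<Longrightarrow> p \<in> polys_over F"
  by (simp add: polys_over_def)

lemma polys_over_coeff: "p \<in> polys_over F \<Longrightarrow> Polynomial.coeff p i \<in> F"
  by (simp add: polys_over_def)

lemma polys_over_mono: "F \<subseteq> F' \<Longrightarrow> p \<in> polys_over F \<Longrightarrow> p \<in> polys_over F'"
  by (auto simp: polys_over_def)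

context
  fixes F :: "'a::field set"
  assumes F: "is_subfield F"
begin

lemma polys_over_0: "0 \<in> polys_over F"
  and polys_over_1: "1 \<in> polys_over F"
  by (auto intro!: polys_overI subfield_intros[OF F] simp: coeff_1)

lemma polys_over_pCons: "c \<in> F \<Longrightarrow> p \<in> polys_over F \<Longrightarrow> pCons c p \<in> polys_over F"
  by (auto intro!: polys_overI simp: coeff_pCons polys_over_coeff split: nat.splits)

lemma polys_over_const: "c \<in> F \<Longrightarrow> [:c:] \<in> polys_over F"
  by (intro polys_over_pCons polys_over_0)

lemma polys_over_linear: "c \<in> F \<Longrightarrow> c' \<in> F \<Longrightarrow> [:c, c':] \<in> polys_over F"
  by (intro polys_over_pCons polys_over_0)

lemma polys_over_monom: "c \<in> F \<Longrightarrow> Polynomial.monom c n \<in> polys_over F"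
  by (auto intro!: polys_overI subfield_intros[OF F] simp: coeff_monom)

lemma polys_over_add: "p \<in> polys_over F \<Longrightarrow> q \<in> polys_over F \<Longrightarrow> p + q \<in> polys_over F"
  and polys_over_diff: "p \<in> polys_over F \<Longrightarrow> q \<in> polys_over F \<Longrightarrow> p - q \<in> polys_over F"
  and polys_over_uminus: "p \<in> polys_over F \<Longrightarrow> - p \<in> polys_over F"
  and polys_over_smult: "c \<in> F \<Longrightarrow> p \<in> polys_over F \<Longrightarrow> Polynomial.smult c p \<in> polys_over F"
  by (auto intro!: polys_overI subfield_intros[OF F] simp: polys_over_coeff)

lemma polys_over_mult: "p \<in> polys_over F \<Longrightarrow> q \<in> polys_over F \<Longrightarrow> p * q \<in> polys_over F"
  by (auto intro!: polys_overI subfield_intros[OF F] simp: polys_over_coeff coeff_mult)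

lemma polys_over_power: "p \<in> polys_over F \<Longrightarrow> p ^ n \<in> polys_over F"
  by (induction n) (auto intro: polys_over_1 polys_over_mult)

lemma polys_over_sum: "(\<And>i. i \<in> I \<Longrightarrow> g i \<in> polys_over F) \<Longrightarrow> sum g I \<in> polys_over F"
  by (induction I rule: infinite_finite_induct) (auto intro: polys_over_0 polys_over_add)

lemma polys_over_pderiv: "p \<in> polys_over F \<Longrightarrow> pderiv p \<in> polys_over F"
  by (intro polys_overI, unfold coeff_pderiv) (intro subfield_intros[OF F] polys_over_coeff)

lemma poly_in_subfield: "p \<in> polys_over F \<Longrightarrow> x \<in> F \<Longrightarrow> poly p x \<in> F"
  unfolding poly_altdef by (intro subfield_intros[OF F] polys_over_coeff)

lemma polys_over_pcompose: "p \<in> polys_over F \<Longrightarrow> q \<in> polys_over F \<Longrightarrow> pcompose p q \<in> polys_over F"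
proof (induction p)
  case (pCons a p)
  have "a \<in> F" using polys_over_coeff[OF pCons.prems(1), of 0] by simp
  moreover have "p \<in> polys_over F"
    using polys_over_coeff[OF pCons.prems(1), of "Suc _"] by (auto intro: polys_overI)
  ultimately show ?case using pCons
    by (simp add: pcompose_pCons polys_over_add polys_over_mult polys_over_const)
qed (simp add: polys_over_0)

text \<open>Long division never leaves \<open>F\<close>: \<open>t * q\<close> cancels the leading
  term of \<open>p\<close>, and the difference \<open>r\<close> has the same remainder modulo
  \<open>q\<close>. Quotients taken over the ambient field are therefore quotients over
  \<open>F\<close>.\<close>

lemma polys_over_div_mod:
  assumes "p \<in> polys_over F" "q \<in> polys_over F"
  shows "p div q \<in> polys_over F \<and> p mod q \<in> polys_over F"
  using assms(1)
proof (induction "Polynomial.degree p" arbitrary: p rule: less_induct)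
  case less
  show ?case
  proof (cases "q = 0 \<or> p = 0 \<or> Polynomial.degree p < Polynomial.degree q")
    case True
    then show ?thesis using less.prems by (auto simp: div_poly_less mod_poly_less polys_over_0)
  next
    case False
    define c where "c = lead_coeff p / lead_coeff q"
    define t where "t = Polynomial.monom c (Polynomial.degree p - Polynomial.degree q)"
    have c: "c \<in> F" unfolding c_def
      by (intro subfield_intros[OF F] polys_over_coeff less.prems assms)
    then have t: "t \<in> polys_over F" by (simp add: t_def polys_over_monom)
    define r where "r = p - t * q"
    have r: "r \<in> polys_over F" unfolding r_def
      by (intro polys_over_diff polys_over_mult t assms less.prems)
    have "c \<noteq> 0" using False by (simp add: c_def)
    then have "t \<noteq> 0" "Polynomial.degree t = Polynomial.degree p - Polynomial.degree q"
      by (simp_all add: t_def degree_monom_eq monom_eq_0_iff)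
    then have dt: "Polynomial.degree (t * q) = Polynomial.degree p"
      using False by (simp add: degree_mult_eq)
    have "lead_coeff t = c"
      using \<open>c \<noteq> 0\<close> by (simp add: t_def degree_monom_eq)
    then have lt: "lead_coeff (t * q) = lead_coeff p"
      using False unfolding lead_coeff_mult by (simp add: c_def)
    have pq: "p = r + t * q" by (simp add: r_def)
    have "r = 0 \<or> Polynomial.degree r < Polynomial.degree p"
    proof (cases "Polynomial.degree p = 0")
      case True
      then have "Polynomial.degree r = 0" using dt unfolding r_def
        by (metis degree_diff_le le_zero_eq order_refl)
      moreover have "Polynomial.coeff r 0 = 0" using True dt lt by (simp add: r_def)
      ultimately have "r = 0" by (metis leading_coeff_0_iff)
      then show ?thesis ..
    next
      case False
      have "Polynomial.degree r \<noteq> Polynomial.degree p"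
        using False lt dt by (metis coeff_diff diff_self leading_coeff_0_iff r_def degree_0)
      moreover have "Polynomial.degree r \<le> Polynomial.degree p"
        unfolding r_def by (rule degree_diff_le) (simp_all add: dt)
      ultimately show ?thesis by simp
    qed
    then have *: "r div q \<in> polys_over F \<and> r mod q \<in> polys_over F"
      using less.hyps[of r] r polys_over_0 by auto
    have "p div q = r div q + t" "p mod q = r mod q"
      using False by (simp_all add: pq div_mult_self1 add.commute mult.commute)
    then show ?thesis using * t polys_over_add by auto
  qed
qed

lemmas polys_over_div = polys_over_div_mod[THEN conjunct1]
  and polys_over_mod = polys_over_div_mod[THEN conjunct2]

end

lemmas polys_over_intros = polys_over_0 polys_over_1 polys_over_const polys_over_pCons
  polys_over_monom polys_over_add polys_over_diff polys_over_uminus polys_over_smult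
  polys_over_mult polys_over_power polys_over_sum polys_over_pderiv polys_over_div polys_over_mod

text \<open>Newton interpolation: dividing \<open>P - P(x0)\<close> by the linear factor at a node
  \<open>x0\<close> leaves a polynomial of smaller degree with values in \<open>F\<close> at the
  other nodes. It later turns knowledge of values into knowledge of coefficients.\<close>

lemma polys_over_interpolation:
  fixes F :: "'a::field set"
  assumes F: "is_subfield F"
  shows "finite A \<Longrightarrow> A \<subseteq> F \<Longrightarrow> Polynomial.degree P < card A \<Longrightarrow> (\<And>x. x \<in> A \<Longrightarrow> poly P x \<in> F)
    \<Longrightarrow> P \<in> polys_over F"
proof (induction A arbitrary: P rule: finite_induct)
  case (insert x0 A)
  show ?case
  proof (cases "Polynomial.degree P = 0")
    case True
    then obtain c where "P = [:c:]" by (metis degree_eq_zeroE)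
    then show ?thesis using insert.prems by (auto intro!: polys_over_const[OF F])
  next
    case False
    define c where "c = poly P x0"
    have "poly (P - [:c:]) x0 = 0" by (simp add: c_def)
    then obtain Q where Q: "P - [:c:] = [:- x0, 1:] * Q" by (metis dvdE poly_eq_0_iff_dvd)
    have P: "P = [:c:] + [:- x0, 1:] * Q" using Q by (metis diff_add_cancel add.commute)
    have "Q \<noteq> 0" using P False by auto
    then have dQ1: "Polynomial.degree ([:- x0, 1:] * Q) = Suc (Polynomial.degree Q)"
      by (subst degree_mult_eq) auto
    then have "Polynomial.degree P = Suc (Polynomial.degree Q)"
      unfolding P by (subst degree_add_eq_right) (simp_all only: degree_pCons_0)
    then have dQ: "Polynomial.degree Q < card A" using insert by simp
    have c: "c \<in> F" using insert.prems by (simp add: c_def)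
    have "poly Q x \<in> F" if "x \<in> A" for x
    proof -
      have "poly P x - c = (x - x0) * poly Q x" by (simp add: P algebra_simps)
      moreover have "x \<noteq> x0" using that insert.hyps by auto
      ultimately have "poly Q x = (poly P x - c) / (x - x0)" by simp
      then show ?thesis using that insert.prems c by (auto intro!: subfield_intros[OF F])
    qed
    then have "Q \<in> polys_over F" using insert.IH[of Q] dQ insert.prems by auto
    then show ?thesis unfolding P using insert.prems c by (auto intro!: polys_over_intros[OF F] subfield_intros[OF F])
  qed
qed auto

section \<open>Minimal polynomials\<close>

lemma order_linear_self: "order a [:- a, 1:] = (1 :: nat)" for a :: "'a::field"
  using order_power_n_n[of a 1] by simp

text \<open>Splitting off the linear factor at a root leaves a cofactor whose value there is that of
  the derivative, so the root is simple exactly when the derivative survives.\<close>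

lemma rsquarefree_iff_pderiv:
  fixes p :: "'a::field poly"
  assumes "p \<noteq> 0"
  shows "rsquarefree p \<longleftrightarrow> (\<forall>a. poly p a = 0 \<longrightarrow> poly (pderiv p) a \<noteq> 0)"
proof -
  have "order a p = 0 \<or> order a p = 1 \<longleftrightarrow> poly (pderiv p) a \<noteq> 0" if root: "poly p a = 0" for a
  proof -
    obtain q where q: "p = [:-a, 1:] * q" using root by (metis dvdE poly_eq_0_iff_dvd)
    have "q \<noteq> 0" using assms q by auto
    have "order a p = 1 + order a q"
      using assms unfolding q by (subst order_mult) (auto simp: order_linear_self)
    moreover have "poly (pderiv p) a = poly q a"
      unfolding q by (simp add: pderiv_mult pderiv_pCons del: mult_pCons_left)
    moreover have "order a q = 0 \<longleftrightarrow> poly q a \<noteq> 0"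
      using \<open>q \<noteq> 0\<close> by (auto simp: order_root)
    ultimately show ?thesis by auto
  qed
  moreover have "order a p = 0" if "poly p a \<noteq> 0" for a using that by (rule order_0I)
  ultimately show ?thesis using assms unfolding rsquarefree_def by blast
qed

lemma is_min_polyD:
  assumes "is_min_poly F x p"
  shows "p \<in> polys_over F" "lead_coeff p = 1" "p \<noteq> 0" "poly p x = 0"
  using assms by (auto simp: is_min_poly_def)

lemma is_min_poly_degree_le:
  "is_min_poly F x p \<Longrightarrow> q \<in> polys_over F \<Longrightarrow> q \<noteq> 0 \<Longrightarrow> poly q x = 0
    \<Longrightarrow> Polynomial.degree p \<le> Polynomial.degree q"
  by (simp add: is_min_poly_def)

context
  fixes F :: "'a::field set"
  assumes F: "is_subfield F"
begin

lemma min_poly_exists: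
  assumes "algebraic_over F x"
  shows "\<exists>p. is_min_poly F x p"
proof -
  define Q where "Q = (\<lambda>p. p \<in> polys_over F \<and> p \<noteq> 0 \<and> poly p x = 0)"
  have "\<exists>p. Q p" using assms by (auto simp: algebraic_over_def Q_def)
  then obtain p where p: "Q p" and min: "\<And>q. Q q \<Longrightarrow> Polynomial.degree p \<le> Polynomial.degree q"
    using ex_has_least_nat[of Q _ Polynomial.degree] by blast
  define p' where "p' = Polynomial.smult (inverse (lead_coeff p)) p"
  have "lead_coeff p \<noteq> 0" using p by (auto simp: Q_def)
  then have "is_min_poly F x p'" unfolding is_min_poly_def p'_def
    using p min by (auto simp: Q_def intro!: polys_over_intros[OF F] subfield_intros[OF F] polys_over_coeff)
  then show ?thesis ..
qed

lemma min_poly_mod: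
  assumes "is_min_poly F x p" "q \<in> polys_over F" "poly q x = 0"
  shows "q mod p = 0"
proof (rule ccontr)
  assume nz: "q mod p \<noteq> 0"
  have p: "p \<in> polys_over F" "poly p x = 0" "p \<noteq> 0" using assms by (auto simp: is_min_poly_def)
  have "poly (q mod p) x = 0" using p assms
    by (metis add.left_neutral div_mult_mod_eq mult_zero_right poly_add poly_mult)
  moreover have "q mod p \<in> polys_over F" by (rule polys_over_mod[OF F assms(2) p(1)])
  ultimately have "Polynomial.degree p \<le> Polynomial.degree (q mod p)"
    using nz assms(1) by (auto simp: is_min_poly_def)
  then show False using degree_mod_less'[OF p(3) nz] by simp
qed

lemma min_poly_dvd:
  assumes "is_min_poly F x p" "q \<in> polys_over F" "poly q x = 0"
  obtains r where "r \<in> polys_over F" "q = p * r"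
proof
  show "q div p \<in> polys_over F"
    using polys_over_div[OF F assms(2)] assms(1) by (auto simp: is_min_poly_def)
  show "q = p * (q div p)" using min_poly_mod[OF assms] by (metis add.right_neutral mult_div_mod_eq)
qed

lemma min_poly_unique:
  assumes "is_min_poly F x p" "is_min_poly F x q"
  shows "p = q"
proof -
  have "p dvd q" "q dvd p"
    using min_poly_mod[OF assms(1), of q] min_poly_mod[OF assms(2), of p]
      is_min_polyD[OF assms(1)] is_min_polyD[OF assms(2)]
    by (simp_all add: mod_eq_0_iff_dvd)
  then obtain c where c: "q = p * c" by (auto elim: dvdE)
  have "p \<noteq> 0" "q \<noteq> 0" using assms by (simp_all add: is_min_polyD(3))
  with \<open>q dvd p\<close> have "c dvd 1" "c \<noteq> 0" unfolding c
    using dvd_times_left_cancel_iff[of p c 1] by auto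
  have "lead_coeff q = lead_coeff p * lead_coeff c" unfolding c by (simp only: lead_coeff_mult)
  moreover have "Polynomial.degree c = 0" using \<open>c dvd 1\<close> \<open>c \<noteq> 0\<close> by (simp add: is_unit_iff_degree)
  ultimately have "c = 1" using assms
    using is_min_polyD(2)[OF assms(1)] is_min_polyD(2)[OF assms(2)] \<open>lead_coeff q = _\<close>
    by (metis degree_eq_zeroE coeff_pCons_0 degree_pCons_0 mult_1 one_pCons)
  then show ?thesis by (simp add: c)
qed

lemma min_poly_degree_pos:
  assumes "is_min_poly F x p"
  shows "Polynomial.degree p > 0"
proof (rule ccontr)
  assume "\<not> Polynomial.degree p > 0"
  then obtain c where "p = [:c:]" by (metis degree_eq_zeroE neq0_conv)
  then show False using assms by (auto simp: is_min_poly_def)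
qed

lemma min_poly_algebraic: "is_min_poly F x p \<Longrightarrow> algebraic_over F x"
  unfolding is_min_poly_def algebraic_over_def by (auto intro!: bexI[of _ p])

text \<open>If \<open>q\<close> is the minimal polynomial of \<open>y\<close>, then
  \<open>p = q * r\<close>. The cofactor \<open>r\<close> has too small a degree to vanish at
  \<open>x\<close>, so \<open>q\<close> does, and minimality of \<open>p\<close> bounds its degree
  by that of \<open>q\<close>.\<close>

lemma min_poly_conjugate:
  assumes p: "is_min_poly F x p" and y: "poly p y = 0"
  shows "is_min_poly F y p"
proof -
  have pF: "p \<in> polys_over F" "p \<noteq> 0" "lead_coeff p = 1" "poly p x = 0"
    using p by (auto simp: is_min_poly_def)
  have "algebraic_over F y" using pF y by (auto simp: algebraic_over_def)
  then obtain q where q: "is_min_poly F y q" using min_poly_exists by blast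
  obtain r where r: "r \<in> polys_over F" "p = q * r" using min_poly_dvd[OF q pF(1) y] .
  have qr: "q \<in> polys_over F" "q \<noteq> 0" "r \<noteq> 0" using is_min_polyD[OF q] pF r by auto
  have deg: "Polynomial.degree p = Polynomial.degree q + Polynomial.degree r"
    using qr r by (simp add: degree_mult_eq)
  have "poly r x \<noteq> 0"
  proof
    assume "poly r x = 0"
    then have "Polynomial.degree p \<le> Polynomial.degree r" by (intro is_min_poly_degree_le[OF p] r qr)
    then show False using deg min_poly_degree_pos[OF q] by simp
  qed
  then have "poly q x = 0" using pF r by auto
  then have "Polynomial.degree p \<le> Polynomial.degree q" by (intro is_min_poly_degree_le[OF p] qr)
  moreover have "Polynomial.degree q \<le> Polynomial.degree q'"
    if "q' \<in> polys_over F" "q' \<noteq> 0" "poly q' y = 0" for q'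
    using q that by (simp add: is_min_poly_def)
  ultimately have "\<forall>q'\<in>polys_over F. q' \<noteq> 0 \<and> poly q' y = 0 \<longrightarrow> Polynomial.degree p \<le> Polynomial.degree q'"
    using order_trans by blast
  then show ?thesis unfolding is_min_poly_def using pF y by blast
qed

lemma min_poly_linear_in_subfield:
  assumes "is_min_poly F x p" "Polynomial.degree p = 1"
  shows "x \<in> F"
proof -
  obtain a b where p: "p = [:a, b:]" using assms(2)
    by (metis One_nat_def degree_pCons_eq_if degree_eq_zeroE nat.inject pCons_cases zero_neq_one)
  then have "p = [:a, 1:]" using is_min_polyD[OF assms(1)] by (auto split: if_splits)
  then have "x = - a" "a \<in> F"
    using is_min_polyD[OF assms(1)] polys_over_coeff[of p F 0] by (auto simp: eq_neg_iff_add_eq_0 add.commute)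
  then show ?thesis by (simp add: subfield_uminus[OF F])
qed

text \<open>Euclid's algorithm read at \<open>x\<close>: with \<open>p = a * q + b\<close>, the
  value of \<open>b\<close> at \<open>x\<close> is a multiple of that of \<open>q\<close>, so an
  inverse of the former gives one of the latter.\<close>

lemma min_poly_inverse:
  assumes p: "is_min_poly F x p"
  shows "q \<in> polys_over F \<Longrightarrow> Polynomial.degree q < Polynomial.degree p \<Longrightarrow> poly q x \<noteq> 0
    \<Longrightarrow> \<exists>r\<in>polys_over F. poly r x * poly q x = 1"
proof (induction "Polynomial.degree q" arbitrary: q rule: less_induct)
  case less
  have pF: "p \<in> polys_over F" "poly p x = 0" using is_min_polyD[OF p] by auto
  show ?case
  proof (cases "Polynomial.degree q = 0")
    case True
    then obtain c where c: "q = [:c:]" by (metis degree_eq_zeroE)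
    then have "c \<in> F" "c \<noteq> 0" using less.prems polys_over_coeff[of q F 0] by auto
    then show ?thesis using c
      by (intro bexI[of _ "[:inverse c:]"] polys_over_const[OF F] subfield_inverse[OF F]) auto
  next
    case False
    define a b where "a = p div q" and "b = p mod q"
    have ab: "a \<in> polys_over F" "b \<in> polys_over F" unfolding a_def b_def
      by (intro polys_over_div[OF F] polys_over_mod[OF F] pF less.prems)+
    have eq: "p = a * q + b" by (simp add: a_def b_def)
    have "q \<noteq> 0" using False by auto
    then have db: "b = 0 \<or> Polynomial.degree b < Polynomial.degree q"
      unfolding b_def using degree_mod_less by blast
    then have db': "Polynomial.degree b < Polynomial.degree p" using less.prems False by auto
    have eqx: "poly a x * poly q x + poly b x = 0" using eq pF by (metis poly_add poly_mult)
    \<comment> \<open>Otherwise \<open>b = 0\<close> by minimality, and \<open>x\<close> would be a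
      root of the cofactor \<open>a\<close>, whose degree is below that of \<open>p\<close>.\<close>
    have "poly b x \<noteq> 0"
    proof
      assume "poly b x = 0"
      then have "b = 0" using is_min_poly_degree_le[OF p ab(2)] db' by fastforce
      then have "a \<noteq> 0" using eq min_poly_degree_pos[OF p] by auto
      then have "Polynomial.degree p = Polynomial.degree a + Polynomial.degree q"
        using eq \<open>b = 0\<close> \<open>q \<noteq> 0\<close> by (simp add: degree_mult_eq)
      moreover have "poly a x = 0" using eqx \<open>poly b x = 0\<close> less.prems by simp
      moreover have "Polynomial.degree p \<le> Polynomial.degree a"
        by (intro is_min_poly_degree_le[OF p] ab \<open>a \<noteq> 0\<close> \<open>poly a x = 0\<close>)
      ultimately show False using False by simp
    qed
    then have "b \<noteq> 0" by auto
    then obtain r where r: "r \<in> polys_over F" "poly r x * poly b x = 1"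
      using less.hyps[of b] db db' ab \<open>poly b x \<noteq> 0\<close> by auto
    have "poly b x = - (poly a x * poly q x)" using eqx by (simp add: eq_neg_iff_add_eq_0 add.commute)
    then have "poly (- r * a) x * poly q x = 1" using r by (simp add: mult.assoc)
    then show ?thesis using r ab by (intro bexI[of _ "- r * a"] polys_over_intros[OF F]) auto
  qed
qed

lemma poly_in_adjoin:
  assumes "q \<in> polys_over F"
  shows "poly q x \<in> adjoin F {x}"
proof (rule poly_in_subfield[OF is_subfield_adjoin])
  show "q \<in> polys_over (adjoin F {x})"
    by (rule polys_over_mono[OF _ assms]) (intro subsetI adjoin_base)
qed (intro adjoin_gen singletonI)

lemma adjoin_simple_algebraic:
  assumes p: "is_min_poly F x p"
  shows "adjoin F {x} = {poly q x |q. q \<in> polys_over F \<and> Polynomial.degree q < Polynomial.degree p}"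
    (is "_ = ?A")
proof
  have pF: "p \<in> polys_over F" "poly p x = 0" "p \<noteq> 0" using is_min_polyD[OF p] by auto
  have memI: "poly q x \<in> ?A" if "q \<in> polys_over F" for q
  proof -
    have "poly q x = poly (q mod p) x"
      using pF by (metis add.left_neutral div_mult_mod_eq mult_zero_right poly_add poly_mult)
    moreover have "q mod p \<in> polys_over F" by (rule polys_over_mod[OF F that pF(1)])
    moreover have "Polynomial.degree (q mod p) < Polynomial.degree p"
      using degree_mod_less[OF pF(3), of q] min_poly_degree_pos[OF p] by auto
    ultimately show ?thesis by blast
  qed
  have "is_subfield ?A"
  proof (rule is_subfieldI)
    show "1 \<in> ?A" using memI[OF polys_over_1[OF F]] by simp
  next
    fix u v assume "u \<in> ?A" "v \<in> ?A"
    then obtain q r where "u = poly q x" "v = poly r x" "q \<in> polys_over F" "r \<in> polys_over F" by auto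
    then show "u + v \<in> ?A" "u * v \<in> ?A" using memI[of "q + r"] memI[of "q * r"]
      by (auto simp: polys_over_intros[OF F])
  next
    fix u assume "u \<in> ?A"
    then obtain q where q: "u = poly q x" "q \<in> polys_over F" "Polynomial.degree q < Polynomial.degree p" by auto
    then show "- u \<in> ?A" using memI[of "- q"] by (auto simp: polys_over_intros[OF F])
    assume "u \<noteq> 0"
    then obtain r where "r \<in> polys_over F" "poly r x * u = 1" using min_poly_inverse[OF p, of q] q by auto
    then have "inverse u = poly r x" by (intro inverse_unique) (simp add: mult.commute)
    then show "inverse u \<in> ?A" using memI[OF \<open>r \<in> polys_over F\<close>] by simp
  qed
  moreover have "F \<subseteq> ?A" using memI[OF polys_over_const[OF F]] by auto
  moreover have "x \<in> ?A" using memI[of "[:0, 1:]"] by (auto simp: polys_over_intros[OF F] subfield_intros[OF F])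
  ultimately show "adjoin F {x} \<subseteq> ?A" by (intro adjoin_subset) auto
  show "?A \<subseteq> adjoin F {x}"
  proof
    fix u assume "u \<in> ?A"
    then obtain q where "u = poly q x" "q \<in> polys_over F" by auto
    then show "u \<in> adjoin F {x}" by (simp only: poly_in_adjoin)
  qed
qed

lemma adjoin_simple_quotients:
  "adjoin F {x} = {poly q x / poly r x |q r. q \<in> polys_over F \<and> r \<in> polys_over F \<and> poly r x \<noteq> 0}"
    (is "_ = ?A")
proof
  have memI: "poly q x / poly r x \<in> ?A" if "q \<in> polys_over F" "r \<in> polys_over F" "poly r x \<noteq> 0" for q r
    using that by blast
  have polyI: "poly q x \<in> ?A" if "q \<in> polys_over F" for q
    using memI[of q 1] that by (simp add: polys_over_1[OF F])
  have "is_subfield ?A"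
  proof (rule is_subfieldI)
    show "1 \<in> ?A" using polyI[OF polys_over_1[OF F]] by simp
  next
    fix u v assume "u \<in> ?A" "v \<in> ?A"
    then obtain q r q' r' where *: "u = poly q x / poly r x" "v = poly q' x / poly r' x"
      "q \<in> polys_over F" "r \<in> polys_over F" "q' \<in> polys_over F" "r' \<in> polys_over F"
      "poly r x \<noteq> 0" "poly r' x \<noteq> 0" by auto
    have "u + v = poly (q * r' + q' * r) x / poly (r * r') x" "u * v = poly (q * q') x / poly (r * r') x"
      using * by (simp_all add: add_divide_distrib mult_ac)
    then show "u + v \<in> ?A" "u * v \<in> ?A"
      using * memI[of "q * r' + q' * r" "r * r'"] memI[of "q * q'" "r * r'"]
      by (simp_all add: polys_over_intros[OF F] del: poly_mult poly_add) (simp_all)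
  next
    fix u assume "u \<in> ?A"
    then obtain q r where *: "u = poly q x / poly r x" "q \<in> polys_over F" "r \<in> polys_over F" "poly r x \<noteq> 0"
      by auto
    then show "- u \<in> ?A" using memI[of "- q" r] by (auto simp: polys_over_intros[OF F])
    assume "u \<noteq> 0"
    then show "inverse u \<in> ?A" using memI[of r q] * by auto
  qed
  moreover have "F \<subseteq> ?A" using polyI[OF polys_over_const[OF F]] by auto
  moreover have "x \<in> ?A" using polyI[of "[:0, 1:]"] by (auto simp: polys_over_intros[OF F] subfield_intros[OF F])
  ultimately show "adjoin F {x} \<subseteq> ?A" by (intro adjoin_subset) auto
  show "?A \<subseteq> adjoin F {x}"
  proof
    fix u assume "u \<in> ?A"
    then obtain q r where "u = poly q x / poly r x" "q \<in> polys_over F" "r \<in> polys_over F" by auto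
    then show "u \<in> adjoin F {x}" by (simp only: poly_in_adjoin subfield_divide[OF is_subfield_adjoin])
  qed
qed

end

section \<open>Algebraic elements\<close>

lemma algebraic_over_mono: "F \<subseteq> E \<Longrightarrow> algebraic_over F x \<Longrightarrow> algebraic_over E x"
  unfolding algebraic_over_def using polys_over_mono by blast

lemma algebraic_over_base: "is_subfield F \<Longrightarrow> x \<in> F \<Longrightarrow> algebraic_over F x"
  unfolding algebraic_over_def
  by (rule bexI[of _ "[:- x, 1:]"]) (auto intro!: polys_over_linear subfield_uminus subfield_one)

context
  fixes F :: "'a::field set"
  assumes F: "is_subfield F"
begin

interpretation R: field "ring_of_type_algebra :: 'a ring" by (rule field_from_type_algebra)

lemma ring_of_type_algebra_nat_pow: "x [^]\<^bsub>ring_of_type_algebra\<^esub> (n::nat) = (x ^ n :: 'a)"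
  by (induction n) (simp_all add: mult.commute)

lemma ring_of_type_algebra_eval: "R.eval cs x = poly (Poly (rev cs)) x"
  by (induction cs) (simp_all add: Poly_snoc poly_monom ring_of_type_algebra_nat_pow)

text \<open>HOL-Algebra lists coefficients from the leading one downwards, hence the reversal. The
  equivalence imports its theorems on finite-dimensional and algebraic extensions.\<close>

lemma algebraic_over_iff: "algebraic_over F x \<longleftrightarrow> (R.algebraic over F) x"
proof
  assume "algebraic_over F x"
  then obtain p where p: "p \<in> polys_over F" "p \<noteq> 0" "poly p x = 0" by (auto simp: algebraic_over_def)
  have "rev (coeffs p) \<in> carrier (F[X]\<^bsub>ring_of_type_algebra\<^esub>)"
    unfolding univ_poly_carrier[symmetric] polynomial_def
    using p by (auto simp: hd_rev last_coeffs_eq_coeff_degree coeffs_def polys_over_coeff)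
  then show "(R.algebraic over F) x"
    by (rule R.algebraicI) (use p in \<open>auto simp: ring_of_type_algebra_eval\<close>)
next
  assume "(R.algebraic over F) x"
  then obtain cs where cs: "cs \<in> carrier (F[X]\<^bsub>ring_of_type_algebra\<^esub>)" "cs \<noteq> []" "R.eval cs x = 0"
    using R.algebraicE[OF subfieldE(1)[OF F]] by auto
  then have 1: "set cs \<subseteq> F" "hd cs \<noteq> 0"
    unfolding univ_poly_carrier[symmetric] polynomial_def by auto
  have "Poly (rev cs) \<in> polys_over F"
    using 1 subfield_zero[OF F] by (intro polys_overI) (auto simp: coeff_Poly_eq nth_default_def rev_nth)
  moreover have "Poly (rev cs) \<noteq> 0"
    using 1 cs by (auto simp: Poly_eq_0 rev_swap)
  ultimately show "algebraic_over F x" using cs unfolding algebraic_over_def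
    by (auto simp: ring_of_type_algebra_eval)
qed

end

context
  fixes F :: "'a::field set"
  assumes F: "is_subfield F"
begin

interpretation R: field "ring_of_type_algebra :: 'a ring" by (rule field_from_type_algebra)

lemma is_subfield_algebraics: "is_subfield {x. algebraic_over F x}"
  using R.subfield_of_algebraics[OF F] by (simp add: algebraic_over_iff[OF F])

text \<open>The finitely many coefficients of a relation for \<open>x\<close> generate an extension
  of finite dimension over \<open>F\<close>, adjoining \<open>x\<close> keeps it finite-dimensional,
  and elements of finite-dimensional extensions are algebraic.\<close>

lemma algebraic_over_trans:
  assumes "algebraic_over {y. algebraic_over F y} x"
  shows "algebraic_over F x"
proof -
  obtain p where p: "p \<in> polys_over {y. algebraic_over F y}" "p \<noteq> 0" "poly p x = 0"
    using assms by (auto simp: algebraic_over_def)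
  define ys where "ys = coeffs p"
  define L where "L = R.finite_extension F ys"
  have ys: "(R.algebraic over F) y" if "y \<in> set ys" for y
    using that p by (auto simp: ys_def coeffs_def polys_over_def algebraic_over_iff[OF F] split: if_splits)
  have L: "subfield L ring_of_type_algebra" unfolding L_def
    by (rule R.finite_extension_is_subfield[OF F]) (use ys in auto)
  have "set ys \<subseteq> L" unfolding L_def
    using R.finite_extension_mem[OF subfieldE(1)[OF F], of ys] by auto
  then have "p \<in> polys_over L"
    using subfield_zero[OF L] by (intro polys_overI) (metis coeff_in_coeffs le_degree p(2) subsetD ys_def)
  then have "algebraic_over L x" using p by (auto simp: algebraic_over_def)
  then have alg: "(R.algebraic over L) x" using algebraic_over_iff[OF L] by simp
  have "R.finite_dimension F L" unfolding L_def
    by (rule R.finite_extension_finite_dimension(1)[OF F]) (use ys in auto)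
  moreover have "R.finite_dimension L (R.simple_extension L x)"
    using R.finite_dimension_simple_extension[OF L] alg by simp
  ultimately have "R.finite_dimension F (R.simple_extension L x)"
    using R.telescopic_base_dim(1)[OF F L] by blast
  then have "(R.algebraic over F) x"
    using R.finite_dimension_imp_algebraic[OF F R.simple_extension_is_subring[OF subfieldE(1)[OF L]], of x x]
      R.simple_extension_mem[OF subfieldE(1)[OF L], of x] by simp
  then show ?thesis by (simp add: algebraic_over_iff[OF F])
qed

end

section \<open>Separable elements\<close>

lemma degree_pderiv_less:
  fixes p :: "'a::field poly"
  assumes "pderiv p \<noteq> 0"
  shows "Polynomial.degree (pderiv p) < Polynomial.degree p"
proof -
  have pos: "Polynomial.degree p > 0"
    using assms by (metis degree_eq_zeroE gr0I pderiv_pCons pderiv_0 add_0 pCons_0_0)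
  have "Polynomial.degree (pderiv p) \<le> Polynomial.degree p - 1"
    by (rule degree_le) (auto simp: coeff_pderiv coeff_eq_0)
  then show ?thesis using pos by simp
qed

text \<open>Over an algebraically closed field the roots form a multiset; a repeated entry would be
  a common root of \<open>p\<close> and its derivative, so the multiset is a set.\<close>

lemma rsquarefree_monic_factorization:
  fixes p :: "'a::alg_closed_field poly"
  assumes "rsquarefree p" "lead_coeff p = 1"
  shows "p = (\<Prod>a\<in>{a. poly p a = 0}. [:- a, 1:])"
proof -
  have "p \<noteq> 0" using assms(2) by auto
  then obtain A where "p = Polynomial.smult (lead_coeff p) (\<Prod>y\<in>#A. [:- y, 1:])"
    using alg_closed_imp_factorization[of p] by blast
  then have A: "p = (\<Prod>y\<in>#A. [:- y, 1:])" using assms(2) by simp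
  have roots: "{a. poly p a = 0} = set_mset A"
    by (subst A) (auto simp: poly_prod_mset prod_mset_zero_iff)
  have "count A y = 1" if "y \<in># A" for y
  proof -
    have "\<not> {#y, y#} \<subseteq># A"
    proof
      assume "{#y, y#} \<subseteq># A"
      then obtain B where "A = {#y, y#} + B" by (metis mset_subset_eq_exists_conv)
      then have "p = [:- y, 1:] * ([:- y, 1:] * (\<Prod>y\<in>#B. [:- y, 1:]))" using A by simp
      then have "poly p y = 0" "poly (pderiv p) y = 0"
        by (simp_all add: pderiv_mult pderiv_pCons del: mult_pCons_left)
      then show False using assms(1) rsquarefree_iff_pderiv[OF \<open>p \<noteq> 0\<close>] by blast
    qed
    moreover have "{#y, y#} \<subseteq># A" if "count A y \<ge> 2"
      using that by (simp add: subseteq_mset_def)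
    ultimately have "\<not> count A y \<ge> 2" by blast
    moreover have "count A y > 0" using that by simp
    ultimately show ?thesis by linarith
  qed
  then have "A = mset_set (set_mset A)"
    by (intro multiset_eqI) (auto simp: count_mset_set' not_in_iff)
  then have "(\<Prod>y\<in>#A. [:- y, 1:]) = (\<Prod>a\<in>set_mset A. [:- a, 1:])"
    by (metis prod_unfold_prod_mset)
  then show ?thesis using A roots by simp
qed

lemma degree_prod_linear: "finite A \<Longrightarrow> Polynomial.degree (\<Prod>a\<in>A. [:- g a, 1 :: 'a::field:]) = card A"
  by (subst degree_prod_eq_sum_degree) auto

lemma rsquarefree_monic_card_roots:
  fixes p :: "'a::alg_closed_field poly"
  assumes "rsquarefree p" "lead_coeff p = 1"
  shows "card {a. poly p a = 0} = Polynomial.degree p"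
proof -
  have "p \<noteq> 0" using assms(2) by auto
  then have "Polynomial.degree (\<Prod>a\<in>{a. poly p a = 0}. [:- a, 1:]) = card {a. poly p a = 0}"
    by (intro degree_prod_linear poly_roots_finite)
  then show ?thesis using rsquarefree_monic_factorization[OF assms] by simp
qed

context
  fixes F :: "'a::alg_closed_field set"
  assumes F: "is_subfield F"
begin

text \<open>Replaces the minimal polynomial by any polynomial with a simple root at
  \<open>x\<close>. A simple root of a multiple of the minimal polynomial \<open>p\<close> is simple
  for \<open>p\<close>; then \<open>pderiv p\<close> is nonzero of smaller degree and, as
  \<open>p\<close> is minimal for each of its roots, vanishes at none of them.\<close>

lemma separable_over_iff_simple_root:
  "separable_over F x \<longleftrightarrow> (\<exists>P\<in>polys_over F. poly P x = 0 \<and> poly (pderiv P) x \<noteq> 0)"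
proof
  assume "separable_over F x"
  then obtain p where p: "is_min_poly F x p" "rsquarefree p" by (auto simp: separable_over_def)
  then show "\<exists>P\<in>polys_over F. poly P x = 0 \<and> poly (pderiv P) x \<noteq> 0"
    using is_min_polyD[OF p(1)] rsquarefree_iff_pderiv[of p] by blast
next
  assume "\<exists>P\<in>polys_over F. poly P x = 0 \<and> poly (pderiv P) x \<noteq> 0"
  then obtain P where P: "P \<in> polys_over F" "poly P x = 0" "poly (pderiv P) x \<noteq> 0" by blast
  then have "P \<noteq> 0" by auto
  then have "algebraic_over F x" using P by (auto simp: algebraic_over_def)
  then obtain p where p: "is_min_poly F x p" using min_poly_exists[OF F] by blast
  note pD = is_min_polyD[OF p]
  obtain r where r: "P = p * r" using min_poly_dvd[OF F p P(1,2)] .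
  have "poly (pderiv p) x \<noteq> 0" using P(3) pD(4) by (auto simp: r pderiv_mult)
  then have nz: "pderiv p \<noteq> 0" by auto
  have "poly (pderiv p) y \<noteq> 0" if "poly p y = 0" for y
  proof
    assume "poly (pderiv p) y = 0"
    then have "Polynomial.degree p \<le> Polynomial.degree (pderiv p)"
      by (intro is_min_poly_degree_le[OF min_poly_conjugate[OF F p that]] polys_over_pderiv[OF F] pD nz)
    then show False using degree_pderiv_less[OF nz] by simp
  qed
  then have "rsquarefree p" using rsquarefree_iff_pderiv[OF pD(3)] by blast
  then show "separable_over F x" using p by (auto simp: separable_over_def)
qed

lemma separable_over_base: "x \<in> F \<Longrightarrow> separable_over F x"
  unfolding separable_over_iff_simple_root
  by (rule bexI[of _ "[:- x, 1:]"])
    (auto simp: pderiv_pCons intro!: polys_over_linear[OF F] subfield_uminus[OF F] subfield_one[OF F])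

lemma separable_imp_algebraic: "separable_over F x \<Longrightarrow> algebraic_over F x"
  using min_poly_algebraic[OF F] by (auto simp: separable_over_def)

lemma separable_over_CHAR_0:
  assumes "CHAR('a) = 0" "algebraic_over F x"
  shows "separable_over F x"
proof -
  obtain p where p: "is_min_poly F x p" using min_poly_exists[OF F assms(2)] by blast
  note pD = is_min_polyD[OF p]
  define d where "d = Polynomial.degree p"
  have "d > 0" using min_poly_degree_pos[OF F p] by (simp add: d_def)
  then have "Polynomial.coeff (pderiv p) (d - 1) = of_nat d * lead_coeff p"
    by (simp add: coeff_pderiv d_def)
  also have "\<dots> \<noteq> 0" using pD \<open>d > 0\<close> assms(1) by (simp add: CHAR_eq0_iff)
  finally have nz: "pderiv p \<noteq> 0" by auto
  have "poly (pderiv p) x \<noteq> 0"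
  proof
    assume "poly (pderiv p) x = 0"
    then have "Polynomial.degree p \<le> Polynomial.degree (pderiv p)"
      by (intro is_min_poly_degree_le[OF p] polys_over_pderiv[OF F] pD nz)
    then show False using degree_pderiv_less[OF nz] by simp
  qed
  then show ?thesis unfolding separable_over_iff_simple_root using pD by blast
qed

end

lemma separable_over_mono:
  assumes "is_subfield F" "is_subfield E" "F \<subseteq> E" "separable_over F x"
  shows "separable_over E x"
  using assms polys_over_mono[OF assms(3)]
  unfolding separable_over_iff_simple_root[OF assms(1)] separable_over_iff_simple_root[OF assms(2)] by blast

text \<open>A basis \<open>1, x, \<dots>\<close> of \<open>E1(x)\<close> over \<open>E1\<close> stays linearly independent over a purely
  inseparable \<open>E\<close>, because the \<open>p\<close>-th power of a linear relation is a polynomial over \<open>E1\<close> having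
  all the distinct conjugates of \<open>x\<close> as roots.\<close>

lemma purely_inseparable_inter_separable:
  fixes E1 E :: "'a::alg_closed_field set"
  assumes p: "prime p" "p = CHAR('a)"
    and E1: "is_subfield E1" and E: "is_subfield E" and sub: "E1 \<subseteq> E"
    and frob: "\<And>u. u \<in> E \<Longrightarrow> u ^ p \<in> E1"
    and x: "separable_over E1 x"
    and z: "z \<in> E" "z \<in> adjoin E1 {x}"
  shows "z \<in> E1"
proof -
  obtain \<mu> where mu: "is_min_poly E1 x \<mu>" "rsquarefree \<mu>" using x by (auto simp: separable_over_def)
  note muD = is_min_polyD[OF mu(1)]
  obtain q where q: "q \<in> polys_over E1" "Polynomial.degree q < Polynomial.degree \<mu>" "z = poly q x"
    using z(2) unfolding adjoin_simple_algebraic[OF E1 mu(1)] by blast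
  define g where "g = q - [:z:]"
  have gE: "g \<in> polys_over E" unfolding g_def
    using polys_over_mono[OF sub q(1)] z(1) by (intro polys_over_diff[OF E] polys_over_const[OF E])
  have gx: "poly g x = 0" by (simp add: g_def q)
  have dg: "Polynomial.degree g < Polynomial.degree \<mu>"
    unfolding g_def using q(2) min_poly_degree_pos[OF E1 mu(1)] by (intro degree_diff_less) auto
  define g1 where "g1 = (\<Sum>i\<le>Polynomial.degree g. Polynomial.monom (Polynomial.coeff g i ^ p) (i * p))"
  have g1: "poly g1 y = poly g y ^ p" for y
  proof -
    have "poly g y ^ p = (\<Sum>i\<le>Polynomial.degree g. (Polynomial.coeff g i * y ^ i) ^ p)"
      unfolding poly_altdef by (rule freshmans_dream_sum) (use p in auto)
    also have "\<dots> = poly g1 y"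
      by (simp add: g1_def poly_sum poly_monom power_mult_distrib power_mult)
    finally show ?thesis ..
  qed
  have g1E: "g1 \<in> polys_over E1" unfolding g1_def
    by (intro polys_over_sum[OF E1] polys_over_monom[OF E1] frob polys_over_coeff[OF gE])
  have "p > 0" using p(1) by (rule prime_gt_0_nat)
  then have "poly g1 x = 0" using gx by (simp add: g1)
  then obtain r where "g1 = \<mu> * r" using min_poly_dvd[OF E1 mu(1) g1E] by blast
  have roots: "{y. poly \<mu> y = 0} \<subseteq> {y. poly g y = 0}"
  proof
    fix y assume "y \<in> {y. poly \<mu> y = 0}"
    then have "poly g1 y = 0" using \<open>g1 = \<mu> * r\<close> by simp
    then show "y \<in> {y. poly g y = 0}" by (simp add: g1)
  qed
  have "card {y. poly \<mu> y = 0} = Polynomial.degree \<mu>"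
    by (rule rsquarefree_monic_card_roots[OF mu(2) muD(2)])
  moreover have "card {y. poly \<mu> y = 0} \<le> card {y. poly g y = 0}" if "g \<noteq> 0"
    by (rule card_mono[OF poly_roots_finite[OF that] roots])
  ultimately have "g = 0" using card_poly_roots_bound[of g] dg by force
  then have "q = [:z:]" by (simp add: g_def)
  then show ?thesis using polys_over_coeff[OF q(1), of 0] by simp
qed

section \<open>Towers of separable extensions\<close>

fun separable_tower :: "'a::alg_closed_field set \<Rightarrow> 'a list \<Rightarrow> bool" where
  "separable_tower F [] \<longleftrightarrow> True"
| "separable_tower F (x # xs) \<longleftrightarrow> separable_over F x \<and> separable_tower (adjoin F {x}) xs"

lemma separable_tower_mono:
  "is_subfield F \<Longrightarrow> is_subfield E \<Longrightarrow> F \<subseteq> E \<Longrightarrow> separable_tower F xs \<Longrightarrow> separable_tower E xs"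
proof (induction xs arbitrary: F E)
  case (Cons x xs)
  have "separable_over E x"
    using separable_over_mono[OF Cons.prems(1-3)] Cons.prems(4) by simp
  moreover have "separable_tower (adjoin E {x}) xs"
    by (rule Cons.IH[OF is_subfield_adjoin is_subfield_adjoin adjoin_mono[OF Cons.prems(3) order_refl]])
      (use Cons.prems(4) in simp)
  ultimately show ?case by simp
qed simp

lemma adjoin_list_Cons: "adjoin (adjoin F {x}) (set xs) = adjoin F (set (x # xs))"
  unfolding adjoin_adjoin by simp

lemma separable_tower_snoc:
  assumes "is_subfield F"
  shows "separable_tower F (xs @ [x]) \<longleftrightarrow> separable_tower F xs \<and> separable_over (adjoin F (set xs)) x"
  using assms
proof (induction xs arbitrary: F)
  case Nil
  have "adjoin F {} = F" by (rule adjoin_trivial) (use Nil in auto)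
  then show ?case by simp
next
  case (Cons y ys)
  show ?case using Cons.IH[OF is_subfield_adjoin[of F "{y}"]] unfolding adjoin_list_Cons by simp
qed

text \<open>Induction along the tower: adjoining \<open>x\<close> to both fields preserves the
  hypothesis on \<open>p\<close>-th powers, so \<open>z\<close> is caught in
  \<open>adjoin E1 {x}\<close>, and the case of a single separable element brings it down to
  \<open>E1\<close>.\<close>

lemma separable_tower_inseparable_inter:
  fixes E1 E :: "'a::alg_closed_field set"
  assumes p: "prime p" "p = CHAR('a)"
  shows "is_subfield E1 \<Longrightarrow> is_subfield E \<Longrightarrow> E1 \<subseteq> E \<Longrightarrow> (\<And>u. u \<in> E \<Longrightarrow> u ^ p \<in> E1)
    \<Longrightarrow> separable_tower E1 xs \<Longrightarrow> z \<in> E \<Longrightarrow> z \<in> adjoin E1 (set xs) \<Longrightarrow> z \<in> E1"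
proof (induction xs arbitrary: E1 E)
  case Nil
  have "adjoin E1 {} = E1" by (rule adjoin_trivial) (use Nil in auto)
  then show ?case using Nil by simp
next
  case (Cons x xs)
  let ?E1 = "adjoin E1 {x}" and ?E = "adjoin E {x}"
  have CH: "prime CHAR('a)" using p by simp
  have "p > 0" using p(1) by (rule prime_gt_0_nat)
  \<comment> \<open>The elements whose \<open>p\<close>-th power lies in the smaller field form a
    field by additivity of the Frobenius map; it contains \<open>E\<close> and \<open>x\<close>,
    hence all of \<open>adjoin E {x}\<close>.\<close>
  have "is_subfield {u. u ^ p \<in> ?E1}"
  proof (rule is_subfieldI)
    fix u v assume uv: "u \<in> {u. u ^ p \<in> ?E1}" "v \<in> {u. u ^ p \<in> ?E1}"
    have "(u + v) ^ p = u ^ p + v ^ p" by (rule freshmans_dream) (use p in auto)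
    then show "u + v \<in> {u. u ^ p \<in> ?E1}" "u * v \<in> {u. u ^ p \<in> ?E1}"
      using uv subfield_add[OF is_subfield_adjoin] subfield_mult[OF is_subfield_adjoin]
      by (simp_all add: power_mult_distrib)
  next
    fix u assume u: "u \<in> {u. u ^ p \<in> ?E1}"
    have "(- u) ^ p = - (u ^ p)"
    proof -
      have "(u + (- u)) ^ p = u ^ p + (- u) ^ p" by (rule freshmans_dream) (use p in auto)
      then have "u ^ p + (- u) ^ p = 0" using \<open>p > 0\<close> by (simp add: zero_power)
      then show ?thesis by (simp add: eq_neg_iff_add_eq_0 add.commute)
    qed
    then show "- u \<in> {u. u ^ p \<in> ?E1}" using u subfield_uminus[OF is_subfield_adjoin] by simp
    show "inverse u \<in> {u. u ^ p \<in> ?E1}"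
      using u subfield_inverse[OF is_subfield_adjoin] by (simp add: power_inverse)
  qed (use subfield_one[OF is_subfield_adjoin] in simp)
  moreover have "E \<subseteq> {u. u ^ p \<in> ?E1}" using Cons.prems(4) adjoin_base by blast
  moreover have "{x} \<subseteq> {u. u ^ p \<in> ?E1}"
    using subfield_power[OF is_subfield_adjoin adjoin_gen[of x "{x}"]] by simp
  ultimately have frob: "u ^ p \<in> ?E1" if "u \<in> ?E" for u
    using adjoin_subset that by blast
  have "z \<in> ?E1"
  proof (rule Cons.IH[OF is_subfield_adjoin is_subfield_adjoin])
    show "?E1 \<subseteq> ?E" by (rule adjoin_mono) (use Cons.prems in auto)
    show "separable_tower ?E1 xs" using Cons.prems(5) by simp
    show "z \<in> ?E" using Cons.prems(6) by (rule adjoin_base)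
    show "z \<in> adjoin ?E1 (set xs)" using Cons.prems(7) unfolding adjoin_list_Cons .
  qed (rule frob)
  then show ?case
    using purely_inseparable_inter_separable[OF p Cons.prems(1-4) _ Cons.prems(6)] Cons.prems(5)
    by (meson separable_tower.simps(2))
qed

text \<open>In characteristic zero algebraicity is enough. In characteristic \<open>p\<close>, the
  \<open>p\<close>-th powers of \<open>adjoin F {z}\<close> lie in \<open>adjoin F {z ^ p}\<close>,
  over which the tower is still separable, so the preceding lemma puts \<open>z\<close> itself into
  \<open>adjoin F {z ^ p}\<close>. Writing \<open>z\<close> as a quotient of polynomials in
  \<open>z ^ p\<close> yields a polynomial with the simple root \<open>z\<close>.\<close>

lemma separable_tower_imp_separable:
  fixes F :: "'a::alg_closed_field set"
  assumes F: "is_subfield F" and xs: "separable_tower F xs" and z: "z \<in> adjoin F (set xs)"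
  shows "separable_over F z"
proof (cases "CHAR('a) = 0")
  case True
  have alg: "x \<in> {y. algebraic_over F y}"
    if "is_subfield E" "E \<subseteq> {y. algebraic_over F y}" "separable_tower E xs" "x \<in> set xs" for E x
    using that
  proof (induction xs arbitrary: E)
    case (Cons y ys)
    have "algebraic_over E y" using separable_imp_algebraic[OF Cons.prems(1)] Cons.prems(3) by simp
    then have y: "algebraic_over F y"
      by (rule algebraic_over_trans[OF F algebraic_over_mono[OF Cons.prems(2)]])
    have sub: "adjoin E {y} \<subseteq> {y. algebraic_over F y}"
      by (rule adjoin_subset[OF is_subfield_algebraics[OF F]]) (use y Cons.prems in auto)
    show ?case
    proof (cases "x = y")
      case False
      then show ?thesis using Cons.IH[OF is_subfield_adjoin sub] Cons.prems by simp
    qed (use y in simp)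
  qed simp
  have "F \<subseteq> {y. algebraic_over F y}" using algebraic_over_base[OF F] by blast
  moreover have "set xs \<subseteq> {y. algebraic_over F y}" using alg[OF F calculation xs] by blast
  ultimately have "adjoin F (set xs) \<subseteq> {y. algebraic_over F y}"
    by (rule adjoin_subset[OF is_subfield_algebraics[OF F]])
  then show ?thesis using separable_over_CHAR_0[OF F True] z by blast
next
  case False
  define p where "p = CHAR('a)"
  have p: "prime p" "p = CHAR('a)" using False prime_CHAR_semidom unfolding p_def by auto
  have "p > 0" using p(1) by (rule prime_gt_0_nat)
  let ?E1 = "adjoin F {z ^ p}" and ?E = "adjoin F {z}"
  have "u ^ p \<in> ?E1" if u: "u \<in> ?E" for u
  proof -
    obtain q r where qr: "u = poly q z / poly r z" "q \<in> polys_over F" "r \<in> polys_over F"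
      using u unfolding adjoin_simple_quotients[OF F] by blast
    have *: "poly g z ^ p \<in> ?E1" if g: "g \<in> polys_over F" for g
    proof -
      have "poly g z ^ p = (\<Sum>i\<le>Polynomial.degree g. (Polynomial.coeff g i * z ^ i) ^ p)"
        unfolding poly_altdef by (rule freshmans_dream_sum) (use p in auto)
      also have "\<dots> = (\<Sum>i\<le>Polynomial.degree g. Polynomial.coeff g i ^ p * (z ^ p) ^ i)"
        by (simp add: power_mult_distrib mult.commute flip: power_mult)
      also have "\<dots> \<in> ?E1"
        by (intro subfield_intros[OF is_subfield_adjoin] adjoin_base polys_over_coeff[OF g] adjoin_gen singletonI)
      finally show ?thesis .
    qed
    show ?thesis unfolding qr(1) power_divide
      by (intro subfield_divide[OF is_subfield_adjoin] * qr)
  qed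
  moreover have "?E1 \<subseteq> ?E"
  proof (rule adjoin_subset[OF is_subfield_adjoin])
    show "{z ^ p} \<subseteq> ?E" using subfield_power[OF is_subfield_adjoin adjoin_gen[of z "{z}"]] by simp
  qed (intro subsetI adjoin_base)
  moreover have "F \<subseteq> ?E1" by (intro subsetI adjoin_base)
  moreover have "separable_tower ?E1 xs"
    by (rule separable_tower_mono[OF F is_subfield_adjoin \<open>F \<subseteq> ?E1\<close> xs])
  moreover have "z \<in> adjoin ?E1 (set xs)"
    using adjoin_mono[OF \<open>F \<subseteq> ?E1\<close> order_refl] z by blast
  moreover have "z \<in> ?E" by (intro adjoin_gen singletonI)
  ultimately have "z \<in> ?E1"
    using separable_tower_inseparable_inter[OF p is_subfield_adjoin is_subfield_adjoin] by blast
  then obtain q r where qr: "q \<in> polys_over F" "r \<in> polys_over F" "z = poly q (z ^ p) / poly r (z ^ p)"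
      "poly r (z ^ p) \<noteq> 0"
    unfolding adjoin_simple_quotients[OF F] by blast
  define h where "h = (\<lambda>s::'a poly. pcompose s (Polynomial.monom 1 p))"
  have h: "h s \<in> polys_over F" if "s \<in> polys_over F" for s
    unfolding h_def by (intro polys_over_pcompose[OF F] polys_over_monom[OF F] that subfield_one[OF F])
  have hz: "poly (h s) z = poly s (z ^ p)" for s by (simp add: h_def poly_pcompose poly_monom)
  have hd: "pderiv (h s) = 0" for s
  proof -
    have "pderiv (Polynomial.monom (1::'a) p) = 0" using p(2) by (simp add: pderiv_monom)
    then show ?thesis by (simp add: h_def pderiv_pcompose)
  qed
  \<comment> \<open>Both \<open>h r\<close> and \<open>h q\<close> are polynomials in the
    \<open>p\<close>-th power of the variable and have zero derivative, so \<open>pderiv P\<close>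
    is \<open>h r\<close>, whose value at \<open>z\<close> is the nonzero denominator.\<close>
  define P where "P = [:0, 1:] * h r - h q"
  have "P \<in> polys_over F" unfolding P_def
    by (intro polys_over_diff[OF F] polys_over_mult[OF F] polys_over_linear[OF F] h qr subfield_zero[OF F] subfield_one[OF F])
  moreover have "z * poly r (z ^ p) = poly q (z ^ p)" using qr(3,4) by (metis nonzero_eq_divide_eq)
  then have "poly P z = 0" by (simp add: P_def hz)
  moreover have "poly (pderiv P) z = poly r (z ^ p)"
    by (simp add: P_def pderiv_diff pderiv_mult hd pderiv_pCons hz del: mult_pCons_left)
  ultimately show ?thesis unfolding separable_over_iff_simple_root[OF F] using qr(4) by auto
qed

section \<open>The separable closure and its Galois property\<close>

context
  fixes F :: "'a::alg_closed_field set"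
  assumes F: "is_subfield F"
begin

lemma separable_tower_of_separable: "(\<And>x. x \<in> set xs \<Longrightarrow> separable_over F x) \<Longrightarrow> separable_tower F xs"
proof (induction xs rule: rev_induct)
  case (snoc x xs)
  have "separable_over (adjoin F (set xs)) x"
    by (rule separable_over_mono[OF F is_subfield_adjoin]) (use snoc.prems in \<open>auto intro: adjoin_base\<close>)
  then show ?case using snoc by (simp add: separable_tower_snoc[OF F])
qed simp

lemma separable_closure_base: "F \<subseteq> separable_closure F"
  using separable_over_base[OF F] by (auto simp: separable_closure_def)

lemma is_subfield_separable_closure: "is_subfield (separable_closure F)"
proof -
  have *: "separable_over F z" if "z \<in> adjoin F {x, y}" "separable_over F x" "separable_over F y" for x y z
  proof (rule separable_tower_imp_separable[OF F])
    show "separable_tower F [x, y]" by (rule separable_tower_of_separable) (use that in auto)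
    show "z \<in> adjoin F (set [x, y])" using that(1) by simp
  qed
  have gen: "x \<in> adjoin F {x, y}" "y \<in> adjoin F {x, y}" for x y by (rule adjoin_gen; simp)+
  show ?thesis unfolding separable_closure_def
  proof (rule is_subfieldI)
    show "1 \<in> {x. separable_over F x}" using separable_over_base[OF F subfield_one[OF F]] by simp
  next
    fix x y assume xy: "x \<in> {x. separable_over F x}" "y \<in> {x. separable_over F x}"
    have "x + y \<in> adjoin F {x, y}" "x * y \<in> adjoin F {x, y}"
      by (intro subfield_add[OF is_subfield_adjoin] subfield_mult[OF is_subfield_adjoin] gen)+
    then show "x + y \<in> {x. separable_over F x}" "x * y \<in> {x. separable_over F x}"
      using *[of _ x y] xy by blast+
  next
    fix x assume x: "x \<in> {x. separable_over F x}"
    have "- x \<in> adjoin F {x, x}" "inverse x \<in> adjoin F {x, x}"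
      by (intro subfield_uminus[OF is_subfield_adjoin] subfield_inverse[OF is_subfield_adjoin] gen(1))+
    then show "- x \<in> {x. separable_over F x}" "inverse x \<in> {x. separable_over F x}"
      using *[of _ x x] x by blast+
  qed
qed

text \<open>Transitivity through towers: the coefficients of a polynomial with the simple root
  \<open>x\<close>, each separable over \<open>F\<close>, followed by \<open>x\<close> itself form a
  separable tower.\<close>

lemma separable_closure_separable_closed:
  assumes "separable_over (separable_closure F) x"
  shows "x \<in> separable_closure F"
proof -
  obtain P where P: "P \<in> polys_over (separable_closure F)" "poly P x = 0" "poly (pderiv P) x \<noteq> 0"
    using assms separable_over_iff_simple_root[OF is_subfield_separable_closure] by blast
  define E where "E = adjoin F (set (coeffs P))"
  have E: "is_subfield E" unfolding E_def by (rule is_subfield_adjoin)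
  have "Polynomial.coeff P i \<in> E" for i
  proof (cases "i \<le> Polynomial.degree P \<and> P \<noteq> 0")
    case True
    then have "Polynomial.coeff P i \<in> set (coeffs P)" using coeff_in_coeffs[of P i] by simp
    then show ?thesis unfolding E_def by (rule adjoin_gen)
  next
    case False
    then have "Polynomial.coeff P i = 0" using coeff_eq_0[of P i] by auto
    then show ?thesis using subfield_zero[OF E] by simp
  qed
  then have "separable_over E x"
    using P by (auto simp: separable_over_iff_simple_root[OF E] polys_over_def)
  moreover have "separable_tower F (coeffs P)"
  proof (rule separable_tower_of_separable)
    fix c assume "c \<in> set (coeffs P)"
    then obtain i where "c = Polynomial.coeff P i" by (auto simp: coeffs_def split: if_splits)
    then show "separable_over F c" using polys_over_coeff[OF P(1), of i] by (simp add: separable_closure_def)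
  qed
  ultimately have "separable_tower F (coeffs P @ [x])"
    by (simp only: separable_tower_snoc[OF F] E_def)
  moreover have "x \<in> adjoin F (set (coeffs P @ [x]))" by (rule adjoin_gen) simp
  ultimately show ?thesis
    unfolding separable_closure_def using separable_tower_imp_separable[OF F] by blast
qed

lemma galois_extension_separable_closure: "galois_extension F (separable_closure F)"
proof -
  have fe: "field_extension F (separable_closure F)"
    using F is_subfield_separable_closure separable_closure_base by (simp add: field_extension_def)
  have "y \<in> separable_closure F" if x: "x \<in> separable_closure F" and that: "is_min_poly F x p" "poly p y = 0" for x p y
  proof -
    obtain p' where "is_min_poly F x p'" "rsquarefree p'"
      using x unfolding separable_closure_def separable_over_def by blast
    then have "rsquarefree p" using min_poly_unique[OF F that(1)] by blast
    then show ?thesis using min_poly_conjugate[OF F that(1,2)]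
      unfolding separable_closure_def separable_over_def by blast
  qed
  then show ?thesis unfolding galois_extension_def separable_algebraic_extension_def normal_extension_def
    using fe separable_imp_algebraic[OF F] by (auto simp: separable_closure_def)
qed

end

section \<open>Norms\<close>

text \<open>Euclid's algorithm for resultants: exchanging the roots of \<open>f\<close> and \<open>g\<close> changes the product
  only by a factor in \<open>F\<close>, and then \<open>f\<close> may be reduced modulo \<open>g\<close>.\<close>

lemma prod_mset_poly_roots_in_subfield:
  fixes F :: "'a::alg_closed_field set"
  assumes F: "is_subfield F"
  shows "(\<Prod>a\<in>#A. [:- a, 1:]) \<in> polys_over F \<Longrightarrow> g \<in> polys_over F \<Longrightarrow> (\<Prod>a\<in>#A. poly g a) \<in> F"
proof (induction "Polynomial.degree g" arbitrary: A g rule: less_induct)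
  case less
  show ?case
  proof (cases "Polynomial.degree g = 0")
    case True
    then obtain c where "g = [:c:]" by (metis degree_eq_zeroE)
    then have "c \<in> F" "image_mset (poly g) A = image_mset (\<lambda>_. c) A"
      using polys_over_coeff[OF less.prems(2), of 0] by (auto intro: image_mset_cong)
    then show ?thesis by (simp add: subfield_power[OF F])
  next
    case False
    define f where "f = (\<Prod>a\<in>#A. [:- a, 1:])"
    define c where "c = lead_coeff g"
    have "g \<noteq> 0" using False by auto
    then have "c \<noteq> 0" by (simp add: c_def)
    have cF: "c \<in> F" unfolding c_def by (rule polys_over_coeff[OF less.prems(2)])
    obtain B where B: "g = Polynomial.smult c (\<Prod>b\<in>#B. [:- b, 1:])"
      using alg_closed_imp_factorization[OF \<open>g \<noteq> 0\<close>] unfolding c_def by blast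
    have "(\<Prod>b\<in>#B. [:- b, 1:]) = Polynomial.smult (inverse c) g"
      unfolding B using \<open>c \<noteq> 0\<close> by simp
    then have BF: "(\<Prod>b\<in>#B. [:- b, 1:]) \<in> polys_over F"
      using less.prems(2) cF by (simp add: polys_over_smult[OF F] subfield_inverse[OF F])
    have root: "poly g b = 0" if "b \<in># B" for b
      using that by (subst B) (auto simp: poly_prod_mset prod_mset_zero_iff)
    have "poly g a = c * (\<Prod>b\<in>#B. a - b)" for a by (subst B) (simp add: poly_prod_mset)
    then have "(\<Prod>a\<in>#A. poly g a) = (\<Prod>a\<in>#A. c * (\<Prod>b\<in>#B. a - b))" by simp
    also have "\<dots> = c ^ size A * (\<Prod>a\<in>#A. \<Prod>b\<in>#B. a - b)"
      by (simp add: prod_mset.distrib)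
    also have "(\<Prod>a\<in>#A. \<Prod>b\<in>#B. a - b) = (\<Prod>b\<in>#B. \<Prod>a\<in>#A. a - b)"
      by (rule prod_mset.swap)
    also have "\<dots> = (\<Prod>b\<in>#B. (-1) ^ size A * poly f b)"
    proof -
      have "(\<Prod>a\<in>#A. a - b) = (\<Prod>a\<in>#A. (-1) * (b - a))" for b by simp
      then have "(\<Prod>a\<in>#A. a - b) = (-1) ^ size A * poly f b" for b
        unfolding f_def poly_prod_mset by (simp only: prod_mset.distrib prod_mset_constant) simp
      then show ?thesis by simp
    qed
    also have "\<dots> = ((-1) ^ size A) ^ size B * (\<Prod>b\<in>#B. poly f b)"
      by (simp add: prod_mset.distrib)
    also have "(\<Prod>b\<in>#B. poly f b) = (\<Prod>b\<in>#B. poly (f mod g) b)"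
    proof (rule arg_cong[where f = prod_mset], rule image_mset_cong)
      fix b assume "b \<in># B"
      then show "poly f b = poly (f mod g) b"
        using root[of b] by (metis add.left_neutral div_mult_mod_eq mult_zero_right poly_add poly_mult)
    qed
    finally have eq: "(\<Prod>a\<in>#A. poly g a)
      = c ^ size A * (((-1) ^ size A) ^ size B * (\<Prod>b\<in>#B. poly (f mod g) b))" .
    have "f mod g \<in> polys_over F"
      using polys_over_mod[OF F _ less.prems(2)] less.prems(1) by (simp add: f_def)
    moreover have "Polynomial.degree (f mod g) < Polynomial.degree g"
      using degree_mod_less[OF \<open>g \<noteq> 0\<close>, of f] False by auto
    ultimately have "(\<Prod>b\<in>#B. poly (f mod g) b) \<in> F" using less.hyps BF by blast
    then show ?thesis unfolding eq
      by (intro subfield_mult[OF F] subfield_power[OF F] subfield_uminus[OF F] subfield_one[OF F] cF)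
  qed
qed

text \<open>Takes the place of the theorem on symmetric functions: the product of the values of a
  polynomial over all conjugates is seen to be rational without a Galois group.\<close>

lemma prod_poly_roots_in_subfield:
  fixes F :: "'a::alg_closed_field set"
  assumes "is_subfield F" "(\<Prod>a\<in>A. [:- a, 1:]) \<in> polys_over F" "g \<in> polys_over F"
  shows "(\<Prod>a\<in>A. poly g a) \<in> F"
  using prod_mset_poly_roots_in_subfield[OF assms(1), of "mset_set A" g] assms(2,3)
  by (simp add: prod_unfold_prod_mset)

section \<open>Extension of field homomorphisms\<close>

text \<open>A total function of which only the values on \<open>F\<close> matter, so an extension to
  a larger field is simply another function agreeing on \<open>F\<close>.\<close>

definition subfield_hom :: "'a::field set \<Rightarrow> ('a \<Rightarrow> 'b::field) \<Rightarrow> bool" where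
  "subfield_hom F \<sigma> \<longleftrightarrow> \<sigma> 1 = 1 \<and> (\<forall>x\<in>F. \<forall>y\<in>F. \<sigma> (x + y) = \<sigma> x + \<sigma> y \<and> \<sigma> (x * y) = \<sigma> x * \<sigma> y)"

context
  fixes F :: "'a::field set" and \<sigma> :: "'a \<Rightarrow> 'b::field"
  assumes F: "is_subfield F" and hom: "subfield_hom F \<sigma>"
begin

lemma subfield_hom_one: "\<sigma> 1 = 1"
  and subfield_hom_add: "x \<in> F \<Longrightarrow> y \<in> F \<Longrightarrow> \<sigma> (x + y) = \<sigma> x + \<sigma> y"
  and subfield_hom_mult: "x \<in> F \<Longrightarrow> y \<in> F \<Longrightarrow> \<sigma> (x * y) = \<sigma> x * \<sigma> y"
  using hom by (auto simp: subfield_hom_def)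

lemma subfield_hom_zero: "\<sigma> 0 = 0"
proof -
  have "\<sigma> (0 + 0) = \<sigma> 0 + \<sigma> 0" by (intro subfield_hom_add subfield_zero[OF F])
  then show ?thesis by (metis add.right_neutral add_left_cancel)
qed

lemma subfield_hom_sum: "(\<And>i. i \<in> I \<Longrightarrow> g i \<in> F) \<Longrightarrow> \<sigma> (sum g I) = (\<Sum>i\<in>I. \<sigma> (g i))"
proof (induction I rule: infinite_finite_induct)
  case (insert i I)
  then show ?case by (simp add: subfield_hom_add subfield_sum[OF F])
qed (auto simp: subfield_hom_zero)

lemma subfield_hom_power: "x \<in> F \<Longrightarrow> \<sigma> (x ^ n) = \<sigma> x ^ n"
  by (induction n) (auto simp: subfield_hom_one subfield_hom_mult subfield_power[OF F])

lemma subfield_hom_inj: "x \<in> F \<Longrightarrow> y \<in> F \<Longrightarrow> \<sigma> x = \<sigma> y \<Longrightarrow> x = y"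
proof (rule ccontr)
  assume xy: "x \<in> F" "y \<in> F" "\<sigma> x = \<sigma> y" "x \<noteq> y"
  define u where "u = x - y"
  have u: "u \<in> F" "u \<noteq> 0" using xy by (auto simp: u_def subfield_diff[OF F])
  have "\<sigma> x = \<sigma> u + \<sigma> y" using subfield_hom_add[OF u(1) xy(2)] by (simp add: u_def)
  then have "\<sigma> u = 0" using xy by simp
  then have "\<sigma> (u * inverse u) = 0" using u by (simp only: subfield_hom_mult subfield_inverse[OF F]) simp
  then show False using u by (simp add: subfield_hom_one)
qed

lemma coeff_map_poly_hom [simp]: "Polynomial.coeff (map_poly \<sigma> p) i = \<sigma> (Polynomial.coeff p i)"
  by (rule coeff_map_poly) (rule subfield_hom_zero)

lemma map_poly_hom_add:
  "p \<in> polys_over F \<Longrightarrow> q \<in> polys_over F \<Longrightarrow> map_poly \<sigma> (p + q) = map_poly \<sigma> p + map_poly \<sigma> q"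
  by (intro poly_eqI) (simp add: subfield_hom_add polys_over_coeff)

lemma map_poly_hom_mult:
  "p \<in> polys_over F \<Longrightarrow> q \<in> polys_over F \<Longrightarrow> map_poly \<sigma> (p * q) = map_poly \<sigma> p * map_poly \<sigma> q"
  by (intro poly_eqI)
    (simp add: coeff_mult subfield_hom_sum subfield_hom_mult polys_over_coeff subfield_mult[OF F])

lemma degree_map_poly_hom: "p \<in> polys_over F \<Longrightarrow> Polynomial.degree (map_poly \<sigma> p) = Polynomial.degree p"
proof (cases "p = 0")
  case False
  assume p: "p \<in> polys_over F"
  have "\<sigma> (lead_coeff p) \<noteq> 0"
    using subfield_hom_inj[OF polys_over_coeff[OF p] subfield_zero[OF F]] subfield_hom_zero False
    by (metis leading_coeff_0_iff)
  then show ?thesis by (rule map_poly_degree_eq)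
qed simp

lemma subfield_hom_poly:
  assumes "q \<in> polys_over F" "x \<in> F"
  shows "\<sigma> (poly q x) = poly (map_poly \<sigma> q) (\<sigma> x)"
proof -
  have "\<sigma> (poly q x) = (\<Sum>i\<le>Polynomial.degree q. \<sigma> (Polynomial.coeff q i) * \<sigma> x ^ i)"
    unfolding poly_altdef using assms
    by (simp add: subfield_hom_sum subfield_hom_mult subfield_hom_power polys_over_coeff
        subfield_mult[OF F] subfield_power[OF F])
  then show ?thesis using assms by (simp add: poly_altdef degree_map_poly_hom)
qed

lemma subfield_hom_extend_simple:
  assumes p: "is_min_poly F x p" and y: "poly (map_poly \<sigma> p) y = 0"
  shows "\<exists>\<tau>. subfield_hom (adjoin F {x}) \<tau> \<and> (\<forall>u\<in>F. \<tau> u = \<sigma> u) \<and> \<tau> x = y"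
proof -
  define ev where "ev q = poly (map_poly \<sigma> q) y" for q
  define \<tau> where "\<tau> u = ev (SOME q. q \<in> polys_over F \<and> poly q x = u)" for u
  have ev_add: "ev (q + r) = ev q + ev r" and ev_mult: "ev (q * r) = ev q * ev r"
    if "q \<in> polys_over F" "r \<in> polys_over F" for q r
    using that by (simp_all add: ev_def map_poly_hom_add map_poly_hom_mult)
  \<comment> \<open>Independence of the chosen polynomial: a difference vanishing at
    \<open>x\<close> is a multiple of \<open>p\<close>, and the image of \<open>p\<close> vanishes
    at \<open>y\<close>.\<close>
  have ev_cong: "ev q = ev r" if q: "q \<in> polys_over F" and r: "r \<in> polys_over F" and eq: "poly q x = poly r x" for q r
  proof -
    have "q - r \<in> polys_over F" "poly (q - r) x = 0" using q r eq by (auto simp: polys_over_diff[OF F])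
    then obtain s where s: "s \<in> polys_over F" "q - r = p * s" using min_poly_dvd[OF F p] by blast
    have "q = r + p * s" using s(2) by (simp add: algebra_simps)
    then have "ev q = ev r + ev p * ev s"
      using s(1) r is_min_polyD(1)[OF p] by (simp add: ev_add ev_mult polys_over_mult[OF F])
    moreover have "ev p = 0" using y by (simp add: ev_def)
    ultimately show ?thesis by simp
  qed
  have tau: "\<tau> (poly q x) = ev q" if "q \<in> polys_over F" for q
  proof -
    let ?q = "SOME r. r \<in> polys_over F \<and> poly r x = poly q x"
    have "?q \<in> polys_over F \<and> poly ?q x = poly q x" by (rule someI[of _ q]) (use that in simp)
    then show ?thesis unfolding \<tau>_def using ev_cong that by blast
  qed
  have tauF: "\<tau> u = \<sigma> u" if "u \<in> F" for u
    using tau[OF polys_over_const[OF F that]] by (simp add: ev_def map_poly_pCons subfield_hom_zero)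
  have "\<tau> x = y"
    using tau[OF polys_over_linear[OF F subfield_zero[OF F] subfield_one[OF F]]]
    by (simp add: ev_def map_poly_pCons subfield_hom_zero subfield_hom_one)
  moreover have "subfield_hom (adjoin F {x}) \<tau>"
    unfolding subfield_hom_def
  proof (intro conjI ballI)
    show "\<tau> 1 = 1" using tauF[OF subfield_one[OF F]] by (simp add: subfield_hom_one)
    fix u v assume uv: "u \<in> adjoin F {x}" "v \<in> adjoin F {x}"
    then obtain q r where qr: "u = poly q x" "q \<in> polys_over F" "v = poly r x" "r \<in> polys_over F"
      unfolding adjoin_simple_algebraic[OF F p] by blast
    show "\<tau> (u + v) = \<tau> u + \<tau> v"
      using tau[OF polys_over_add[OF F qr(2,4)]] tau[OF qr(2)] tau[OF qr(4)] by (simp add: qr ev_add)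
    show "\<tau> (u * v) = \<tau> u * \<tau> v"
      using tau[OF polys_over_mult[OF F qr(2,4)]] tau[OF qr(2)] tau[OF qr(4)] by (simp add: qr ev_mult)
  qed
  ultimately show ?thesis using tauF by blast
qed

end

text \<open>Algebraic closedness of the codomain supplies a root for the image of each minimal
  polynomial. Only finitely many elements are adjoined later, so induction on a list is
  enough.\<close>

lemma subfield_hom_extend:
  fixes \<sigma> :: "'a::field \<Rightarrow> 'b::alg_closed_field"
  shows "is_subfield F \<Longrightarrow> subfield_hom F \<sigma> \<Longrightarrow> (\<And>x. x \<in> set xs \<Longrightarrow> algebraic_over F x)
    \<Longrightarrow> \<exists>\<tau>. subfield_hom (adjoin F (set xs)) \<tau> \<and> (\<forall>u\<in>F. \<tau> u = \<sigma> u)"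
proof (induction xs arbitrary: F \<sigma>)
  case Nil
  have "adjoin F {} = F" by (rule adjoin_trivial) (use Nil in auto)
  then show ?case using Nil by auto
next
  case (Cons x xs)
  note F = Cons.prems(1)
  obtain p where p: "is_min_poly F x p" using min_poly_exists[OF F] Cons.prems(3) by auto
  have "Polynomial.degree (map_poly \<sigma> p) > 0"
    using degree_map_poly_hom[OF Cons.prems(1,2) is_min_polyD(1)[OF p]] min_poly_degree_pos[OF F p] by simp
  then obtain y where "poly (map_poly \<sigma> p) y = 0" using alg_closed_imp_poly_has_root by blast
  then obtain \<tau> where tau: "subfield_hom (adjoin F {x}) \<tau>" "\<forall>u\<in>F. \<tau> u = \<sigma> u"
    using subfield_hom_extend_simple[OF Cons.prems(1,2) p] by blast
  have "algebraic_over (adjoin F {x}) z" if "z \<in> set xs" for z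
    by (rule algebraic_over_mono[of F]) (use that Cons.prems(3) in \<open>auto intro: adjoin_base\<close>)
  then obtain \<tau>' where "subfield_hom (adjoin (adjoin F {x}) (set xs)) \<tau>'" "\<forall>u\<in>adjoin F {x}. \<tau>' u = \<tau> u"
    using Cons.IH[OF is_subfield_adjoin tau(1)] by blast
  then show ?case using tau(2) adjoin_base[of _ F "{x}"] unfolding adjoin_list_Cons by metis
qed

section \<open>Algebraic dependence\<close>

text \<open>The closure operator of algebraic dependence over \<open>k\<close>. Phrasing
  independence through it gives the Steinitz argument for transcendence degree without polynomials
  in several variables.\<close>

definition acl :: "'a::field set \<Rightarrow> 'a set \<Rightarrow> 'a set" where
  "acl k S = {x. algebraic_over (adjoin k S) x}"

lemma acl_mono: "S \<subseteq> T \<Longrightarrow> acl k S \<subseteq> acl k T"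
  unfolding acl_def using algebraic_over_mono[OF adjoin_mono[OF order_refl]] by blast

lemma adjoin_subset_acl: "adjoin k S \<subseteq> acl k S"
  unfolding acl_def using algebraic_over_base[OF is_subfield_adjoin] by blast

lemma acl_gen: "x \<in> S \<Longrightarrow> x \<in> acl k S"
  using adjoin_subset_acl adjoin_gen by blast

lemma is_subfield_acl: "is_subfield (acl k S)"
  unfolding acl_def by (rule is_subfield_algebraics[OF is_subfield_adjoin])

lemma acl_subset: "T \<subseteq> acl k S \<Longrightarrow> acl k T \<subseteq> acl k S"
proof
  fix x assume T: "T \<subseteq> acl k S" and x: "x \<in> acl k T"
  have "k \<subseteq> acl k S" using adjoin_base adjoin_subset_acl by blast
  then have "adjoin k T \<subseteq> acl k S" by (rule adjoin_subset[OF is_subfield_acl _ T])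
  then have "algebraic_over (acl k S) x" using x algebraic_over_mono unfolding acl_def[of k T] by blast
  then show "x \<in> acl k S"
    unfolding acl_def using algebraic_over_trans[OF is_subfield_adjoin] by blast
qed

text \<open>A relation for \<open>x\<close> with coefficients in \<open>adjoin F {y}\<close> is,
  after clearing denominators, a polynomial relation between \<open>x\<close> and \<open>y\<close>,
  which may be read as one for \<open>y\<close> with coefficients in
  \<open>adjoin F {x}\<close>.\<close>

lemma algebraic_over_exchange:
  assumes F: "is_subfield F" and alg: "algebraic_over (adjoin F {y}) x" and nalg: "\<not> algebraic_over F x"
  shows "algebraic_over (adjoin F {x}) y"
proof -
  obtain P where P: "P \<in> polys_over (adjoin F {y})" "P \<noteq> 0" "poly P x = 0"
    using alg by (auto simp: algebraic_over_def)
  define n where "n = Polynomial.degree P"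
  have "\<exists>q r. Polynomial.coeff P i = poly q y / poly r y \<and> q \<in> polys_over F \<and> r \<in> polys_over F \<and> poly r y \<noteq> 0" for i
    using polys_over_coeff[OF P(1), of i] unfolding adjoin_simple_quotients[OF F] by blast
  then obtain q r where qr: "\<And>i. Polynomial.coeff P i = poly (q i) y / poly (r i) y"
    "\<And>i. q i \<in> polys_over F" "\<And>i. r i \<in> polys_over F" "\<And>i. poly (r i) y \<noteq> 0" by metis
  define R where "R = (\<Prod>i\<le>n. poly (r i) y)"
  have "R \<noteq> 0" using qr by (simp add: R_def)
  define g where "g i = q i * (\<Prod>j\<in>{..n} - {i}. r j)" for i
  have prodF: "(\<Prod>j\<in>J. r j) \<in> polys_over F" for J
    by (induction J rule: infinite_finite_induct) (auto intro!: polys_over_intros[OF F] qr(3))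
  have gF: "g i \<in> polys_over F" for i
    unfolding g_def by (intro polys_over_mult[OF F] prodF qr(2))
  have gy: "poly (g i) y = R * Polynomial.coeff P i" if "i \<le> n" for i
  proof -
    have "R = poly (r i) y * (\<Prod>j\<in>{..n} - {i}. poly (r j) y)"
      unfolding R_def using that by (subst prod.remove[of _ i]) auto
    then show ?thesis using qr(1,4)[of i] by (simp add: g_def poly_prod)
  qed
  define G where "G = (\<Sum>i\<le>n. Polynomial.smult (x ^ i) (g i))"
  have Fx: "F \<subseteq> adjoin F {x}" by (intro subsetI adjoin_base)
  have "G \<in> polys_over (adjoin F {x})" unfolding G_def
    by (intro polys_over_sum[OF is_subfield_adjoin] polys_over_smult[OF is_subfield_adjoin]
        subfield_power[OF is_subfield_adjoin] adjoin_gen singletonI polys_over_mono[OF Fx] gF)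
  moreover have "poly G y = R * poly P x"
    unfolding G_def poly_altdef[of P] n_def[symmetric] sum_distrib_left
    by (simp add: poly_sum gy mult_ac)
  then have "poly G y = 0" using P(3) by simp
  \<comment> \<open>If \<open>G\<close> vanished, each of its coefficients, as a polynomial in
    \<open>x\<close> over \<open>F\<close>, would be trivial because \<open>x\<close> is
    transcendental over \<open>F\<close>; then the leading coefficient of \<open>P\<close>, cleared
    of denominators, would be zero.\<close>
  moreover have "G \<noteq> 0"
  proof
    assume "G = 0"
    have "Polynomial.coeff (g i) j = 0" if "i \<le> n" for i j
    proof -
      define Q where "Q = (\<Sum>i\<le>n. Polynomial.monom (Polynomial.coeff (g i) j) i)"
      have "poly Q x = Polynomial.coeff G j"
        by (simp add: Q_def G_def poly_sum poly_monom coeff_sum mult.commute)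
      then have "poly Q x = 0" using \<open>G = 0\<close> by simp
      moreover have "Q \<in> polys_over F" unfolding Q_def
        by (intro polys_over_sum[OF F] polys_over_monom[OF F] polys_over_coeff[OF gF])
      ultimately have "Q = 0" using nalg by (auto simp: algebraic_over_def)
      moreover have "Polynomial.coeff Q i = Polynomial.coeff (g i) j"
        using that by (simp add: Q_def coeff_sum coeff_monom)
      ultimately show ?thesis by simp
    qed
    then have "g n = 0" by (intro poly_eqI) simp
    then have "R * lead_coeff P = 0" using gy[of n] by (simp add: n_def)
    then show False using \<open>R \<noteq> 0\<close> P(2) by simp
  qed
  ultimately show ?thesis by (auto simp: algebraic_over_def)
qed

lemma acl_exchange:
  assumes "x \<in> acl k (insert y S)" "x \<notin> acl k S"
  shows "y \<in> acl k (insert x S)"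
proof -
  have *: "adjoin (adjoin k S) {u} = adjoin k (insert u S)" for u
    unfolding adjoin_adjoin by (rule arg_cong[where f = "adjoin k"]) auto
  show ?thesis using assms algebraic_over_exchange[OF is_subfield_adjoin, of k S y x]
    unfolding acl_def * by simp
qed

text \<open>Enlarging \<open>B\<close> by the elements of \<open>U\<close> one at a time,
  \<open>y\<close> is the element whose arrival first captures \<open>x\<close>; the exchange
  property applies exactly there.\<close>

lemma acl_first_generator:
  "finite U \<Longrightarrow> x \<notin> acl k B \<Longrightarrow> x \<in> acl k (B \<union> U)
    \<Longrightarrow> \<exists>T y. B \<subseteq> T \<and> T \<subseteq> B \<union> U \<and> y \<in> U \<and> y \<notin> T \<and> x \<notin> acl k T \<and> x \<in> acl k (insert y T)"
proof (induction U rule: finite_induct)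
  case (insert u U)
  have eq: "B \<union> insert u U = insert u (B \<union> U)" by auto
  show ?case
  proof (cases "x \<in> acl k (B \<union> U)")
    case True
    then show ?thesis using insert by blast
  next
    case False
    then have "u \<notin> B \<union> U" using insert.prems(2) unfolding eq by (metis insert_absorb)
    then show ?thesis using False insert.prems(2) unfolding eq
      by (intro exI[of _ "B \<union> U"] exI[of _ u]) auto
  qed
qed auto

text \<open>Steinitz replacement, by induction on the number of elements of \<open>I\<close> outside
  \<open>S\<close>: an element of \<open>S\<close> outside \<open>I\<close> is traded for one of
  \<open>I\<close>, which preserves the size of \<open>S\<close> and keeps \<open>I\<close> in its
  closure.\<close>

lemma card_le_of_acl:
  assumes "finite I" "finite S" "I \<subseteq> acl k S" and indep: "\<And>x. x \<in> I \<Longrightarrow> x \<notin> acl k (I - {x})"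
  shows "card I \<le> card S"
  using assms(2,3)
proof (induction "card (I - S)" arbitrary: S)
  case 0
  then have "I \<subseteq> S" using assms(1) by simp
  then show ?case using 0 by (simp add: card_mono)
next
  case (Suc n)
  then obtain x where x: "x \<in> I" "x \<notin> S" by (metis Diff_eq_empty_iff card.empty nat.distinct(1) subsetI)
  have "acl k (S \<inter> I) \<subseteq> acl k (I - {x})" by (rule acl_mono) (use x in auto)
  then have "x \<notin> acl k (S \<inter> I)" using indep[OF x(1)] by blast
  moreover have "S \<inter> I \<union> (S - I) = S" by auto
  \<comment> \<open>The closure of \<open>S \<inter> I\<close> misses \<open>x\<close> by
    independence, so the element exchanged for \<open>x\<close> can be taken outside
    \<open>I\<close>, which makes the induction progress.\<close>
  ultimately obtain T y where Ty: "S \<inter> I \<subseteq> T" "T \<subseteq> S" "y \<in> S - I" "y \<notin> T" "x \<notin> acl k T" "x \<in> acl k (insert y T)"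
    using acl_first_generator[of "S - I" x k "S \<inter> I"] Suc.prems x by auto
  define S' where "S' = insert x (S - {y})"
  have "y \<in> acl k (insert x T)" by (rule acl_exchange) fact+
  moreover have "acl k (insert x T) \<subseteq> acl k S'" by (rule acl_mono) (use Ty in \<open>auto simp: S'_def\<close>)
  ultimately have "S \<subseteq> acl k S'" using acl_gen[of _ S' k] by (auto simp: S'_def)
  then have "I \<subseteq> acl k S'" using acl_subset Suc.prems(2) by blast
  moreover have "card S > 0" using Ty(3) Suc.prems(1) by (auto simp: card_gt_0_iff)
  then have "card S' = card S"
    using Suc.prems(1) Ty x unfolding S'_def by simp
  moreover have "I - S' = I - S - {x}" using Ty by (auto simp: S'_def)
  then have "card (I - S') = n" using Suc.hyps(2) x by simp
  moreover have "finite S'" using Suc.prems by (simp add: S'_def)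
  ultimately show ?case using Suc.hyps(1)[of S'] by simp
qed

text \<open>If some \<open>\<nu> i\<close> were redundant, \<open>n\<close> independent elements
  would lie in the closure of \<open>n - 1\<close> elements. This yields dominance of a map from
  algebraicity of the coordinates over the field generated by its components.\<close>

lemma acl_generators_independent:
  fixes \<xi> \<nu> :: "nat \<Rightarrow> 'a::field"
  assumes indep: "\<And>i. i < n \<Longrightarrow> \<xi> i \<notin> acl k (\<xi> ` ({..<n} - {i}))"
    and span: "\<And>i. i < n \<Longrightarrow> \<xi> i \<in> acl k (\<nu> ` {..<n})"
    and i: "i < n"
  shows "\<nu> i \<notin> acl k (\<nu> ` ({..<n} - {i}))"
proof
  let ?S = "\<nu> ` ({..<n} - {i})"
  assume nu: "\<nu> i \<in> acl k ?S"
  have "\<nu> ` {..<n} \<subseteq> acl k ?S"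
  proof
    fix u assume "u \<in> \<nu> ` {..<n}"
    then obtain j where "j < n" "u = \<nu> j" by auto
    then show "u \<in> acl k ?S" using nu acl_gen[of u ?S k] by (cases "j = i") auto
  qed
  then have "\<xi> ` {..<n} \<subseteq> acl k ?S" using span acl_subset by blast
  have inj: "inj_on \<xi> {..<n}"
  proof (rule inj_onI, rule ccontr)
    fix a b assume ab: "a \<in> {..<n}" "b \<in> {..<n}" "\<xi> a = \<xi> b" "a \<noteq> b"
    then have "\<xi> a \<in> \<xi> ` ({..<n} - {a})" by auto
    then show False using indep[of a] acl_gen[of "\<xi> a" _ k] ab(1) by simp
  qed
  have "\<xi> ` {..<n} - {\<xi> j} = \<xi> ` ({..<n} - {j})" if "j < n" for j
    using that by (subst inj_on_image_set_diff[OF inj]) auto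
  then have "x \<notin> acl k (\<xi> ` {..<n} - {x})" if "x \<in> \<xi> ` {..<n}" for x
    using that indep by auto
  then have "card (\<xi> ` {..<n}) \<le> card ?S"
    by (intro card_le_of_acl[where k = k]) (use \<open>\<xi> ` {..<n} \<subseteq> acl k ?S\<close> in auto)
  moreover have "card (\<xi> ` {..<n}) = n" using inj by (simp add: card_image)
  moreover have "card ?S \<le> n - 1" using card_image_le[of "{..<n} - {i}" \<nu>] i by simp
  ultimately show False using i by simp
qed

section \<open>Evaluation of polynomials in several variables\<close>

lemma infinite_UNIV_alg_closed: "infinite (UNIV :: 'a::alg_closed_field set)"
proof
  assume fin: "finite (UNIV :: 'a set)"
  define p :: "'a poly" where "p = (\<Prod>a\<in>UNIV. [:- a, 1:])"
  have "Polynomial.degree p = card (UNIV :: 'a set)"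
    unfolding p_def by (rule degree_prod_linear[OF fin])
  then have "Polynomial.degree p > 0" using fin by (simp add: card_gt_0_iff)
  then have "Polynomial.degree (p + 1) > 0" by (subst degree_add_eq_left) auto
  then obtain x where "poly (p + 1) x = 0" using alg_closed_imp_poly_has_root by blast
  moreover have "poly p x = 0" using fin by (simp add: p_def poly_prod prod_zero_iff)
  ultimately show False by simp
qed

definition monom_eval :: "(nat \<Rightarrow> 'b::comm_semiring_1) \<Rightarrow> (nat \<Rightarrow>\<^sub>0 nat) \<Rightarrow> 'b" where
  "monom_eval x m = (\<Prod>i\<in>Poly_Mapping.keys m. x i ^ Poly_Mapping.lookup m i)"

abbreviation mvar :: "nat \<Rightarrow> 'a::comm_semiring_1 mpoly" where
  "mvar i \<equiv> Poly_Mapping.single (Poly_Mapping.single i 1) 1"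

lemma monom_eval_superset:
  "finite A \<Longrightarrow> Poly_Mapping.keys m \<subseteq> A \<Longrightarrow> monom_eval x m = (\<Prod>i\<in>A. x i ^ Poly_Mapping.lookup m i)"
  unfolding monom_eval_def by (rule prod.mono_neutral_left) (auto simp: in_keys_iff)

lemma monom_eval_add: "monom_eval x (m + m') = monom_eval x m * monom_eval x m'"
proof -
  let ?A = "Poly_Mapping.keys m \<union> Poly_Mapping.keys m'"
  have "Poly_Mapping.keys (m + m') \<subseteq> ?A" by (rule keys_add)
  then show ?thesis
    by (simp add: monom_eval_superset[of ?A] lookup_add power_add prod.distrib)
qed

lemma monom_eval_0 [simp]: "monom_eval x 0 = 1"
  by (simp add: monom_eval_def)

lemma monom_eval_single [simp]: "monom_eval x (Poly_Mapping.single i l) = x i ^ l"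
  by (simp add: monom_eval_def)

lemma poly_mapping_sum_singles:
  "p = (\<Sum>m\<in>Poly_Mapping.keys p. Poly_Mapping.single m (Poly_Mapping.lookup p m))"
proof (rule poly_mapping_eqI)
  fix m
  have "Poly_Mapping.lookup (\<Sum>m\<in>Poly_Mapping.keys p. Poly_Mapping.single m (Poly_Mapping.lookup p m)) m
    = (\<Sum>m'\<in>Poly_Mapping.keys p. if m' = m then Poly_Mapping.lookup p m else 0)"
    unfolding lookup_sum lookup_single by (intro sum.cong) (auto simp: when_def)
  also have "\<dots> = Poly_Mapping.lookup p m" by (auto simp: in_keys_iff)
  finally show "Poly_Mapping.lookup p m = Poly_Mapping.lookup (\<Sum>m\<in>Poly_Mapping.keys p. Poly_Mapping.single m (Poly_Mapping.lookup p m)) m" ..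
qed

lemma mvar_power: "mvar i ^ l = (Poly_Mapping.single (Poly_Mapping.single i l) 1 :: 'a::comm_semiring_1 mpoly)"
  by (induction l) (simp_all add: mult_single flip: single_add)

text \<open>One set of evaluation rules serves both evaluation of polynomials at points, with the
  identity, and at elements of the universal domain, with \<open>const_embed\<close>.\<close>

locale coeff_hom =
  fixes h :: "'a::idom \<Rightarrow> 'b::idom"
  assumes hom_zero: "h 0 = 0" and hom_one: "h 1 = 1"
    and hom_add: "h (a + b) = h a + h b" and hom_mult: "h (a * b) = h a * h b"
    and hom_inj: "h a = 0 \<Longrightarrow> a = 0"
begin

abbreviation eval_at :: "(nat \<Rightarrow> 'b) \<Rightarrow> 'a mpoly \<Rightarrow> 'b" where
  "eval_at \<equiv> mpoly_eval_hom h"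

lemma eval_superset:
  "finite A \<Longrightarrow> Poly_Mapping.keys p \<subseteq> A
    \<Longrightarrow> eval_at x p = (\<Sum>m\<in>A. h (Poly_Mapping.lookup p m) * monom_eval x m)"
  unfolding mpoly_eval_hom_def monom_eval_def
  by (rule sum.mono_neutral_left) (auto simp: in_keys_iff hom_zero)

lemma eval_zero [simp]: "eval_at x 0 = 0"
  by (simp add: mpoly_eval_hom_def)

lemma eval_single [simp]: "eval_at x (Poly_Mapping.single m c) = h c * monom_eval x m"
  by (subst eval_superset[of "{m}"]) (auto simp: hom_zero)

lemma eval_one [simp]: "eval_at x 1 = 1"
  using eval_single[of x 0 1] by (simp add: hom_one)

lemma eval_add [simp]: "eval_at x (p + q) = eval_at x p + eval_at x q"
proof -
  let ?A = "Poly_Mapping.keys p \<union> Poly_Mapping.keys q"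
  have "Poly_Mapping.keys (p + q) \<subseteq> ?A" by (rule keys_add)
  then show ?thesis
    by (simp add: eval_superset[of ?A] lookup_add hom_add distrib_right sum.distrib)
qed

lemma eval_sum [simp]: "eval_at x (sum f A) = (\<Sum>a\<in>A. eval_at x (f a))"
  by (induction A rule: infinite_finite_induct) auto

lemma eval_mult [simp]: "eval_at x (p * q) = eval_at x p * eval_at x q"
proof -
  have "p * q = (\<Sum>m\<in>Poly_Mapping.keys p. \<Sum>m'\<in>Poly_Mapping.keys q.
      Poly_Mapping.single (m + m') (Poly_Mapping.lookup p m * Poly_Mapping.lookup q m'))"
    by (subst poly_mapping_sum_singles[of p], subst poly_mapping_sum_singles[of q])
      (simp add: sum_product mult_single)
  then have "eval_at x (p * q) = (\<Sum>m\<in>Poly_Mapping.keys p. \<Sum>m'\<in>Poly_Mapping.keys q.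
      (h (Poly_Mapping.lookup p m) * monom_eval x m) * (h (Poly_Mapping.lookup q m') * monom_eval x m'))"
    by (simp add: hom_mult monom_eval_add mult_ac)
  also have "\<dots> = eval_at x p * eval_at x q"
    by (simp add: mpoly_eval_hom_def monom_eval_def sum_product)
  finally show ?thesis .
qed

lemma eval_power [simp]: "eval_at x (p ^ l) = eval_at x p ^ l"
  by (induction l) simp_all

lemma eval_prod [simp]: "eval_at x (prod f A) = (\<Prod>a\<in>A. eval_at x (f a))"
  by (induction A rule: infinite_finite_induct) auto

lemma hom_uminus: "h (- a) = - h a"
  using hom_add[of a "- a"] hom_zero by (simp add: eq_neg_iff_add_eq_0 add.commute)

lemma eval_mvar [simp]: "eval_at x (mvar i) = x i"
  by (simp add: hom_one)

end

section \<open>Polynomials with coefficients in a subfield\<close>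

text \<open>An arbitrary index set in place of an initial segment lets inductions remove any one
  variable.\<close>

definition mpolys_in :: "'a::zero set \<Rightarrow> nat set \<Rightarrow> 'a mpoly set" where
  "mpolys_in F J = {p. (\<forall>m. Poly_Mapping.lookup p m \<in> F) \<and> (\<forall>m\<in>Poly_Mapping.keys p. Poly_Mapping.keys m \<subseteq> J)}"

lemma mpolys_over_eq: "mpolys_over F n = mpolys_in F {..<n}"
  by (simp add: mpolys_over_def mpolys_in_def)

lemma mpolys_in_mono: "F \<subseteq> F' \<Longrightarrow> J \<subseteq> J' \<Longrightarrow> p \<in> mpolys_in F J \<Longrightarrow> p \<in> mpolys_in F' J'"
  unfolding mpolys_in_def by blast

context
  fixes F :: "'a::field set"
  assumes F: "is_subfield F"
begin

lemma mpolys_in_single: "c \<in> F \<Longrightarrow> Poly_Mapping.keys m \<subseteq> J \<Longrightarrow> Poly_Mapping.single m c \<in> mpolys_in F J"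
  by (auto simp: mpolys_in_def lookup_single when_def subfield_zero[OF F] split: if_splits)

lemma mpolys_in_zero: "0 \<in> mpolys_in F J"
  by (auto simp: mpolys_in_def subfield_zero[OF F])

lemma mpolys_in_add: "p \<in> mpolys_in F J \<Longrightarrow> q \<in> mpolys_in F J \<Longrightarrow> p + q \<in> mpolys_in F J"
  using keys_add[of p q] by (fastforce simp: mpolys_in_def lookup_add subfield_add[OF F])

lemma mpolys_in_sum: "(\<And>a. a \<in> A \<Longrightarrow> f a \<in> mpolys_in F J) \<Longrightarrow> sum f A \<in> mpolys_in F J"
  by (induction A rule: infinite_finite_induct) (auto intro: mpolys_in_zero mpolys_in_add)

lemma mpolys_in_mult: 
  assumes "p \<in> mpolys_in F J" "q \<in> mpolys_in F J"
  shows "p * q \<in> mpolys_in F J"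
proof -
  have "p * q = (\<Sum>m\<in>Poly_Mapping.keys p. \<Sum>m'\<in>Poly_Mapping.keys q.
      Poly_Mapping.single (m + m') (Poly_Mapping.lookup p m * Poly_Mapping.lookup q m'))"
    by (subst poly_mapping_sum_singles[of p], subst poly_mapping_sum_singles[of q])
      (simp add: sum_product mult_single)
  also have "\<dots> \<in> mpolys_in F J"
  proof (intro mpolys_in_sum mpolys_in_single subfield_mult[OF F])
    fix m m' assume "m \<in> Poly_Mapping.keys p" "m' \<in> Poly_Mapping.keys q"
    then show "Poly_Mapping.keys (m + m') \<subseteq> J"
      using assms keys_add[of m m'] unfolding mpolys_in_def by blast
  qed (use assms in \<open>auto simp: mpolys_in_def\<close>)
  finally show ?thesis .
qed

lemma mpolys_in_one: "1 \<in> mpolys_in F J"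
  using mpolys_in_single[OF subfield_one[OF F], of 0 J] by simp

lemma mpolys_in_power: "p \<in> mpolys_in F J \<Longrightarrow> p ^ l \<in> mpolys_in F J"
  by (induction l) (auto intro: mpolys_in_one mpolys_in_mult)

lemma mpolys_in_prod: "(\<And>a. a \<in> A \<Longrightarrow> f a \<in> mpolys_in F J) \<Longrightarrow> prod f A \<in> mpolys_in F J"
  by (induction A rule: infinite_finite_induct) (auto intro: mpolys_in_one mpolys_in_mult)

lemma mpolys_in_mvar: "i \<in> J \<Longrightarrow> mvar i \<in> mpolys_in F J"
  by (rule mpolys_in_single[OF subfield_one[OF F]]) simp

text \<open>Sorting the monomials by their exponent at \<open>i\<close> presents \<open>p\<close> as
  a polynomial in that variable, the basis of the inductions on the number of variables.\<close>

lemma mpolys_in_decompose: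
  assumes p: "p \<in> mpolys_in F (insert i J)"
  shows "\<exists>N q. (\<forall>l. q l \<in> mpolys_in F (J - {i})) \<and> p = (\<Sum>l\<le>N. q l * mvar i ^ l)"
proof -
  define r where "r m = Poly_Mapping.update i 0 m" for m :: "nat \<Rightarrow>\<^sub>0 nat"
  have r: "m = r m + Poly_Mapping.single i (Poly_Mapping.lookup m i)" for m
    by (rule poly_mapping_eqI) (auto simp: r_def lookup_add lookup_update lookup_single when_def)
  define q where "q l = (\<Sum>m\<in>{m\<in>Poly_Mapping.keys p. Poly_Mapping.lookup m i = l}.
      Poly_Mapping.single (r m) (Poly_Mapping.lookup p m))" for l
  \<comment> \<open>The inserted zero covers \<open>p = 0\<close>, which has no exponents.\<close>
  define N where "N = Max (insert 0 ((\<lambda>m. Poly_Mapping.lookup m i) ` Poly_Mapping.keys p))"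
  have "q l \<in> mpolys_in F (J - {i})" for l
    unfolding q_def
  proof (intro mpolys_in_sum mpolys_in_single)
    fix m assume "m \<in> {m\<in>Poly_Mapping.keys p. Poly_Mapping.lookup m i = l}"
    then show "Poly_Mapping.keys (r m) \<subseteq> J - {i}" "Poly_Mapping.lookup p m \<in> F"
      using p unfolding mpolys_in_def r_def keys_update by auto
  qed
  moreover have "p = (\<Sum>l\<le>N. q l * mvar i ^ l)"
  proof -
    have "p = (\<Sum>m\<in>Poly_Mapping.keys p. Poly_Mapping.single m (Poly_Mapping.lookup p m))"
      by (rule poly_mapping_sum_singles)
    also have "\<dots> = (\<Sum>l\<le>N. \<Sum>m\<in>{m\<in>Poly_Mapping.keys p. Poly_Mapping.lookup m i = l}.
        Poly_Mapping.single m (Poly_Mapping.lookup p m))"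
      by (rule sum.group[symmetric]) (auto simp: N_def)
    also have "\<dots> = (\<Sum>l\<le>N. q l * mvar i ^ l)"
    proof (rule sum.cong[OF refl])
      fix l
      have "Poly_Mapping.single m (Poly_Mapping.lookup p m)
          = Poly_Mapping.single (r m) (Poly_Mapping.lookup p m) * mvar i ^ l"
        if "Poly_Mapping.lookup m i = l" for m
      proof -
        have "Poly_Mapping.single (r m) (Poly_Mapping.lookup p m) * mvar i ^ l
            = Poly_Mapping.single (r m + Poly_Mapping.single i l) (Poly_Mapping.lookup p m)"
          by (simp only: mvar_power mult_single mult_1_right)
        also have "r m + Poly_Mapping.single i l = m" using r[of m] that by simp
        finally show ?thesis ..
      qed
      then show "(\<Sum>m\<in>{m\<in>Poly_Mapping.keys p. Poly_Mapping.lookup m i = l}.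
          Poly_Mapping.single m (Poly_Mapping.lookup p m)) = q l * mvar i ^ l"
        unfolding q_def sum_distrib_right by (intro sum.cong) auto
    qed
    finally show ?thesis .
  qed
  ultimately show ?thesis by blast
qed

end

lemma mpolys_in_empty:
  assumes "p \<in> mpolys_in F {}"
  shows "p = Poly_Mapping.single 0 (Poly_Mapping.lookup p 0)"
proof (rule poly_mapping_eqI)
  fix m
  show "Poly_Mapping.lookup p m = Poly_Mapping.lookup (Poly_Mapping.single 0 (Poly_Mapping.lookup p 0)) m"
  proof (cases "m = 0")
    case False
    then have "m \<notin> Poly_Mapping.keys p" using assms by (auto simp: mpolys_in_def)
    then show ?thesis using False by (simp add: lookup_single in_keys_iff)
  qed simp
qed

context coeff_hom
begin

lemma eval_cong:
  assumes "p \<in> mpolys_in F J" "\<And>i. i \<in> J \<Longrightarrow> x i = y i"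
  shows "eval_at x p = eval_at y p"
  unfolding mpoly_eval_hom_def
proof (intro sum.cong refl arg_cong2[where f = "(*)"] prod.cong)
  fix m i assume "m \<in> Poly_Mapping.keys p" "i \<in> Poly_Mapping.keys m"
  then have "i \<in> J" using assms(1) by (auto simp: mpolys_in_def)
  then show "x i ^ Poly_Mapping.lookup m i = y i ^ Poly_Mapping.lookup m i" using assms(2) by simp
qed

end

interpretation id_hom: coeff_hom "\<lambda>a::'a::idom. a"
  by unfold_locales auto

text \<open>Fix values of the other variables at which some coefficient is nonzero; the resulting
  polynomial in one variable has only finitely many roots in an infinite field.\<close>

lemma mpoly_nonvanishing:
  fixes p :: "'a::alg_closed_field mpoly"
  assumes "finite J"
  shows "p \<in> mpolys_in UNIV J \<Longrightarrow> p \<noteq> 0 \<Longrightarrow> \<exists>b. mpoly_eval b p \<noteq> 0"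
  using assms
proof (induction J arbitrary: p rule: finite_induct)
  case empty
  have "p = Poly_Mapping.single 0 (Poly_Mapping.lookup p 0)" using mpolys_in_empty empty(1) by blast
  then obtain c where c: "p = Poly_Mapping.single 0 c" by blast
  then have "c \<noteq> 0" using empty by auto
  then show ?case by (simp add: c)
next
  case (insert i J)
  have J: "J - {i} = J" using insert.hyps by auto
  obtain N q where q: "\<And>l. q l \<in> mpolys_in UNIV J" "p = (\<Sum>l\<le>N. q l * mvar i ^ l)"
    using mpolys_in_decompose[OF is_subfield_UNIV insert.prems(1)] unfolding J by blast
  have "\<exists>l\<le>N. q l \<noteq> 0"
  proof (rule ccontr)
    assume "\<not> (\<exists>l\<le>N. q l \<noteq> 0)"
    then have "p = 0" unfolding q(2) by simp
    then show False using insert.prems(2) by simp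
  qed
  then obtain l where l: "l \<le> N" "q l \<noteq> 0" by blast
  obtain b where b: "mpoly_eval b (q l) \<noteq> 0" using insert.IH[OF q(1) l(2)] by blast
  define Q where "Q = (\<Sum>l\<le>N. Polynomial.monom (mpoly_eval b (q l)) l)"
  have "Polynomial.coeff Q l = mpoly_eval b (q l)"
    using l by (simp add: Q_def coeff_sum coeff_monom)
  then have "Q \<noteq> 0" using b by auto
  then have "\<exists>t. poly Q t \<noteq> 0"
    using poly_roots_finite[of Q] infinite_UNIV_alg_closed[where ?'a = 'a] by (auto intro: ccontr)
  then obtain t where t: "poly Q t \<noteq> 0" by blast
  have "mpoly_eval (b(i := t)) (q l) = mpoly_eval b (q l)" for l
    by (rule id_hom.eval_cong[OF q(1)]) (use insert.hyps in auto)
  then have "mpoly_eval (b(i := t)) p = poly Q t"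
    unfolding q(2) by (simp add: Q_def poly_sum poly_monom)
  then show ?case using t by metis
qed

locale field_coeff_hom = coeff_hom h for h :: "'a::field \<Rightarrow> 'b::field"
begin

lemma hom_eq_iff: "h a = h b \<longleftrightarrow> a = b"
  using hom_inj[of "a - b"] hom_add[of a "- b"] hom_uminus[of b] by auto

lemma hom_inverse: "h (inverse a) = inverse (h a)"
proof (cases "a = 0")
  case False
  then have "h a * h (inverse a) = 1" by (simp add: hom_one flip: hom_mult)
  then show ?thesis by (metis inverse_unique)
qed (simp add: hom_zero)

lemma is_subfield_image:
  assumes F: "is_subfield F"
  shows "is_subfield (h ` F)"
proof (rule is_subfieldI)
  show "1 \<in> h ` F" using subfield_one[OF F] hom_one by (metis imageI)
next
  fix u v assume "u \<in> h ` F" "v \<in> h ` F"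
  then show "u + v \<in> h ` F" "u * v \<in> h ` F"
    using subfield_add[OF F] subfield_mult[OF F] by (auto simp: hom_add[symmetric] hom_mult[symmetric])
next
  fix u assume "u \<in> h ` F"
  then show "- u \<in> h ` F" "inverse u \<in> h ` F"
    using subfield_uminus[OF F] subfield_inverse[OF F]
    by (auto simp: hom_uminus[symmetric] hom_inverse[symmetric])
qed

lemma eval_in_adjoin:
  assumes F: "is_subfield F" and p: "p \<in> mpolys_in F J"
  shows "eval_at x p \<in> adjoin (h ` F) (x ` J)"
  unfolding mpoly_eval_hom_def
proof (intro subfield_sum[OF is_subfield_adjoin] subfield_mult[OF is_subfield_adjoin]
    subfield_prod[OF is_subfield_adjoin] subfield_power[OF is_subfield_adjoin])
  fix m assume m: "m \<in> Poly_Mapping.keys p"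
  show "h (Poly_Mapping.lookup p m) \<in> adjoin (h ` F) (x ` J)"
    by (rule adjoin_base) (use p in \<open>auto simp: mpolys_in_def\<close>)
  fix i assume "i \<in> Poly_Mapping.keys m"
  then show "x i \<in> adjoin (h ` F) (x ` J)"
    by (intro adjoin_gen imageI) (use p m in \<open>auto simp: mpolys_in_def\<close>)
qed

lemma adjoin_quotients:
  assumes F: "is_subfield F" and u: "u \<in> adjoin (h ` F) (x ` J)"
  shows "\<exists>p\<in>mpolys_in F J. \<exists>q\<in>mpolys_in F J. eval_at x q \<noteq> 0 \<and> u = eval_at x p / eval_at x q"
proof -
  define A where "A = {eval_at x p / eval_at x q |p q. p \<in> mpolys_in F J \<and> q \<in> mpolys_in F J \<and> eval_at x q \<noteq> 0}"
  have memI: "eval_at x p / eval_at x q \<in> A"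
    if "p \<in> mpolys_in F J" "q \<in> mpolys_in F J" "eval_at x q \<noteq> 0" for p q
    unfolding A_def using that by blast
  have polyI: "eval_at x p \<in> A" if "p \<in> mpolys_in F J" for p
    using memI[OF that mpolys_in_one[OF F]] by simp
  have "is_subfield A"
  proof (rule is_subfieldI)
    show "1 \<in> A" using polyI[OF mpolys_in_one[OF F]] by simp
  next
    fix u v assume "u \<in> A" "v \<in> A"
    then obtain p q p' q' where *: "u = eval_at x p / eval_at x q" "v = eval_at x p' / eval_at x q'"
      "p \<in> mpolys_in F J" "q \<in> mpolys_in F J" "p' \<in> mpolys_in F J" "q' \<in> mpolys_in F J"
      "eval_at x q \<noteq> 0" "eval_at x q' \<noteq> 0" unfolding A_def by blast
    have "u + v = eval_at x (p * q' + p' * q) / eval_at x (q * q')"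
      "u * v = eval_at x (p * p') / eval_at x (q * q')"
      using * by (simp_all add: add_divide_distrib mult_ac)
    moreover have "eval_at x (q * q') \<noteq> 0" using * by simp
    ultimately show "u + v \<in> A" "u * v \<in> A"
      using memI[of "p * q' + p' * q" "q * q'"] memI[of "p * p'" "q * q'"] *(3-6)
      by (simp_all only: mpolys_in_add[OF F] mpolys_in_mult[OF F] not_False_eq_True simp_thms)
  next
    fix u assume "u \<in> A"
    then obtain p q where *: "u = eval_at x p / eval_at x q"
      "p \<in> mpolys_in F J" "q \<in> mpolys_in F J" "eval_at x q \<noteq> 0" unfolding A_def by blast
    have "- u = eval_at x (Poly_Mapping.single 0 (- 1) * p) / eval_at x q"
      using * by (simp add: hom_uminus hom_one)
    moreover have "Poly_Mapping.single 0 (- 1) * p \<in> mpolys_in F J"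
      by (intro mpolys_in_mult[OF F] mpolys_in_single[OF F] subfield_uminus[OF F] subfield_one[OF F] *(2)) simp
    ultimately show "- u \<in> A" using memI[OF _ *(3,4)] by (simp only:)
    assume "u \<noteq> 0"
    then show "inverse u \<in> A" using memI[OF *(3,2)] * by simp
  qed
  moreover have "h ` F \<subseteq> A"
  proof
    fix c assume "c \<in> h ` F"
    then obtain a where "a \<in> F" "c = h a" by blast
    then show "c \<in> A" using polyI[OF mpolys_in_single[OF F, of a 0]] by simp
  qed
  moreover have "x ` J \<subseteq> A"
    using polyI[OF mpolys_in_mvar[OF F]] by (auto simp: hom_one)
  ultimately have "u \<in> A" using adjoin_subset u by blast
  then show ?thesis unfolding A_def by blast
qed

end

text \<open>An algebraic equation for \<open>x i\<close>, cleared of denominators, becomes a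
  polynomial \<open>M\<close> in the variables of \<open>insert i J\<close> with value zero, hence
  \<open>M = 0\<close> by hypothesis.\<close>

lemma injective_eval_imp_not_acl:
  fixes h :: "'a::alg_closed_field \<Rightarrow> 'b::field"
  assumes h: "field_coeff_hom h" and J: "finite J" "i \<notin> J"
    and inj: "\<And>p. p \<in> mpolys_in UNIV (insert i J) \<Longrightarrow> mpoly_eval_hom h x p = 0 \<Longrightarrow> p = 0"
  shows "x i \<notin> acl (range h) (x ` J)"
proof
  interpret field_coeff_hom h by (rule h)
  note U = is_subfield_UNIV[where ?'a = 'a]
  assume "x i \<in> acl (range h) (x ` J)"
  then obtain P where P: "P \<in> polys_over (adjoin (range h) (x ` J))" "P \<noteq> 0" "poly P (x i) = 0"
    by (auto simp: acl_def algebraic_over_def)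
  define n where "n = Polynomial.degree P"
  have "\<exists>p q. p \<in> mpolys_in UNIV J \<and> q \<in> mpolys_in UNIV J \<and> eval_at x q \<noteq> 0
      \<and> Polynomial.coeff P l = eval_at x p / eval_at x q" for l
    using adjoin_quotients[OF U polys_over_coeff[OF P(1), of l]] by blast
  then obtain p q where pq: "\<And>l. p l \<in> mpolys_in UNIV J" "\<And>l. q l \<in> mpolys_in UNIV J"
    "\<And>l. eval_at x (q l) \<noteq> 0" "\<And>l. Polynomial.coeff P l = eval_at x (p l) / eval_at x (q l)" by metis
  define R where "R = (\<Prod>l\<le>n. eval_at x (q l))"
  have "R \<noteq> 0" using pq by (simp add: R_def)
  define g where "g l = p l * (\<Prod>j\<in>{..n} - {l}. q j)" for l
  have gJ: "g l \<in> mpolys_in UNIV J" for l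
    unfolding g_def by (intro mpolys_in_mult[OF U] mpolys_in_prod[OF U] pq)
  have gx: "eval_at x (g l) = R * Polynomial.coeff P l" if "l \<le> n" for l
  proof -
    have "R = eval_at x (q l) * (\<Prod>j\<in>{..n} - {l}. eval_at x (q j))"
      unfolding R_def using that by (subst prod.remove[of _ l]) auto
    then show ?thesis using pq(3,4)[of l] by (simp add: g_def)
  qed
  define M where "M = (\<Sum>l\<le>n. g l * mvar i ^ l)"
  have "M \<in> mpolys_in UNIV (insert i J)"
    unfolding M_def
    by (intro mpolys_in_sum[OF U] mpolys_in_mult[OF U] mpolys_in_power[OF U] mpolys_in_mvar[OF U]
        mpolys_in_mono[OF _ _ gJ]) auto
  moreover have "eval_at x M = R * poly P (x i)"
    unfolding M_def poly_altdef n_def[symmetric] sum_distrib_left by (simp add: gx mult_ac hom_one)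
  ultimately have "M = 0" using inj P(3) by simp
  have "eval_at x (g n) \<noteq> 0" using gx[of n] \<open>R \<noteq> 0\<close> P(2) by (simp add: n_def)
  then have "g n \<noteq> 0" by auto
  \<comment> \<open>To contradict \<open>M = 0\<close>, the variables in \<open>J\<close> are
    specialised so that the leading coefficient \<open>g n\<close> survives; the polynomial
    \<open>Q\<close> in the remaining variable is then nonzero, yet has every field element as a
    root.\<close>
  then obtain b where b: "mpoly_eval b (g n) \<noteq> 0" using mpoly_nonvanishing[OF J(1) gJ] by blast
  define Q where "Q = (\<Sum>l\<le>n. Polynomial.monom (mpoly_eval b (g l)) l)"
  have "poly Q t = 0" for t
  proof -
    have "mpoly_eval (b(i := t)) (g l) = mpoly_eval b (g l)" for l
      by (rule id_hom.eval_cong[OF gJ]) (use J in auto)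
    then have "mpoly_eval (b(i := t)) M = poly Q t"
      by (simp add: M_def Q_def poly_sum poly_monom)
    then show ?thesis using \<open>M = 0\<close> by simp
  qed
  then have "Q = 0"
    using poly_roots_finite[of Q] infinite_UNIV_alg_closed[where ?'a = 'a] by auto
  moreover have "Polynomial.coeff Q n = mpoly_eval b (g n)"
    by (simp add: Q_def coeff_sum coeff_monom)
  ultimately show False using b by simp
qed

text \<open>Peeling off the last variable turns a relation into a polynomial equation for
  \<open>x n\<close> over the field of the earlier elements; it must be trivial, and the induction
  hypothesis disposes of its coefficients.\<close>

lemma not_acl_imp_injective_eval:
  fixes h :: "'a::field \<Rightarrow> 'b::field"
  assumes h: "field_coeff_hom h" and indep: "\<And>i. i < n \<Longrightarrow> x i \<notin> acl (range h) (x ` {..<i})"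
  shows "p \<in> mpolys_in UNIV {..<n} \<Longrightarrow> mpoly_eval_hom h x p = 0 \<Longrightarrow> p = 0"
  using indep
proof (induction n arbitrary: p)
  interpret field_coeff_hom h by (rule h)
  case 0
  then have "p \<in> mpolys_in UNIV {}" by simp
  then obtain c where c: "p = Poly_Mapping.single 0 c" using mpolys_in_empty by blast
  then show ?case using 0 hom_inj[of c] by simp
next
  interpret field_coeff_hom h by (rule h)
  case (Suc n)
  have J: "{..<Suc n} = insert n {..<n}" "{..<n} - {n} = {..<n}" by auto
  obtain N q where q: "\<And>l. q l \<in> mpolys_in UNIV {..<n}" "p = (\<Sum>l\<le>N. q l * mvar n ^ l)"
    using mpolys_in_decompose[OF is_subfield_UNIV, of p n "{..<n}"] Suc.prems(1) unfolding J by blast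
  define Q where "Q = (\<Sum>l\<le>N. Polynomial.monom (eval_at x (q l)) l)"
  have "Q \<in> polys_over (adjoin (range h) (x ` {..<n}))"
    unfolding Q_def by (intro polys_over_sum[OF is_subfield_adjoin] polys_over_monom[OF is_subfield_adjoin]
        eval_in_adjoin[OF is_subfield_UNIV] q)
  moreover have "poly Q (x n) = 0"
    using Suc.prems(2) unfolding q(2) by (simp add: Q_def poly_sum poly_monom hom_one)
  ultimately have "Q = 0" using Suc.prems(3)[of n] by (auto simp: acl_def algebraic_over_def)
  have "q l = 0" if "l \<le> N" for l
  proof (rule Suc.IH[OF q(1)])
    have "Polynomial.coeff Q l = eval_at x (q l)" using that by (simp add: Q_def coeff_sum coeff_monom)
    then show "eval_at x (q l) = 0" using \<open>Q = 0\<close> by simp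
  qed (use Suc.prems(3) in simp)
  then show ?case by (simp add: q(2))
qed

section \<open>The generic point of affine space\<close>

definition generic_coord :: "nat \<Rightarrow> 'a::field universal_domain" where
  "generic_coord i = to_ac (Fract (mvar i) 1)"

lemma Fract_1_add: "Fract (a + b) 1 = Fract a 1 + Fract b (1::'a::idom)"
  by simp

lemma Fract_1_mult: "Fract (a * b) 1 = Fract a 1 * Fract b (1::'a::idom)"
  by simp

lemma field_coeff_hom_const_embed: "field_coeff_hom (const_embed :: 'a::field \<Rightarrow> _)"
proof
  show "const_embed 0 = 0" "const_embed 1 = 1"
    by (simp_all add: const_embed_def fract_collapse One_fract_def[symmetric])
  fix a b :: 'a
  show "const_embed (a + b) = const_embed a + const_embed b"
    unfolding const_embed_def single_add by (simp only: Fract_1_add to_ac_add)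
  show "const_embed (a * b) = const_embed a * const_embed b"
  proof -
    have "(Poly_Mapping.single 0 (a * b) :: 'a mpoly) = Poly_Mapping.single 0 a * Poly_Mapping.single 0 b"
      by (simp add: mult_single)
    then show ?thesis unfolding const_embed_def by (simp only: Fract_1_mult to_ac_mult)
  qed
  show "a = 0" if "const_embed a = 0"
  proof -
    have "Fract (Poly_Mapping.single 0 a :: 'a mpoly) 1 = 0" using that by (simp add: const_embed_def)
    then have "(Poly_Mapping.single 0 a :: 'a mpoly) = 0" by (simp add: Zero_fract_def eq_fract)
    then have "Poly_Mapping.lookup (Poly_Mapping.single (0 :: nat \<Rightarrow>\<^sub>0 nat) a) 0 = 0" by simp
    then show ?thesis by simp
  qed
qed

interpretation ce: field_coeff_hom "const_embed :: 'a::field \<Rightarrow> 'a universal_domain"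
  by (rule field_coeff_hom_const_embed)

text \<open>Evaluation at the coordinates is the embedding of the polynomial ring into the closure
  of its fraction field, as the two agree on constants and variables. Injectivity is then
  immediate.\<close>

lemma generic_eval_generic_coord:
  fixes p :: "'a::field mpoly"
  shows "generic_eval generic_coord p = to_ac (Fract p 1)"
proof -
  define \<phi> :: "'a mpoly \<Rightarrow> 'a universal_domain" where "\<phi> p = to_ac (Fract p 1)" for p
  have add: "\<phi> (p + q) = \<phi> p + \<phi> q" and mult: "\<phi> (p * q) = \<phi> p * \<phi> q" for p q
    unfolding \<phi>_def by (simp_all only: Fract_1_add Fract_1_mult to_ac_add to_ac_mult)
  have zero: "\<phi> 0 = 0" and one: "\<phi> 1 = 1"
    by (simp_all add: \<phi>_def fract_collapse One_fract_def[symmetric])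
  have sum: "\<phi> (sum f A) = (\<Sum>a\<in>A. \<phi> (f a))" for f and A :: "(nat \<Rightarrow>\<^sub>0 nat) set"
    by (induction A rule: infinite_finite_induct) (auto simp: zero add)
  have power: "\<phi> (q ^ l) = \<phi> q ^ l" for q l by (induction l) (auto simp: one mult)
  have mon: "\<phi> (Poly_Mapping.single (\<Sum>i\<in>A. Poly_Mapping.single i (e i)) 1) = (\<Prod>i\<in>A. generic_coord i ^ e i)"
    if "finite A" for A :: "nat set" and e
    using that
  proof (induction A rule: finite_induct)
    case (insert i A)
    have "Poly_Mapping.single (\<Sum>i\<in>insert i A. Poly_Mapping.single i (e i)) (1::'a)
      = mvar i ^ e i * Poly_Mapping.single (\<Sum>i\<in>A. Poly_Mapping.single i (e i)) 1"
      using insert.hyps unfolding mvar_power mult_single by simp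
    then show ?case using insert by (simp only: mult power) (simp add: \<phi>_def generic_coord_def)
  qed (simp add: one)
  have single: "\<phi> (Poly_Mapping.single m c) = const_embed c * monom_eval generic_coord m" for m c
  proof -
    have m: "(\<Sum>i\<in>Poly_Mapping.keys m. Poly_Mapping.single i (Poly_Mapping.lookup m i)) = m"
      by (rule poly_mapping_sum_singles[symmetric])
    have "Poly_Mapping.single m c = Poly_Mapping.single 0 c * Poly_Mapping.single m 1"
      by (simp add: mult_single)
    also have "\<phi> \<dots> = const_embed c * \<phi> (Poly_Mapping.single m 1)"
      unfolding mult by (simp add: \<phi>_def const_embed_def)
    also have "\<phi> (Poly_Mapping.single m 1) = monom_eval generic_coord m"
      using mon[of "Poly_Mapping.keys m" "Poly_Mapping.lookup m"] unfolding m monom_eval_def by simp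
    finally show ?thesis .
  qed
  have "\<phi> p = (\<Sum>m\<in>Poly_Mapping.keys p. const_embed (Poly_Mapping.lookup p m) * monom_eval generic_coord m)"
    by (subst poly_mapping_sum_singles) (simp only: sum single)
  then show ?thesis by (simp add: \<phi>_def mpoly_eval_hom_def monom_eval_def)
qed

lemma generic_eval_eq_0_iff: "generic_eval generic_coord p = 0 \<longleftrightarrow> p = 0"
  by (simp add: generic_eval_generic_coord Zero_fract_def eq_fract)

lemma generic_eval_eq_iff: "generic_eval generic_coord p = generic_eval generic_coord q \<longleftrightarrow> p = q"
  by (simp add: generic_eval_generic_coord eq_fract)

lemma generic_coord_not_acl:
  fixes J :: "nat set"
  assumes "finite J" "i \<notin> J"
  shows "generic_coord i \<notin> acl (range (const_embed :: 'a::alg_closed_field \<Rightarrow> _)) (generic_coord ` J)"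
  by (rule injective_eval_imp_not_acl[OF field_coeff_hom_const_embed assms])
    (simp add: generic_eval_eq_0_iff)

section \<open>Affine space as a variety\<close>

lemma mpoly_nonvanishing_affine:
  fixes p :: "'a::alg_closed_field mpoly"
  assumes "p \<in> mpolys_over UNIV n" "p \<noteq> 0"
  shows "\<exists>b\<in>affine_space n UNIV. mpoly_eval b p \<noteq> 0"
proof -
  have p: "p \<in> mpolys_in UNIV {..<n}" using assms by (simp add: mpolys_over_eq)
  obtain b where b: "mpoly_eval b p \<noteq> 0" using mpoly_nonvanishing[OF _ p assms(2)] by auto
  have "mpoly_eval (restrict b {..<n}) p = mpoly_eval b p"
    by (rule id_hom.eval_cong[OF p]) simp
  then show ?thesis using b by (intro bexI[of _ "restrict b {..<n}"]) (auto simp: affine_space_def)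
qed

lemma vanishing_ideal_affine_space:
  fixes F :: "'a::alg_closed_field set"
  assumes "is_subfield F"
  shows "vanishing_ideal F n (affine_space n UNIV) = {0}"
proof -
  have "p = 0" if "p \<in> mpolys_over F n" "\<forall>x\<in>affine_space n UNIV. mpoly_eval x p = 0" for p :: "'a mpoly"
  proof -
    have "p \<in> mpolys_over UNIV n" using that(1) by (auto simp: mpolys_over_def)
    then show ?thesis using mpoly_nonvanishing_affine that(2) by blast
  qed
  moreover have "0 \<in> mpolys_over F n" by (simp add: mpolys_over_eq mpolys_in_zero[OF assms])
  ultimately show ?thesis unfolding vanishing_ideal_def by auto
qed

text \<open>If two proper closed sets covered the space, the product of a nonzero equation for each
  would vanish everywhere. The ideal of the whole space is zero, so the empty set generates it over
  any field.\<close>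

lemma abs_irreducible_variety_affine_space:
  fixes K :: "'a::alg_closed_field set"
  assumes "is_subfield K"
  shows "abs_irreducible_variety K n (affine_space n UNIV)"
proof -
  let ?V = "affine_space n UNIV :: (nat \<Rightarrow> 'a) set"
  have "zariski_closed n ?V" unfolding zariski_closed_def by (intro exI[of _ "{}"]) simp
  moreover have "(\<lambda>i\<in>{..<n}. 0) \<in> ?V" by (simp add: affine_space_def)
  moreover have "?V = A \<or> ?V = B" if AB: "zariski_closed n A" "zariski_closed n B" "?V = A \<union> B" for A B
  proof (rule ccontr)
    assume neq: "\<not> (?V = A \<or> ?V = B)"
    have ex: "\<exists>p\<in>mpolys_over UNIV n. p \<noteq> 0 \<and> (\<forall>x\<in>C. mpoly_eval x p = 0)"
      if C: "zariski_closed n C" "?V \<noteq> C" for C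
    proof -
      obtain S where S: "S \<subseteq> mpolys_over UNIV n" "C = {x \<in> ?V. \<forall>p\<in>S. mpoly_eval x p = 0}"
        using C(1) unfolding zariski_closed_def by blast
      have "\<exists>p\<in>S. p \<noteq> 0"
      proof (rule ccontr)
        assume "\<not> (\<exists>p\<in>S. p \<noteq> 0)"
        then have "C = ?V" unfolding S(2) by auto
        then show False using C(2) by simp
      qed
      then show ?thesis using S by blast
    qed
    obtain p q where pq: "p \<in> mpolys_over UNIV n" "p \<noteq> 0" "\<forall>x\<in>A. mpoly_eval x p = 0"
      "q \<in> mpolys_over UNIV n" "q \<noteq> 0" "\<forall>x\<in>B. mpoly_eval x q = 0"
      using ex[OF AB(1)] ex[OF AB(2)] neq by blast
    have "p * q \<in> mpolys_over UNIV n" "p * q \<noteq> 0"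
      using pq mpolys_in_mult[OF is_subfield_UNIV] by (auto simp: mpolys_over_eq)
    then obtain b where "b \<in> ?V" "mpoly_eval b (p * q) \<noteq> 0" using mpoly_nonvanishing_affine by blast
    then show False using pq AB(3) by auto
  qed
  ultimately have "irreducible_closed n ?V" unfolding irreducible_closed_def by blast
  moreover have "defined_over K n ?V"
    unfolding defined_over_def vanishing_ideal_affine_space[OF is_subfield_UNIV]
    by (intro ballI exI[of _ "{}"]) simp
  ultimately show ?thesis by (simp add: abs_irreducible_variety_def)
qed

lemma generic_point_affine_space:
  fixes K :: "'a::alg_closed_field set"
  assumes "is_subfield K"
  shows "generic_point K n (affine_space n UNIV) generic_coord"
  unfolding generic_point_def vanishing_ideal_affine_space[OF assms] generic_eval_eq_0_iff by simp

lemma has_dimension_generic_coord: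
  fixes K :: "'a::alg_closed_field set"
  assumes K: "is_subfield K"
  shows "has_dimension K n generic_coord n"
proof -
  have "alg_independent (const_embed ` K) n generic_coord"
    unfolding alg_independent_def
  proof (intro ballI impI)
    fix p assume p: "p \<in> mpolys_over (const_embed ` K) n" "mpoly_eval generic_coord p = 0"
    have "\<exists>c. Poly_Mapping.lookup p m = const_embed c" for m
      using p(1) by (auto simp: mpolys_over_def)
    then obtain c where c: "\<And>m. Poly_Mapping.lookup p m = const_embed (c m)" by metis
    define q where "q = (\<Sum>m\<in>Poly_Mapping.keys p. Poly_Mapping.single m (c m))"
    have "generic_eval generic_coord q = mpoly_eval generic_coord p"
      by (simp add: q_def mpoly_eval_hom_def[of _ _ p] c monom_eval_def)
    then have "q = 0" using p(2) by (simp add: generic_eval_eq_0_iff)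
    have "c m = 0" if "m \<in> Poly_Mapping.keys p" for m
    proof -
      have "Poly_Mapping.lookup q m = (\<Sum>m'\<in>Poly_Mapping.keys p. if m' = m then c m else 0)"
        unfolding q_def lookup_sum lookup_single by (intro sum.cong) (auto simp: when_def)
      also have "\<dots> = c m" using that by simp
      finally show ?thesis using \<open>q = 0\<close> by simp
    qed
    then have "Poly_Mapping.keys p = {}" using c ce.hom_zero by (metis equals0I in_keys_iff)
    then show "p = 0" by simp
  qed
  moreover have "generic_coord i \<in> function_field K n generic_coord" if "i < n" for i
    unfolding function_field_def by (rule adjoin_gen) (use that in simp)
  ultimately show ?thesis
    unfolding has_dimension_def has_trdeg_def function_field_def
    using algebraic_over_base[OF is_subfield_adjoin] by blast
qed

section \<open>Specialisation of rational functions\<close>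

text \<open>Coefficients from the whole ambient field are allowed, since the computations at
  \<open>b\<close> involve conjugates of \<alpha> and \<theta> that may lie outside
  \<open>K\<close>. A relation rather than a function reflects that a rational function may have no
  value at \<open>b\<close>.\<close>

abbreviation specializes ::
  "nat \<Rightarrow> (nat \<Rightarrow> 'a::alg_closed_field) \<Rightarrow> 'a universal_domain \<Rightarrow> 'a \<Rightarrow> bool" where
  "specializes n b \<phi> c \<equiv> rational_function_value UNIV n generic_coord \<phi> b c"

context
  fixes n :: nat and b :: "nat \<Rightarrow> 'a::alg_closed_field"
begin

lemma specializesI:
  assumes "p \<in> mpolys_in UNIV {..<n}" "q \<in> mpolys_in UNIV {..<n}" "mpoly_eval b q \<noteq> 0"
    and "\<phi> * generic_eval generic_coord q = generic_eval generic_coord p"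
    and "c * mpoly_eval b q = mpoly_eval b p"
  shows "specializes n b \<phi> c"
proof -
  have "q \<noteq> 0" using assms(3) by auto
  then have "generic_eval generic_coord q \<noteq> 0" by (simp add: generic_eval_eq_0_iff)
  then have "\<phi> = generic_eval generic_coord p / generic_eval generic_coord q"
    using assms(4) by (metis nonzero_eq_divide_eq)
  moreover have "c = mpoly_eval b p / mpoly_eval b q"
    using assms(3,5) by (metis nonzero_eq_divide_eq)
  ultimately show ?thesis unfolding rational_function_value_def mpolys_over_eq
    using assms(1,2,3) \<open>generic_eval generic_coord q \<noteq> 0\<close> by blast
qed

lemma specializesE:
  assumes "specializes n b \<phi> c"
  obtains p q where "p \<in> mpolys_in UNIV {..<n}" "q \<in> mpolys_in UNIV {..<n}" "mpoly_eval b q \<noteq> 0"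
    "\<phi> * generic_eval generic_coord q = generic_eval generic_coord p" "c * mpoly_eval b q = mpoly_eval b p"
  using assms unfolding rational_function_value_def mpolys_over_eq by force

lemma specializes_of_rational_function_value:
  "rational_function_value K n generic_coord \<phi> b c \<Longrightarrow> specializes n b \<phi> c"
  unfolding rational_function_value_def mpolys_over_def by blast

lemma specializes_unique:
  assumes "specializes n b \<phi> c" "specializes n b \<phi> c'"
  shows "c = c'"
proof -
  obtain p q where pq: "mpoly_eval b q \<noteq> 0"
    "\<phi> * generic_eval generic_coord q = generic_eval generic_coord p" "c * mpoly_eval b q = mpoly_eval b p"
    using specializesE[OF assms(1)] by metis
  obtain p' q' where pq': "mpoly_eval b q' \<noteq> 0"
    "\<phi> * generic_eval generic_coord q' = generic_eval generic_coord p'" "c' * mpoly_eval b q' = mpoly_eval b p'"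
    using specializesE[OF assms(2)] by metis
  have "generic_eval generic_coord (p * q') = generic_eval generic_coord (p' * q)"
    by (simp flip: pq(2) pq'(2))
  then have "mpoly_eval b (p * q') = mpoly_eval b (p' * q)" by (simp only: generic_eval_eq_iff)
  then have "c * (mpoly_eval b q * mpoly_eval b q') = c' * (mpoly_eval b q * mpoly_eval b q')"
    by (simp add: mult_ac flip: pq(3) pq'(3))
  then show ?thesis using pq(1) pq'(1) by simp
qed

lemma specializes_const: "specializes n b (const_embed a) a"
  by (rule specializesI[of "Poly_Mapping.single 0 a" 1])
    (auto intro: mpolys_in_single[OF is_subfield_UNIV] mpolys_in_one[OF is_subfield_UNIV])

lemma specializes_coord: "i < n \<Longrightarrow> specializes n b (generic_coord i) (b i)"
  by (rule specializesI[OF mpolys_in_mvar[OF is_subfield_UNIV] mpolys_in_one[OF is_subfield_UNIV]])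
    (simp_all add: ce.hom_one)

lemma specializes_add:
  assumes "specializes n b \<phi> c" "specializes n b \<psi> d"
  shows "specializes n b (\<phi> + \<psi>) (c + d)"
proof -
  obtain p q where pq: "p \<in> mpolys_in UNIV {..<n}" "q \<in> mpolys_in UNIV {..<n}" "mpoly_eval b q \<noteq> 0"
    "\<phi> * generic_eval generic_coord q = generic_eval generic_coord p" "c * mpoly_eval b q = mpoly_eval b p"
    using specializesE[OF assms(1)] .
  obtain p' q' where pq': "p' \<in> mpolys_in UNIV {..<n}" "q' \<in> mpolys_in UNIV {..<n}" "mpoly_eval b q' \<noteq> 0"
    "\<psi> * generic_eval generic_coord q' = generic_eval generic_coord p'" "d * mpoly_eval b q' = mpoly_eval b p'"
    using specializesE[OF assms(2)] .
  show ?thesis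
  proof (rule specializesI[of "p * q' + p' * q" "q * q'"])
    show "p * q' + p' * q \<in> mpolys_in UNIV {..<n}" "q * q' \<in> mpolys_in UNIV {..<n}"
      by (intro mpolys_in_add[OF is_subfield_UNIV] mpolys_in_mult[OF is_subfield_UNIV] pq pq')+
    show "mpoly_eval b (q * q') \<noteq> 0" using pq(3) pq'(3) by simp
  qed (simp_all add: algebra_simps flip: pq(4,5) pq'(4,5))
qed

lemma specializes_mult:
  assumes "specializes n b \<phi> c" "specializes n b \<psi> d"
  shows "specializes n b (\<phi> * \<psi>) (c * d)"
proof -
  obtain p q where pq: "p \<in> mpolys_in UNIV {..<n}" "q \<in> mpolys_in UNIV {..<n}" "mpoly_eval b q \<noteq> 0"
    "\<phi> * generic_eval generic_coord q = generic_eval generic_coord p" "c * mpoly_eval b q = mpoly_eval b p"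
    using specializesE[OF assms(1)] .
  obtain p' q' where pq': "p' \<in> mpolys_in UNIV {..<n}" "q' \<in> mpolys_in UNIV {..<n}" "mpoly_eval b q' \<noteq> 0"
    "\<psi> * generic_eval generic_coord q' = generic_eval generic_coord p'" "d * mpoly_eval b q' = mpoly_eval b p'"
    using specializesE[OF assms(2)] .
  show ?thesis
  proof (rule specializesI[of "p * p'" "q * q'"])
    show "p * p' \<in> mpolys_in UNIV {..<n}" "q * q' \<in> mpolys_in UNIV {..<n}"
      by (intro mpolys_in_mult[OF is_subfield_UNIV] pq pq')+
    show "mpoly_eval b (q * q') \<noteq> 0" using pq(3) pq'(3) by simp
  qed (simp_all add: algebra_simps flip: pq(4,5) pq'(4,5))
qed

lemma specializes_0: "specializes n b 0 0" and specializes_1: "specializes n b 1 1"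
  using specializes_const[of 0] specializes_const[of 1] by (simp_all add: ce.hom_zero ce.hom_one)

lemma specializes_uminus: "specializes n b \<phi> c \<Longrightarrow> specializes n b (- \<phi>) (- c)"
  using specializes_mult[OF specializes_const[of "- 1"], of \<phi> c] by (simp add: ce.hom_uminus ce.hom_one)

lemma specializes_diff:
  "specializes n b \<phi> c \<Longrightarrow> specializes n b \<psi> d \<Longrightarrow> specializes n b (\<phi> - \<psi>) (c - d)"
  using specializes_add[of \<phi> c "- \<psi>" "- d"] specializes_uminus[of \<psi> d] by simp

lemma specializes_power: "specializes n b \<phi> c \<Longrightarrow> specializes n b (\<phi> ^ l) (c ^ l)"
  by (induction l) (auto intro: specializes_1 specializes_mult)

lemma specializes_sum:
  "(\<And>a. a \<in> A \<Longrightarrow> specializes n b (f a) (g a)) \<Longrightarrow> specializes n b (sum f A) (sum g A)"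
  by (induction A rule: infinite_finite_induct) (auto intro: specializes_0 specializes_add)

lemma specializes_prod:
  "(\<And>a. a \<in> A \<Longrightarrow> specializes n b (f a) (g a)) \<Longrightarrow> specializes n b (prod f A) (prod g A)"
  by (induction A rule: infinite_finite_induct) (auto intro: specializes_1 specializes_mult)

lemma specializes_generic_eval:
  assumes "\<And>i. i < n \<Longrightarrow> specializes n b (\<nu> i) (y i)" "r \<in> mpolys_in UNIV {..<n}"
  shows "specializes n b (generic_eval \<nu> r) (mpoly_eval y r)"
  unfolding mpoly_eval_hom_def
  by (intro specializes_sum specializes_mult specializes_const specializes_prod specializes_power assms(1))
    (use assms(2) in \<open>auto simp: mpolys_in_def\<close>)

text \<open>No condition on degrees is imposed, since leading coefficients may vanish at
  \<open>b\<close>.\<close>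

definition specializes_poly :: "'a universal_domain poly \<Rightarrow> 'a poly \<Rightarrow> bool" where
  "specializes_poly P p \<longleftrightarrow> (\<forall>i. specializes n b (Polynomial.coeff P i) (Polynomial.coeff p i))"

lemma poly_eq_sum_coeffs:
  fixes p :: "'c::comm_semiring_1 poly"
  shows "Polynomial.degree p \<le> N \<Longrightarrow> poly p x = (\<Sum>i\<le>N. Polynomial.coeff p i * x ^ i)"
  unfolding poly_altdef by (rule sum.mono_neutral_left) (auto simp: coeff_eq_0)

lemma specializes_poly_eval:
  assumes "specializes_poly P p" "specializes n b \<phi> c"
  shows "specializes n b (poly P \<phi>) (poly p c)"
proof -
  let ?N = "max (Polynomial.degree P) (Polynomial.degree p)"
  show ?thesis
    unfolding poly_eq_sum_coeffs[of P ?N, OF max.cobounded1] poly_eq_sum_coeffs[of p ?N, OF max.cobounded2]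
    using assms unfolding specializes_poly_def
    by (intro specializes_sum specializes_mult specializes_power) auto
qed

lemma specializes_poly_mult:
  "specializes_poly P p \<Longrightarrow> specializes_poly Q q \<Longrightarrow> specializes_poly (P * Q) (p * q)"
  unfolding specializes_poly_def coeff_mult by (intro allI specializes_sum specializes_mult) auto

lemma specializes_poly_pCons:
  "specializes n b \<phi> c \<Longrightarrow> specializes_poly P p \<Longrightarrow> specializes_poly (pCons \<phi> P) (pCons c p)"
  by (auto simp: specializes_poly_def coeff_pCons split: nat.splits)

lemma specializes_poly_0: "specializes_poly 0 0"
  by (simp add: specializes_poly_def specializes_0)

lemma specializes_poly_1: "specializes_poly 1 1"
  using specializes_poly_pCons[OF specializes_1 specializes_poly_0] by (simp add: one_pCons)

lemma specializes_poly_prod: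
  "(\<And>a. a \<in> A \<Longrightarrow> specializes_poly (f a) (g a)) \<Longrightarrow> specializes_poly (prod f A) (prod g A)"
  by (induction A rule: infinite_finite_induct) (auto intro: specializes_poly_1 specializes_poly_mult)

lemma specializes_of_nat: "specializes n b (of_nat l) (of_nat l)"
  by (induction l) (auto intro: specializes_0 specializes_add specializes_1)

lemma specializes_poly_pderiv: "specializes_poly P p \<Longrightarrow> specializes_poly (pderiv P) (pderiv p)"
  unfolding specializes_poly_def coeff_pderiv by (intro allI specializes_mult specializes_of_nat) auto

end

section \<open>Rational points over PAC extensions\<close>

text \<open>For a nonzero \<open>r\<close> among the equations of \<open>Z\<close>, the function
  \<open>r(\<nu>)\<close> is nonzero, so at a suitable point \<open>b\<close> the map
  \<open>\<nu>\<close> is defined and \<open>r(\<nu>)\<close> has a nonzero value; but the image of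
  \<open>b\<close> lies in \<open>Z\<close>, where \<open>r\<close> vanishes.\<close>

lemma dominant_of_independent:
  fixes K :: "'a::alg_closed_field set"
  assumes K: "is_subfield K"
    and nu: "\<And>i. i < n \<Longrightarrow> \<nu> i \<in> function_field K n generic_coord"
    and indep: "\<And>r. r \<in> mpolys_in UNIV {..<n} \<Longrightarrow> generic_eval \<nu> r = 0 \<Longrightarrow> r = 0"
  shows "dominant K n (affine_space n UNIV) generic_coord n \<nu>"
  unfolding dominant_def
proof (intro allI impI, elim conjE)
  note U = is_subfield_UNIV[where ?'a = 'a]
  let ?V = "affine_space n UNIV :: (nat \<Rightarrow> 'a) set"
  fix Z assume "zariski_closed n Z"
    and Z: "{y \<in> ?V. \<exists>b\<in>?V. rational_map_value K n generic_coord n \<nu> b y} \<subseteq> Z"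
  then obtain S where S: "S \<subseteq> mpolys_over UNIV n" "Z = {x \<in> ?V. \<forall>p\<in>S. mpoly_eval x p = 0}"
    unfolding zariski_closed_def by blast
  have "\<exists>p q. p \<in> mpolys_in K {..<n} \<and> q \<in> mpolys_in K {..<n} \<and> generic_eval generic_coord q \<noteq> 0
      \<and> \<nu> i = generic_eval generic_coord p / generic_eval generic_coord q" if "i < n" for i
    using ce.adjoin_quotients[OF K, of "\<nu> i" generic_coord "{..<n}"] nu[OF that] unfolding function_field_def by blast
  then obtain p q where pq: "\<And>i. i < n \<Longrightarrow> p i \<in> mpolys_in K {..<n}" "\<And>i. i < n \<Longrightarrow> q i \<in> mpolys_in K {..<n}"
    "\<And>i. i < n \<Longrightarrow> generic_eval generic_coord (q i) \<noteq> 0"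
    "\<And>i. i < n \<Longrightarrow> \<nu> i = generic_eval generic_coord (p i) / generic_eval generic_coord (q i)" by metis
  have "r = 0" if "r \<in> S" for r
  proof (rule ccontr)
    assume "r \<noteq> 0"
    have r: "r \<in> mpolys_in UNIV {..<n}" using S(1) that by (auto simp: mpolys_over_eq)
    define \<phi> where "\<phi> = generic_eval \<nu> r"
    have "\<phi> \<noteq> 0" using indep[OF r] \<open>r \<noteq> 0\<close> by (auto simp: \<phi>_def)
    have sub: "adjoin (const_embed ` K) (generic_coord ` {..<n}) \<subseteq> adjoin (range const_embed) (generic_coord ` {..<n})"
      by (rule adjoin_mono) auto
    have "\<phi> \<in> adjoin (range const_embed) (\<nu> ` {..<n})"
      unfolding \<phi>_def by (rule ce.eval_in_adjoin[OF U r])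
    moreover have "adjoin (range const_embed) (\<nu> ` {..<n}) \<subseteq> adjoin (range const_embed) (generic_coord ` {..<n})"
      by (rule adjoin_subset[OF is_subfield_adjoin])
        (use nu sub in \<open>auto simp: function_field_def intro: adjoin_base\<close>)
    ultimately obtain P Q where PQ: "P \<in> mpolys_in UNIV {..<n}" "Q \<in> mpolys_in UNIV {..<n}"
      "generic_eval generic_coord Q \<noteq> 0" "\<phi> = generic_eval generic_coord P / generic_eval generic_coord Q"
      using ce.adjoin_quotients[OF U, of \<phi> generic_coord "{..<n}"] by blast
    \<comment> \<open>Nonvanishing of this product at \<open>b\<close> ensures that all components
      of \<open>\<nu>\<close> are defined there through the denominators \<open>q i\<close>, and
      that \<open>\<phi> = P / Q\<close> has a nonzero value.\<close>
    define t where "t = P * Q * (\<Prod>i<n. q i)"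
    have qU: "q i \<in> mpolys_in UNIV {..<n}" "p i \<in> mpolys_in UNIV {..<n}" if "i < n" for i
      using mpolys_in_mono[OF _ order_refl pq(2)[OF that]] mpolys_in_mono[OF _ order_refl pq(1)[OF that]] by auto
    have "P \<noteq> 0" "Q \<noteq> 0" using PQ \<open>\<phi> \<noteq> 0\<close> by auto
    moreover have "q i \<noteq> 0" if "i < n" for i using pq(3)[OF that] by auto
    ultimately have "t \<noteq> 0" by (simp add: t_def)
    moreover have "t \<in> mpolys_over UNIV n"
      unfolding t_def mpolys_over_eq
      by (intro mpolys_in_mult[OF U] mpolys_in_prod[OF U] PQ) (use qU in auto)
    ultimately obtain b where b: "b \<in> ?V" "mpoly_eval b t \<noteq> 0" using mpoly_nonvanishing_affine by blast
    have bq: "mpoly_eval b (q i) \<noteq> 0" if "i < n" for i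
      using b(2) that by (auto simp: t_def)
    have bPQ: "mpoly_eval b P \<noteq> 0" "mpoly_eval b Q \<noteq> 0" using b(2) by (auto simp: t_def)
    define y where "y = (\<lambda>i\<in>{..<n}. mpoly_eval b (p i) / mpoly_eval b (q i))"
    have val: "rational_function_value K n generic_coord (\<nu> i) b (y i)" if "i < n" for i
      unfolding rational_function_value_def mpolys_over_eq
      using pq(1-4)[OF that] bq[OF that] that by (auto simp: y_def)
    then have "rational_map_value K n generic_coord n \<nu> b y" by (simp add: rational_map_value_def)
    moreover have "y \<in> ?V" by (auto simp: y_def affine_space_def)
    ultimately have "y \<in> Z" using Z b(1) by blast
    then have "mpoly_eval y r = 0" using that S(2) by blast
    moreover have "specializes n b \<phi> (mpoly_eval y r)"
      unfolding \<phi>_def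
      by (rule specializes_generic_eval[OF _ r]) (rule specializes_of_rational_function_value[OF val])
    moreover have "specializes n b \<phi> (mpoly_eval b P / mpoly_eval b Q)"
      unfolding rational_function_value_def mpolys_over_eq using PQ bPQ by blast
    ultimately have "mpoly_eval b P / mpoly_eval b Q = 0" using specializes_unique by metis
    then show False using bPQ by simp
  qed
  then have "mpoly_eval x r = 0" if "r \<in> S" for x r using that id_hom.eval_zero by metis
  then show "Z = ?V" unfolding S(2) by blast
qed

text \<open>Dominance is deduced from separability: the \<open>n\<close> coordinates are algebraic
  over the components of \<open>\<nu>\<close>, so these \<open>n\<close> components are
  algebraically independent. Independence is proved over constants from the whole ambient field,
  because dominance concerns closed sets defined there.\<close>

lemma PAC_extension_affine_space:
  fixes K0 K :: "'a::alg_closed_field set"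
  assumes PAC: "PAC_extension K0 K" and n: "n \<ge> 1"
    and nu: "\<And>i. i < n \<Longrightarrow> \<nu> i \<in> adjoin (const_embed ` K) (generic_coord ` {..<n})"
    and sep: "\<And>i. i < n \<Longrightarrow> generic_coord i \<in> separable_closure (adjoin (const_embed ` K) (\<nu> ` {..<n}))"
  shows "\<exists>b a. (\<forall>i<n. b i \<in> K \<and> a i \<in> K0 \<and> specializes n b (\<nu> i) (a i))"
proof -
  have fe: "field_extension K0 K" using PAC by (simp add: PAC_extension_def)
  then have K: "is_subfield K" by (simp add: field_extension_def)
  let ?\<xi> = "generic_coord :: nat \<Rightarrow> 'a universal_domain"
  let ?k = "range (const_embed :: 'a \<Rightarrow> _)"
  let ?M = "adjoin (const_embed ` K) (\<nu> ` {..<n})"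
  have alg: "?\<xi> i \<in> acl ?k (\<nu> ` {..<n})" if "i < n" for i
  proof -
    have "algebraic_over ?M (?\<xi> i)"
      using sep[OF that] separable_imp_algebraic[OF is_subfield_adjoin] by (simp add: separable_closure_def)
    moreover have "?M \<subseteq> adjoin ?k (\<nu> ` {..<n})" by (rule adjoin_mono) auto
    ultimately show ?thesis unfolding acl_def using algebraic_over_mono by blast
  qed
  have nacl: "\<nu> i \<notin> acl ?k (\<nu> ` {..<i})" if "i < n" for i
  proof -
    have "\<nu> i \<notin> acl ?k (\<nu> ` ({..<n} - {i}))"
    proof (rule acl_generators_independent[OF _ alg that])
      show "?\<xi> j \<notin> acl ?k (?\<xi> ` ({..<n} - {j}))" for j by (rule generic_coord_not_acl) auto
    qed
    moreover have "acl ?k (\<nu> ` {..<i}) \<subseteq> acl ?k (\<nu> ` ({..<n} - {i}))"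
      by (rule acl_mono) (use that in auto)
    ultimately show ?thesis by blast
  qed
  have "dominant K n (affine_space n UNIV) ?\<xi> n \<nu>"
  proof (rule dominant_of_independent[OF K])
    show "\<nu> i \<in> function_field K n ?\<xi>" if "i < n" for i using nu[OF that] by (simp add: function_field_def)
    show "r = 0" if "r \<in> mpolys_in UNIV {..<n}" "generic_eval \<nu> r = 0" for r
      by (rule not_acl_imp_injective_eval[OF field_coeff_hom_const_embed _ that]) (rule nacl)
  qed
  moreover have "separable_map K n ?\<xi> n \<nu>"
    unfolding separable_map_def separable_algebraic_extension_def field_extension_def function_field_def
  proof (intro conjI is_subfield_adjoin ballI)
    show "?M \<subseteq> adjoin (const_embed ` K) (?\<xi> ` {..<n})"
      by (rule adjoin_subset[OF is_subfield_adjoin]) (use nu in \<open>auto intro: adjoin_base\<close>)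
    have "const_embed ` K \<subseteq> separable_closure ?M"
      using separable_closure_base[OF is_subfield_adjoin] adjoin_base by blast
    then have "adjoin (const_embed ` K) (?\<xi> ` {..<n}) \<subseteq> separable_closure ?M"
      by (rule adjoin_subset[OF is_subfield_separable_closure[OF is_subfield_adjoin]]) (use sep in auto)
    then show "separable_over ?M x" if "x \<in> adjoin (const_embed ` K) (?\<xi> ` {..<n})" for x
      using that by (auto simp: separable_closure_def)
  qed
  moreover have "rational_map K n ?\<xi> n \<nu>"
    using nu by (simp add: rational_map_def function_field_def)
  ultimately obtain b a where ba: "b \<in> affine_space n K" "a \<in> affine_space n K0"
    "rational_map_value K n ?\<xi> n \<nu> b a"
    using PAC[unfolded PAC_extension_def, THEN conjunct2, THEN spec[of _ n],
        THEN spec[of _ "affine_space n UNIV"], THEN spec[of _ ?\<xi>], THEN spec[of _ n], THEN spec[of _ \<nu>]]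
      n abs_irreducible_variety_affine_space[OF K, of n] generic_point_affine_space[OF K, of n]
      has_dimension_generic_coord[OF K, of n] by blast
  show ?thesis
  proof (rule exI[of _ b], rule exI[of _ a], intro allI impI conjI)
    fix i assume "i < n"
    then show "b i \<in> K" "a i \<in> K0" using ba(1,2) by (auto simp: affine_space_def)
    show "specializes n b (\<nu> i) (a i)"
      using ba(3) \<open>i < n\<close> specializes_of_rational_function_value unfolding rational_map_value_def by blast
  qed
qed

section \<open>The twisted cover of affine space\<close>

lemma map_poly_hom_prod:
  assumes F: "is_subfield F" and hom: "subfield_hom F \<sigma>"
  shows "(\<And>a. a \<in> A \<Longrightarrow> g a \<in> polys_over F) \<Longrightarrow> map_poly \<sigma> (prod g A) = (\<Prod>a\<in>A. map_poly \<sigma> (g a))"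
proof (induction A rule: infinite_finite_induct)
  case (insert a A)
  have "(\<Prod>a\<in>A'. g a) \<in> polys_over F" if "A' \<subseteq> insert a A" for A'
    using that insert.prems
    by (induction A' rule: infinite_finite_induct) (auto intro!: polys_over_intros[OF F])
  then show ?case using insert by (simp add: map_poly_hom_mult[OF F hom] subset_insertI)
qed (simp_all add: subfield_hom_one[OF F hom])

lemma subfield_hom_const_embed: "subfield_hom UNIV (const_embed :: 'a::field \<Rightarrow> _)"
  by (simp add: subfield_hom_def ce.hom_one ce.hom_add ce.hom_mult)

lemmas coeff_map_const_embed = coeff_map_poly_hom[OF is_subfield_UNIV subfield_hom_const_embed]

lemma poly_map_const_embed: "poly (map_poly const_embed q) (const_embed x) = const_embed (poly q x)"
  by (rule subfield_hom_poly[OF is_subfield_UNIV subfield_hom_const_embed, symmetric]) (auto intro: polys_overI)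

lemma degree_map_const_embed: "Polynomial.degree (map_poly const_embed q) = Polynomial.degree q"
  by (rule degree_map_poly_hom[OF is_subfield_UNIV subfield_hom_const_embed]) (auto intro: polys_overI)

lemma pderiv_map_const_embed: "pderiv (map_poly const_embed q) = map_poly const_embed (pderiv q)"
proof -
  have of_nat: "const_embed (of_nat l) = of_nat l" for l :: nat
    by (induction l) (simp_all add: ce.hom_zero ce.hom_one ce.hom_add)
  show ?thesis
    by (intro poly_eqI) (simp only: coeff_pderiv coeff_map_const_embed ce.hom_mult of_nat)
qed

lemma poly_mod_root:
  fixes q r :: "'a::field poly"
  assumes "poly r x = 0"
  shows "poly (q mod r) x = poly q x"
proof -
  have "poly q x = poly (q div r) x * poly r x + poly (q mod r) x"
    by (metis div_mult_mod_eq poly_add poly_mult)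
  then show ?thesis using assms by simp
qed

lemma pderiv_sum: "pderiv (sum g A) = (\<Sum>a\<in>A. pderiv (g a))"
  by (induction A rule: infinite_finite_induct) (simp_all add: pderiv_add)

lemma poly_pderiv_prod_linear_eq_0_iff:
  fixes g :: "'b \<Rightarrow> 'a::field"
  assumes S: "finite S" and a: "a \<in> S"
  shows "poly (pderiv (\<Prod>u\<in>S. [:- g u, 1:])) (g a) = 0 \<longleftrightarrow> (\<exists>u\<in>S. u \<noteq> a \<and> g u = g a)"
proof -
  have "(\<Prod>u\<in>S. [:- g u, 1:]) = [:- g a, 1:] * (\<Prod>u\<in>S - {a}. [:- g u, 1:])"
    by (rule prod.remove[OF S a])
  then have "poly (pderiv (\<Prod>u\<in>S. [:- g u, 1:])) (g a) = (\<Prod>u\<in>S - {a}. g a - g u)"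
    by (simp add: pderiv_mult pderiv_pCons poly_prod del: mult_pCons_left)
  moreover have "(\<Prod>u\<in>S - {a}. g a - g u) = 0 \<longleftrightarrow> (\<exists>u\<in>S - {a}. g a - g u = 0)"
    by (rule prod_zero_iff) (use S in simp)
  moreover have "(\<exists>u\<in>S - {a}. g a - g u = 0) \<longleftrightarrow> (\<exists>u\<in>S. u \<noteq> a \<and> g u = g a)"
    by (metis Diff_iff right_minus_eq singletonD singletonI)
  ultimately show ?thesis by simp
qed

text \<open>The roots of \<open>f\<close> are the conjugates of \<alpha>, those of \<open>p\<close>
  the conjugates of \<theta>. The bound \<open>m \<ge> 2\<close> makes room for a linear coefficient
  in \<open>W\<close> and in the polynomial in \<open>Z\<close>, and \<open>d \<ge> 2\<close> for a
  second root of \<open>p\<close>.\<close>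

locale twisted_cover =
  fixes K0 K :: "'a::alg_closed_field set" and f p :: "'a poly" and \<theta> :: 'a and m d :: nat
  assumes K0: "is_subfield K0" and K: "is_subfield K" and K0_K: "K0 \<subseteq> K"
    and f: "f \<in> polys_over K0" "lead_coeff f = 1" "rsquarefree f" "Polynomial.degree f = m" "m \<ge> 2"
    and p: "p \<in> polys_over K0" "lead_coeff p = 1" "rsquarefree p" "Polynomial.degree p = d" "d \<ge> 2"
    and \<theta>: "\<theta> \<in> K" "poly p \<theta> = 0"
begin

definition "S = {a. poly f a = 0}"
definition "T = {t. poly p t = 0} - {\<theta>}"
definition "p1 = p div [:- \<theta>, 1:]"
definition "n = m * d + 1"

abbreviation c :: "'a \<Rightarrow> 'a universal_domain" where "c \<equiv> const_embed"
abbreviation \<xi> :: "nat \<Rightarrow> 'a universal_domain" where "\<xi> \<equiv> generic_coord"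

definition "P1 = map_poly c p1"

text \<open>The coordinates of the affine space form an \<open>m \<times> d\<close> array, with entry \<open>(k, i)\<close> at index
  \<open>k * d + i\<close>, followed by one further coordinate at index \<open>m * d\<close>.\<close>

definition "W = (\<Sum>k<m. Polynomial.monom (\<xi> (k * d)) k)"
text \<open>For \<open>k \<ge> 1\<close> this is the residue modulo \<open>P1\<close> prescribed for
  the coefficient of \<open>Z ^ k\<close>. \<open>B 0\<close> is instead the root \<open>y\<close>,
  because the constant coefficient is solved for.\<close>

definition "B k = (\<Sum>i<d - 1. Polynomial.monom (\<xi> (k * d + Suc i)) i)"
definition "H = (\<Prod>a\<in>S. [:- poly W (c a), 1:])"
text \<open>Up to sign the discriminant of \<open>H\<close>, since each factor is the product of the
  differences of one root with the others.\<close>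

definition "D = (\<Prod>a\<in>S. poly (pderiv H) (poly W (c a)))"
text \<open>At \<open>k = 0\<close> this is the constant coefficient that turns \<open>B 0\<close>
  into a root modulo \<open>P1\<close>.\<close>

definition "R k = (if k = 0 then - (B 0 ^ m + (\<Sum>k\<in>{1..<m}. B k * B 0 ^ k)) mod P1 else B k)"

text \<open>\<open>A k\<close> is the polynomial of degree less than \<open>d\<close> congruent to \<open>R k\<close> modulo \<open>p1\<close> whose value
  at \<open>\<theta>\<close> is the \<open>k\<close>-th coefficient of \<open>H\<close>.\<close>

definition "A k = R k + Polynomial.smult ((Polynomial.coeff H k - poly (R k) (c \<theta>)) / poly P1 (c \<theta>)) P1"

text \<open>The summand \<open>1 / D\<close> makes \<open>D\<close> nonzero wherever \<open>\<nu>\<close> is defined.\<close>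

definition "\<nu> j = (if j < m * d then Polynomial.coeff (A (j div d)) (j mod d) else \<xi> (m * d) + 1 / D)"

text \<open>The polynomial \<open>F\<close> of the overview over the function field, with its first
  argument set to \<open>t\<close>.\<close>

definition "G t = Polynomial.monom 1 m + (\<Sum>k<m. Polynomial.monom (poly (A k) t) k)"

definition "L = adjoin (c ` K) (\<xi> ` {..<n})"

section \<open>Degrees, values and indices in the construction\<close>

lemma f_nz: "f \<noteq> 0" and p_nz: "p \<noteq> 0"
  using f(2) p(2) by auto

lemma finite_S: "finite S"
  unfolding S_def by (rule poly_roots_finite[OF f_nz])

lemma card_S: "card S = m"
  using rsquarefree_monic_card_roots[OF f(3,2)] f(4) by (simp add: S_def)

lemma f_eq: "f = (\<Prod>a\<in>S. [:- a, 1:])"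
  unfolding S_def by (rule rsquarefree_monic_factorization[OF f(3,2)])

lemma finite_T: "finite T" and card_T: "card T = d - 1"
proof -
  have fin: "finite {t. poly p t = 0}" by (rule poly_roots_finite[OF p_nz])
  then show "finite T" by (simp add: T_def)
  show "card T = d - 1"
    using rsquarefree_monic_card_roots[OF p(3,2)] p(4) \<theta>(2) fin by (simp add: T_def)
qed

lemma p_eq: "p = [:- \<theta>, 1:] * p1"
proof -
  have "[:- \<theta>, 1:] dvd p" using \<theta>(2) by (simp add: poly_eq_0_iff_dvd)
  then show ?thesis unfolding p1_def by (rule dvd_mult_div_cancel[symmetric])
qed

lemma p1_nz: "p1 \<noteq> 0"
  using p_eq p_nz by auto

lemma degree_p1: "Polynomial.degree p1 = d - 1"
proof -
  have "Polynomial.degree p = Suc (Polynomial.degree p1)"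
    by (subst p_eq, subst degree_mult_eq) (use p1_nz in auto)
  then show ?thesis using p(4) by simp
qed

lemma p1_theta: "poly p1 \<theta> \<noteq> 0"
proof -
  have "poly (pderiv p) \<theta> = poly p1 \<theta>"
    by (subst p_eq) (simp add: pderiv_mult pderiv_pCons del: mult_pCons_left)
  then show ?thesis using p(3) \<theta>(2) rsquarefree_iff_pderiv[OF p_nz] by metis
qed

lemma p1_T: "t \<in> T \<Longrightarrow> poly p1 t = 0"
  using arg_cong[OF p_eq, of "\<lambda>q. poly q t"] by (auto simp: T_def)

lemma p1_K: "p1 \<in> polys_over K"
  unfolding p1_def
  by (intro polys_over_div[OF K] polys_over_mono[OF K0_K p(1)] polys_over_linear[OF K]
      subfield_uminus[OF K] subfield_one[OF K] \<theta>)

lemma P1_T: "t \<in> T \<Longrightarrow> poly P1 (c t) = 0"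
  by (simp add: P1_def poly_map_const_embed p1_T ce.hom_zero)

lemma P1_theta: "poly P1 (c \<theta>) \<noteq> 0"
  using p1_theta ce.hom_inj by (auto simp: P1_def poly_map_const_embed)

lemma degree_P1: "Polynomial.degree P1 = d - 1"
  by (simp add: P1_def degree_map_const_embed degree_p1)

lemma P1_nz: "P1 \<noteq> 0"
  using P1_theta by auto

lemma P1_over: "P1 \<in> polys_over (c ` K)"
  using p1_K by (auto simp: P1_def polys_over_def coeff_map_const_embed)

lemma f_over: "(\<Prod>a\<in>c ` S. [:- a, 1:]) \<in> polys_over (c ` K)"
proof -
  have "map_poly c f = (\<Prod>a\<in>S. map_poly c [:- a, 1:])"
    by (subst f_eq, rule map_poly_hom_prod[OF is_subfield_UNIV subfield_hom_const_embed]) (auto intro: polys_overI)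
  also have "\<dots> = (\<Prod>a\<in>S. [:- c a, 1:])"
    by (simp add: map_poly_pCons ce.hom_zero ce.hom_one ce.hom_uminus)
  also have "\<dots> = (\<Prod>a\<in>c ` S. [:- a, 1:])"
    by (subst prod.reindex) (auto simp: inj_on_def ce.hom_eq_iff)
  finally have "(\<Prod>a\<in>c ` S. [:- a, 1:]) = map_poly c f" ..
  moreover have "Polynomial.coeff f i \<in> K" for i using polys_over_coeff[OF f(1)] K0_K by blast
  ultimately show ?thesis by (auto simp: polys_over_def coeff_map_const_embed)
qed

lemma coeff_W: "Polynomial.coeff W k = (if k < m then \<xi> (k * d) else 0)"
  by (simp add: W_def coeff_sum coeff_monom)

lemma coeff_B: "Polynomial.coeff (B k) i = (if i < d - 1 then \<xi> (k * d + Suc i) else 0)"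
  by (simp add: B_def coeff_sum coeff_monom)

lemma degree_W: "Polynomial.degree W < m"
  by (rule degree_lessI) (use f(5) in \<open>auto simp: coeff_W\<close>)

lemma degree_B: "Polynomial.degree (B k) < d - 1"
  by (rule degree_lessI) (use p(5) in \<open>auto simp: coeff_B\<close>)

lemma degree_R: "Polynomial.degree (R k) < d - 1"
proof -
  have "Polynomial.degree (q mod P1) < d - 1" for q
    using degree_mod_less[OF P1_nz, of q] p(5) by (auto simp: degree_P1)
  then show ?thesis using degree_B by (simp add: R_def)
qed

lemma poly_A_theta: "poly (A k) (c \<theta>) = Polynomial.coeff H k"
  using P1_theta by (simp add: A_def)

lemma poly_A_T: "t \<in> T \<Longrightarrow> poly (A k) (c t) = poly (R k) (c t)"
  by (simp add: A_def P1_T)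

lemma A_mod_P1: "A k mod P1 = R k"
proof -
  have "A k mod P1 = R k mod P1" by (simp add: A_def poly_mod_add_left mod_smult_left)
  also have "\<dots> = R k" by (rule mod_poly_less) (simp only: degree_R degree_P1)
  finally show ?thesis .
qed

lemma degree_A: "Polynomial.degree (A k) < d"
proof -
  have "Polynomial.degree (A k) \<le> d - 1"
    unfolding A_def by (intro degree_add_le) (use degree_R[of k] degree_P1 degree_smult_le in \<open>auto intro: order_trans\<close>)
  then show ?thesis using p(5) by simp
qed

lemma degree_H: "Polynomial.degree H = m"
  unfolding H_def using degree_prod_linear[OF finite_S] card_S by simp

lemma lead_coeff_H: "Polynomial.coeff H m = 1"
proof -
  have "lead_coeff H = 1" unfolding H_def by (subst lead_coeff_prod) simp
  then show ?thesis by (simp add: degree_H)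
qed

lemma index_less: "k < m \<Longrightarrow> i < d \<Longrightarrow> k * d + i < m * d"
proof -
  assume "k < m" "i < d"
  then have "k * d + i < Suc k * d" by simp
  also have "\<dots> \<le> m * d" by (rule mult_le_mono1) (use \<open>k < m\<close> in simp)
  finally show ?thesis .
qed

lemma index_less_n: "k < m \<Longrightarrow> i < d \<Longrightarrow> k * d + i < n"
  using index_less[of k i] by (simp add: n_def)

lemma index_0_less_n: "k < m \<Longrightarrow> k * d < n"
  using index_less_n[of k 0] p(5) by simp

lemma index_cases:
  assumes "j < n"
  obtains "j = m * d" | k i where "j = k * d + i" "k < m" "i < d"
proof (cases "j = m * d")
  case False
  then have j: "j < m * d" using assms by (simp add: n_def)
  have "j div d < m" using j by (simp add: less_mult_imp_div_less)
  moreover have "j mod d < d" using p(5) by simp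
  moreover have "j = j div d * d + j mod d" by simp
  ultimately show ?thesis using that(2) by blast
qed (use that(1) in blast)

lemma nu_index: "k < m \<Longrightarrow> i < d \<Longrightarrow> \<nu> (k * d + i) = Polynomial.coeff (A k) i"
  using index_less by (simp add: \<nu>_def)

lemma nu_last: "\<nu> (m * d) = \<xi> (m * d) + 1 / D"
  by (simp add: \<nu>_def)

section \<open>Rationality of the map over \<open>K\<close>\<close>

lemma L: "is_subfield L"
  unfolding L_def by (rule is_subfield_adjoin)

lemma c_in_L: "a \<in> K \<Longrightarrow> c a \<in> L"
  unfolding L_def by (intro adjoin_base imageI)

lemma coord_in_L: "j < n \<Longrightarrow> \<xi> j \<in> L"
  unfolding L_def by (intro adjoin_gen imageI) simp

lemma polys_over_L: "q \<in> polys_over (c ` K) \<Longrightarrow> q \<in> polys_over L"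
  by (rule polys_over_mono) (use c_in_L in auto)

lemma W_over_L: "W \<in> polys_over L"
  unfolding W_def
  by (intro polys_over_sum[OF L] polys_over_monom[OF L] coord_in_L)
    (use index_0_less_n in auto)

lemma B_over_L: "k < m \<Longrightarrow> B k \<in> polys_over L"
  unfolding B_def
  by (intro polys_over_sum[OF L] polys_over_monom[OF L] coord_in_L)
    (use index_less_n[of k "Suc _"] in auto)

text \<open>Provides interpolation nodes in any number, from the powers of a transcendental
  coordinate.\<close>

lemma infinite_L: "infinite L"
proof
  assume "finite L"
  have x: "\<xi> 0 \<in> L" by (rule coord_in_L) (simp add: n_def)
  have "range (\<lambda>i::nat. \<xi> 0 ^ i) \<subseteq> L" using subfield_power[OF L x] by blast
  then have "finite (range (\<lambda>i::nat. \<xi> 0 ^ i))" using \<open>finite L\<close> finite_subset by blast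
  then have "\<not> inj (\<lambda>i::nat. \<xi> 0 ^ i)" using finite_imageD by auto
  then obtain i j :: nat where ij: "\<xi> 0 ^ i = \<xi> 0 ^ j" "i \<noteq> j" by (auto simp: inj_def)
  let ?q = "Polynomial.monom 1 i - Polynomial.monom 1 j :: 'a universal_domain poly"
  have "Polynomial.coeff ?q i = 1" using ij(2) by (simp add: coeff_monom)
  then have "?q \<noteq> 0" by (metis coeff_0 zero_neq_one)
  moreover have "poly ?q (\<xi> 0) = 0" using ij by (simp add: poly_monom)
  moreover have "?q \<in> polys_over (adjoin (range c) {})"
    by (intro polys_over_diff[OF is_subfield_adjoin] polys_over_monom[OF is_subfield_adjoin] subfield_one[OF is_subfield_adjoin])
  ultimately have "\<xi> 0 \<in> acl (range c) (\<xi> ` {})"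
    unfolding acl_def algebraic_over_def image_empty by blast
  then show False using generic_coord_not_acl[where ?'a = 'a and J = "{}" and i = 0] by simp
qed

text \<open>At \<open>z\<close> in \<open>L\<close> the value of \<open>H\<close> is the product of
  the values of \<open>z - W\<close> over the conjugates of \<alpha>, which lies in \<open>L\<close>
  because these are the roots of a polynomial over \<open>L\<close>. Interpolation transfers this to
  the coefficients.\<close>

lemma H_over_L: "H \<in> polys_over L"
proof -
  obtain X' where X': "X' \<subseteq> L" "finite X'" "card X' = Suc m"
    using infinite_arbitrarily_large[OF infinite_L] by metis
  show ?thesis
  proof (rule polys_over_interpolation[OF L X'(2,1)])
    show "Polynomial.degree H < card X'" by (simp add: degree_H X')
    fix z assume "z \<in> X'"
    then have z: "z \<in> L" using X' by blast
    have "poly H z = (\<Prod>a\<in>S. z - poly W (c a))" by (simp add: H_def poly_prod)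
    also have "\<dots> = (\<Prod>a\<in>c ` S. poly ([:z:] - W) a)"
      by (subst prod.reindex) (auto simp: inj_on_def ce.hom_eq_iff)
    also have "\<dots> \<in> L"
      by (intro prod_poly_roots_in_subfield[OF L polys_over_L[OF f_over]] polys_over_diff[OF L]
          polys_over_const[OF L] z W_over_L)
    finally show "poly H z \<in> L" .
  qed
qed

lemma D_in_L: "D \<in> L"
proof -
  have "D = (\<Prod>a\<in>c ` S. poly (pcompose (pderiv H) W) a)"
    unfolding D_def by (subst prod.reindex) (auto simp: inj_on_def ce.hom_eq_iff poly_pcompose)
  also have "\<dots> \<in> L"
    by (intro prod_poly_roots_in_subfield[OF L polys_over_L[OF f_over]] polys_over_pcompose[OF L]
        polys_over_pderiv[OF L] H_over_L W_over_L)
  finally show ?thesis .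
qed

lemma R_over_L:
  assumes "k < m"
  shows "R k \<in> polys_over L"
proof (cases "k = 0")
  case True
  have "- (B 0 ^ m + (\<Sum>k\<in>{1..<m}. B k * B 0 ^ k)) mod P1 \<in> polys_over L"
    using f(5) by (intro polys_over_mod[OF L] polys_over_uminus[OF L] polys_over_add[OF L] polys_over_sum[OF L]
      polys_over_mult[OF L] polys_over_power[OF L] B_over_L polys_over_L[OF P1_over]) auto
  then show ?thesis unfolding R_def using True by (simp only: if_True simp_thms)
qed (use B_over_L[OF assms] in \<open>simp add: R_def\<close>)

lemma A_over_L: "k < m \<Longrightarrow> A k \<in> polys_over L"
  unfolding A_def
  by (intro polys_over_add[OF L] polys_over_smult[OF L] subfield_divide[OF L] subfield_diff[OF L]
      poly_in_subfield[OF L] polys_over_coeff[OF H_over_L] R_over_L polys_over_L[OF P1_over] c_in_L \<theta>)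

lemma nu_in_L:
  assumes "j < n"
  shows "\<nu> j \<in> L"
  using assms
proof (cases rule: index_cases)
  case 1
  then show ?thesis
    using coord_in_L[OF assms] D_in_L
    by (simp add: nu_last subfield_add[OF L] subfield_divide[OF L] subfield_one[OF L])
next
  case (2 k i)
  then show ?thesis by (simp add: nu_index polys_over_coeff[OF A_over_L])
qed

text \<open>The test for nonvanishing of generic expressions: they are arranged to be linear in one
  coordinate, with a nonzero constant as its coefficient and a remaining part that avoids
  it.\<close>

lemma coord_linear_independent:
  assumes j: "j < n" and u: "u \<in> adjoin (range c) (\<xi> ` ({..<n} - {j}))" and v: "v \<noteq> 0" "v \<in> range c"
  shows "\<xi> j * v + u \<noteq> 0"
proof
  let ?E = "adjoin (range c) (\<xi> ` ({..<n} - {j}))"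
  assume "\<xi> j * v + u = 0"
  then have "\<xi> j * v = - u" by (simp add: eq_neg_iff_add_eq_0)
  then have "\<xi> j = - u / v" using v(1) by (metis nonzero_eq_divide_eq)
  also have "\<dots> \<in> ?E"
    by (intro subfield_divide[OF is_subfield_adjoin] subfield_uminus[OF is_subfield_adjoin] u adjoin_base v)
  finally have "\<xi> j \<in> acl (range c) (\<xi> ` ({..<n} - {j}))" using adjoin_subset_acl by blast
  then show False using generic_coord_not_acl[where ?'a = 'a and J = "{..<n} - {j}" and i = j] by simp
qed

text \<open>The coordinate \<open>\<xi> d\<close>, at position \<open>(1, 0)\<close>, is the linear
  coefficient of \<open>W\<close>; in the difference of two values it is multiplied by the nonzero
  constant \<open>c a - c a'\<close>.\<close>

lemma W_inj: "inj_on (\<lambda>a. poly W (c a)) S"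
proof (rule inj_onI, rule ccontr)
  fix a a' assume eq: "poly W (c a) = poly W (c a')" and neq: "a \<noteq> a'"
  let ?E = "adjoin (range c) (\<xi> ` ({..<n} - {d}))"
  define u where "u = (\<Sum>k\<in>{..<m} - {1}. \<xi> (k * d) * (c a ^ k - c a' ^ k))"
  have "poly W (c a) - poly W (c a') = (\<Sum>k<m. \<xi> (k * d) * (c a ^ k - c a' ^ k))"
    by (simp add: W_def poly_sum poly_monom sum_subtractf right_diff_distrib)
  also have "\<dots> = \<xi> d * (c a - c a') + u"
    unfolding u_def using f(5) by (subst sum.remove[of _ 1]) auto
  finally have "\<xi> d * (c a - c a') + u = 0" using eq by simp
  moreover have "u \<in> ?E"
    unfolding u_def
  proof (rule subfield_sum[OF is_subfield_adjoin], rule subfield_mult[OF is_subfield_adjoin])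
    fix k assume k: "k \<in> {..<m} - {1}"
    show "c a ^ k - c a' ^ k \<in> ?E"
      by (intro subfield_diff[OF is_subfield_adjoin] subfield_power[OF is_subfield_adjoin] adjoin_base rangeI)
    have "k * d < n" by (rule index_0_less_n) (use k in simp)
    moreover have "k * d \<noteq> d" using k p(5) by simp
    ultimately show "\<xi> (k * d) \<in> ?E" by (intro adjoin_gen imageI) simp
  qed
  moreover have "d < n" using index_0_less_n[of 1] f(5) by simp
  moreover have "c a - c a' \<noteq> 0" using neq by (simp add: ce.hom_eq_iff)
  moreover have "c a - c a' \<in> range c"
    using subfield_diff[OF ce.is_subfield_image[OF is_subfield_UNIV]] by blast
  ultimately show False using coord_linear_independent by blast
qed

lemma H_simple_roots: "a \<in> S \<Longrightarrow> poly (pderiv H) (poly W (c a)) \<noteq> 0"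
  unfolding H_def using poly_pderiv_prod_linear_eq_0_iff[OF finite_S, of a "\<lambda>a. poly W (c a)"] W_inj
  by (auto simp: inj_on_def)

lemma D_nz: "D \<noteq> 0"
  using H_simple_roots finite_S by (simp add: D_def)

lemma G_root:
  assumes t: "t \<in> T"
  shows "poly (G (c t)) (poly (B 0) (c t)) = 0"
proof -
  let ?y = "poly (B 0) (c t)"
  let ?r = "B 0 ^ m + (\<Sum>k\<in>{1..<m}. B k * B 0 ^ k)"
  have "poly (- ?r mod P1) (c t) = poly (- ?r) (c t)"
    by (rule poly_mod_root[OF P1_T[OF t]])
  then have R0: "poly (R 0) (c t) = - (?y ^ m + (\<Sum>k\<in>{1..<m}. poly (B k) (c t) * ?y ^ k))"
    by (simp add: R_def poly_sum)
  have "{..<m} = insert 0 {1..<m}" using f(5) by auto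
  then have "poly (G (c t)) ?y = ?y ^ m + (poly (R 0) (c t) + (\<Sum>k\<in>{1..<m}. poly (B k) (c t) * ?y ^ k))"
    by (simp add: G_def poly_sum poly_monom poly_A_T[OF t] R_def)
  then show ?thesis by (simp add: R0)
qed

text \<open>The derivative at the value of \<open>B 0\<close> contains the value of
  \<open>B 1\<close> with factor one, and the constant term of \<open>B 1\<close> is the coordinate
  \<open>\<xi> (d + 1)\<close>, which occurs nowhere else; so it cannot vanish, even if the
  characteristic divides \<open>m\<close>.\<close>

lemma G_simple_root:
  assumes t: "t \<in> T"
  shows "poly (pderiv (G (c t))) (poly (B 0) (c t)) \<noteq> 0"
proof -
  let ?y = "poly (B 0) (c t)"
  let ?E = "adjoin (range c) (\<xi> ` ({..<n} - {d + 1}))"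
  note E = is_subfield_adjoin
  define u1 where "u1 = (\<Sum>i\<in>{..<d - 1} - {0}. \<xi> (d + Suc i) * c t ^ i)"
  define u where "u = of_nat m * ?y ^ (m - 1) + (\<Sum>k\<in>{..<m} - {0, 1}. of_nat k * poly (B k) (c t) * ?y ^ (k - 1)) + u1"
  have "poly (pderiv (G (c t))) ?y
      = of_nat m * ?y ^ (m - 1) + (\<Sum>k<m. of_nat k * poly (R k) (c t) * ?y ^ (k - 1))"
    by (simp add: G_def pderiv_add pderiv_sum pderiv_monom poly_sum poly_monom poly_A_T[OF t])
  also have "(\<Sum>k<m. of_nat k * poly (R k) (c t) * ?y ^ (k - 1))
      = (\<Sum>k\<in>{..<m} - {0}. of_nat k * poly (R k) (c t) * ?y ^ (k - 1))"
    by (rule sum.mono_neutral_right) auto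
  also have "\<dots> = poly (B 1) (c t) + (\<Sum>k\<in>{..<m} - {0, 1}. of_nat k * poly (R k) (c t) * ?y ^ (k - 1))"
    using f(5) by (subst sum.remove[of _ 1]) (auto simp: R_def Diff_insert2[symmetric] insert_commute)
  also have "(\<Sum>k\<in>{..<m} - {0, 1}. of_nat k * poly (R k) (c t) * ?y ^ (k - 1))
      = (\<Sum>k\<in>{..<m} - {0, 1}. of_nat k * poly (B k) (c t) * ?y ^ (k - 1))"
    by (rule sum.cong) (auto simp: R_def)
  also have "poly (B 1) (c t) = \<xi> (d + 1) + u1"
    unfolding u1_def B_def poly_sum using p(5)
    by (subst sum.remove[of _ 0]) (auto simp: poly_monom)
  finally have eq: "poly (pderiv (G (c t))) ?y = \<xi> (d + 1) * 1 + u" by (simp add: u_def)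
  have gen: "\<xi> j \<in> ?E" if "j < n" "j \<noteq> d + 1" for j by (rule adjoin_gen) (use that in auto)
  have Bk: "poly (B k) (c t) \<in> ?E" if "k < m" "k \<noteq> 1" for k
    unfolding B_def poly_sum poly_monom
  proof (rule subfield_sum[OF E], rule subfield_mult[OF E])
    fix i assume i: "i \<in> {..<d - 1}"
    show "c t ^ i \<in> ?E" by (intro subfield_power[OF E] adjoin_base rangeI)
    have "k * d + Suc i < n" using index_less_n[OF that(1), of "Suc i"] i by simp
    moreover have "k * d + Suc i \<noteq> d + 1"
    proof
      assume eq: "k * d + Suc i = d + 1"
      show False
      proof (cases "k = 0")
        case False
        then have "2 \<le> k" using that(2) by simp
        then have "2 * d \<le> k * d" by (rule mult_le_mono1)
        then show False using eq p(5) by linarith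
      qed (use eq i in simp)
    qed
    ultimately show "\<xi> (k * d + Suc i) \<in> ?E" by (rule gen)
  qed
  have "u1 \<in> ?E" unfolding u1_def
  proof (rule subfield_sum[OF E], rule subfield_mult[OF E])
    fix i assume i: "i \<in> {..<d - 1} - {0}"
    show "c t ^ i \<in> ?E" by (intro subfield_power[OF E] adjoin_base rangeI)
    show "\<xi> (d + Suc i) \<in> ?E" by (rule gen) (use index_less_n[of 1 "Suc i"] f(5) i in auto)
  qed
  moreover have "?y \<in> ?E" using Bk[of 0] f(5) by simp
  ultimately have "u \<in> ?E" unfolding u_def
    by (intro subfield_add[OF E] subfield_sum[OF E] subfield_mult[OF E] subfield_power[OF E]
        subfield_of_nat[OF E] Bk) (use f(5) in auto)
  moreover have "d + 1 < n" using index_less_n[of 1 1] f(5) p(5) by simp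
  moreover have "1 \<in> range c" using ce.hom_one by (metis rangeI)
  ultimately show ?thesis unfolding eq using coord_linear_independent[of "d + 1" u 1] by simp
qed

section \<open>Separability of the function field over the field \<open>M\<close> generated by the
  map\<close>

definition "M = adjoin (c ` K) (\<nu> ` {..<n})"

lemma M: "is_subfield M"
  unfolding M_def by (rule is_subfield_adjoin)

lemma nu_in_M: "j < n \<Longrightarrow> \<nu> j \<in> M"
  unfolding M_def by (intro adjoin_gen imageI) simp

lemma c_in_M: "a \<in> K \<Longrightarrow> c a \<in> M"
  unfolding M_def by (intro adjoin_base imageI)

lemma polys_over_M: "q \<in> polys_over (c ` K) \<Longrightarrow> q \<in> polys_over M"
  by (rule polys_over_mono) (use c_in_M in auto)

lemma A_over_M:
  assumes "k < m"
  shows "A k \<in> polys_over M"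
proof (rule polys_overI)
  fix i
  show "Polynomial.coeff (A k) i \<in> M"
  proof (cases "i < d")
    case True
    then have "Polynomial.coeff (A k) i = \<nu> (k * d + i)" using assms by (simp add: nu_index)
    moreover have "k * d + i < n" by (rule index_less_n[OF assms True])
    ultimately show ?thesis using nu_in_M by simp
  next
    case False
    then have "Polynomial.coeff (A k) i = 0" using degree_A[of k] by (intro coeff_eq_0) simp
    then show ?thesis using subfield_zero[OF M] by simp
  qed
qed

lemma H_over_M: "H \<in> polys_over M"
proof (rule polys_overI)
  fix k
  consider "k < m" | "k = m" | "k > m" by linarith
  then show "Polynomial.coeff H k \<in> M"
  proof cases
    case 1
    then show ?thesis
      using poly_in_subfield[OF M A_over_M c_in_M[OF \<theta>(1)]] by (simp flip: poly_A_theta)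
  qed (auto simp: lead_coeff_H degree_H coeff_eq_0 subfield_zero[OF M] subfield_one[OF M])
qed

lemma const_root_separable:
  assumes "q \<in> polys_over K0" "rsquarefree q" "q \<noteq> 0" "poly q a = 0"
  shows "c a \<in> separable_closure M"
proof -
  have "map_poly c q \<in> polys_over M"
    using assms(1) K0_K c_in_M by (auto simp: polys_over_def coeff_map_const_embed)
  moreover have "poly (map_poly c q) (c a) = 0" using assms(4) by (simp add: poly_map_const_embed ce.hom_zero)
  moreover have "poly (pderiv (map_poly c q)) (c a) \<noteq> 0"
    using assms rsquarefree_iff_pderiv[OF assms(3)] ce.hom_inj
    by (auto simp: pderiv_map_const_embed poly_map_const_embed)
  ultimately show ?thesis
    unfolding separable_closure_def using separable_over_iff_simple_root[OF M] by blast
qed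

text \<open>The construction is undone by simple roots. Evaluating \<open>A k\<close> at \<theta>
  gives \<open>H\<close>, whose simple roots are the values of \<open>W\<close> on the conjugates of
  \<alpha>; reducing modulo \<open>P1\<close> gives \<open>B k\<close> for \<open>k \<ge> 1\<close>;
  and the values of \<open>B 0\<close> on \<open>T\<close> are simple roots of \<open>G\<close>.
  Interpolation recovers \<open>W\<close> and \<open>B 0\<close>, and \<open>D\<close> then gives
  the last coordinate.\<close>

lemma coord_separable:
  assumes "j < n"
  shows "\<xi> j \<in> separable_closure M"
proof -
  let ?E = "separable_closure M"
  have E: "is_subfield ?E" by (rule is_subfield_separable_closure[OF M])
  have ME: "M \<subseteq> ?E" by (rule separable_closure_base[OF M])
  have S: "c a \<in> ?E" if "a \<in> S" for a
    using const_root_separable[OF f(1,3) f_nz] that by (simp add: S_def)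
  have T: "c t \<in> ?E" if "t \<in> T" for t
    using const_root_separable[OF p(1,3) p_nz] that by (simp add: T_def)
  have Wa: "poly W (c a) \<in> ?E" if "a \<in> S" for a
  proof -
    have "poly H (poly W (c a)) = 0" using that finite_S by (auto simp: H_def poly_prod prod_zero_iff)
    then show ?thesis unfolding separable_closure_def
      using separable_over_iff_simple_root[OF M] H_over_M H_simple_roots[OF that] by blast
  qed
  have WE: "W \<in> polys_over ?E"
  proof (rule polys_over_interpolation[OF E])
    show "finite (c ` S)" using finite_S by simp
    show "c ` S \<subseteq> ?E" using S by blast
    show "Polynomial.degree W < card (c ` S)"
      using degree_W card_S by (subst card_image) (auto simp: inj_on_def ce.hom_eq_iff)
    show "poly W x \<in> ?E" if "x \<in> c ` S" for x using that Wa by auto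
  qed
  have DE: "D \<in> ?E"
    unfolding D_def
    by (intro subfield_prod[OF E] poly_in_subfield[OF E] polys_over_pderiv[OF E] polys_over_mono[OF ME H_over_M] Wa)
  have RM: "R k \<in> polys_over M" if "k < m" for k
    using polys_over_mod[OF M A_over_M[OF that] polys_over_M[OF P1_over]] by (simp add: A_mod_P1)
  \<comment> \<open>The coefficients of \<open>G (c t)\<close> are only known to lie in the
    separable closure of \<open>M\<close>, since \<open>c t\<close> need not be in \<open>M\<close>;
    transitivity of separability closes the gap.\<close>
  have Ya: "poly (B 0) (c t) \<in> ?E" if t: "t \<in> T" for t
  proof (rule separable_closure_separable_closed[OF M])
    have "G (c t) \<in> polys_over ?E"
      unfolding G_def using polys_over_mono[OF ME A_over_M] T[OF t]
      by (intro polys_over_add[OF E] polys_over_sum[OF E] polys_over_monom[OF E] subfield_one[OF E] poly_in_subfield[OF E]) auto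
    then show "separable_over ?E (poly (B 0) (c t))"
      using separable_over_iff_simple_root[OF E] G_root[OF t] G_simple_root[OF t] by blast
  qed
  have Y: "B 0 \<in> polys_over ?E"
  proof (rule polys_over_interpolation[OF E])
    show "finite (c ` T)" using finite_T by simp
    show "c ` T \<subseteq> ?E" using T by blast
    show "Polynomial.degree (B 0) < card (c ` T)"
      using degree_B card_T by (subst card_image) (auto simp: inj_on_def ce.hom_eq_iff)
    show "poly (B 0) x \<in> ?E" if "x \<in> c ` T" for x using that Ya by auto
  qed
  have BE: "B k \<in> polys_over ?E" if "k < m" for k
  proof (cases "k = 0")
    case False
    then show ?thesis using polys_over_mono[OF ME RM[OF that]] by (simp add: R_def)
  qed (use Y in simp)
  from assms show ?thesis
  proof (cases rule: index_cases)
    case 1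
    have "\<xi> (m * d) = \<nu> (m * d) - 1 / D" by (simp add: nu_last)
    moreover have "\<nu> (m * d) \<in> ?E" using nu_in_M[OF assms] ME 1 by blast
    ultimately show ?thesis using 1 DE
      by (simp add: subfield_diff[OF E] subfield_divide[OF E] subfield_one[OF E])
  next
    case (2 k i)
    show ?thesis
    proof (cases i)
      case 0
      then show ?thesis using polys_over_coeff[OF WE, of k] 2 by (simp add: coeff_W)
    next
      case (Suc i')
      then have "i' < d - 1" using 2 by simp
      then show ?thesis using polys_over_coeff[OF BE[OF 2(2)], of i'] 2 Suc by (simp add: coeff_B)
    qed
  qed
qed

section \<open>Specialisation of the cover at a rational point\<close>

lemma rational_point_of_cover:
  assumes PAC: "PAC_extension K0 K"
  shows "\<exists>A W Y. (\<forall>k. A k \<in> polys_over K0) \<and> W \<in> polys_over K \<and> Y \<in> polys_over K \<and> inj_on (poly W) S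
    \<and> Polynomial.monom 1 m + (\<Sum>k<m. Polynomial.monom (poly (A k) \<theta>) k) = (\<Prod>a\<in>S. [:- poly W a, 1:])
    \<and> (\<forall>t\<in>T. poly (Polynomial.monom 1 m + (\<Sum>k<m. Polynomial.monom (poly (A k) t) k)) (poly Y t) = 0)"
proof -
  have "n \<ge> 1" by (simp add: n_def)
  obtain b a where ba: "\<And>j. j < n \<Longrightarrow> b j \<in> K" "\<And>j. j < n \<Longrightarrow> a j \<in> K0" "\<And>j. j < n \<Longrightarrow> specializes n b (\<nu> j) (a j)"
    using PAC_extension_affine_space[OF PAC \<open>n \<ge> 1\<close>, of \<nu>] nu_in_L coord_separable
    unfolding L_def M_def by blast
  define w where "w = (\<Sum>k<m. Polynomial.monom (b (k * d)) k)"
  define y where "y = (\<Sum>i<d - 1. Polynomial.monom (b (Suc i)) i)"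
  \<comment> \<open>The default zero keeps every \<open>A' k\<close> over \<open>K0\<close>, as the
    conclusion ranges over all \<open>k\<close>.\<close>
  define A' where "A' k = (if k < m then \<Sum>i<d. Polynomial.monom (a (k * d + i)) i else 0)" for k
  define H' where "H' = (\<Prod>u\<in>S. [:- poly w u, 1:])"
  define g where "g t = Polynomial.monom 1 m + (\<Sum>k<m. Polynomial.monom (poly (A' k) t) k)" for t
  have coord: "specializes n b (\<xi> j) (b j)" if "j < n" for j by (rule specializes_coord[OF that])
  have sW: "specializes_poly n b W w"
    unfolding specializes_poly_def
    using coord index_0_less_n specializes_0 by (auto simp: coeff_W w_def coeff_sum coeff_monom)
  have sY: "specializes_poly n b (B 0) y"
    unfolding specializes_poly_def
    using coord index_less_n[of 0 "Suc _"] f(5) specializes_0 by (auto simp: coeff_B y_def coeff_sum coeff_monom)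
  have sA: "specializes_poly n b (A k) (A' k)" if k: "k < m" for k
    unfolding specializes_poly_def
  proof
    fix i
    show "specializes n b (Polynomial.coeff (A k) i) (Polynomial.coeff (A' k) i)"
    proof (cases "i < d")
      case True
      then show ?thesis using ba(3)[OF index_less_n[OF k True]] k by (simp add: nu_index A'_def coeff_sum coeff_monom)
    next
      case False
      then have "Polynomial.coeff (A k) i = 0" using degree_A[of k] by (intro coeff_eq_0) simp
      then show ?thesis using False k specializes_0 by (simp add: A'_def coeff_sum coeff_monom)
    qed
  qed
  have sWu: "specializes n b (poly W (c u)) (poly w u)" for u
    by (rule specializes_poly_eval[OF sW specializes_const])
  have sH: "specializes_poly n b H H'"
    unfolding H_def H'_def
    by (intro specializes_poly_prod specializes_poly_pCons specializes_uminus sWu specializes_1 specializes_poly_0)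
  have "Polynomial.coeff H' k = poly (A' k) \<theta>" if "k < m" for k
  proof (rule specializes_unique)
    show "specializes n b (Polynomial.coeff H k) (Polynomial.coeff H' k)" using sH by (simp add: specializes_poly_def)
    show "specializes n b (Polynomial.coeff H k) (poly (A' k) \<theta>)"
      unfolding poly_A_theta[symmetric] by (rule specializes_poly_eval[OF sA[OF that] specializes_const])
  qed
  moreover have "Polynomial.degree H' = m" unfolding H'_def using degree_prod_linear[OF finite_S] card_S by simp
  moreover have "lead_coeff H' = 1" unfolding H'_def by (subst lead_coeff_prod) simp
  ultimately have gH: "g \<theta> = H'"
    by (intro poly_eqI) (auto simp: g_def coeff_sum coeff_monom coeff_eq_0)
  define D' where "D' = (\<Prod>u\<in>S. poly (pderiv H') (poly w u))"
  have sD: "specializes n b D D'"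
    unfolding D_def D'_def by (intro specializes_prod specializes_poly_eval specializes_poly_pderiv sH sWu)
  \<comment> \<open>Here the extra coordinate acts: \<open>1 / D\<close> is a difference of two
    functions that have values at \<open>b\<close>, so the value of \<open>D\<close> there is
    invertible and the values of \<open>w\<close> on \<open>S\<close> are distinct.\<close>
  have "1 / D = \<nu> (m * d) - \<xi> (m * d)" by (simp add: nu_last)
  then have "specializes n b (1 / D) (a (m * d) - b (m * d))"
    using ba(3)[of "m * d"] coord[of "m * d"] by (simp add: n_def specializes_diff)
  then have "specializes n b (D * (1 / D)) (D' * (a (m * d) - b (m * d)))"
    by (rule specializes_mult[OF sD])
  then have "D' * (a (m * d) - b (m * d)) = 1"
    using D_nz specializes_unique[OF _ specializes_1] by simp
  then have "D' \<noteq> 0" by auto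
  then have simple: "poly (pderiv H') (poly w u) \<noteq> 0" if "u \<in> S" for u
    using that finite_S by (auto simp: D'_def prod_zero_iff)
  have inj: "inj_on (poly w) S"
    using simple poly_pderiv_prod_linear_eq_0_iff[OF finite_S, of _ "poly w"] unfolding H'_def inj_on_def by metis
  have root: "poly (g t) (poly y t) = 0" if t: "t \<in> T" for t
  proof (rule specializes_unique)
    have "specializes n b (poly (A k) (c t)) (poly (A' k) t)" if "k < m" for k
      by (rule specializes_poly_eval[OF sA[OF that] specializes_const])
    then have "specializes_poly n b (G (c t)) (g t)"
      unfolding specializes_poly_def using specializes_0 specializes_1
      by (auto simp: G_def g_def coeff_sum coeff_monom intro: specializes_add)
    then show "specializes n b (poly (G (c t)) (poly (B 0) (c t))) (poly (g t) (poly y t))"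
      by (intro specializes_poly_eval sY specializes_const)
    show "specializes n b (poly (G (c t)) (poly (B 0) (c t))) 0"
      using G_root[OF t] specializes_0 by simp
  qed
  have "A' k \<in> polys_over K0" for k
    unfolding A'_def using ba(2) index_less_n by (auto intro!: polys_over_0[OF K0] polys_over_sum[OF K0] polys_over_monom[OF K0])
  moreover have "w \<in> polys_over K"
    unfolding w_def using ba(1) index_0_less_n by (intro polys_over_sum[OF K] polys_over_monom[OF K]) auto
  moreover have "y \<in> polys_over K"
    unfolding y_def using ba(1) index_less_n[of 0 "Suc _"] f(5) by (intro polys_over_sum[OF K] polys_over_monom[OF K]) auto
  ultimately show ?thesis using inj gH root unfolding H'_def g_def by blast
qed

end

section \<open>Conjugating a rational point\<close>

text \<open>The minimal polynomial of \<beta> divides both \<open>g\<close> and \<open>h\<close>, so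
  \<beta> is its only root, and separability makes it linear.\<close>

lemma unique_separable_root_in_subfield:
  fixes N :: "'a::alg_closed_field set"
  assumes N: "is_subfield N" and sep: "separable_over N \<beta>"
    and g: "g \<in> polys_over N" "poly g \<beta> = 0" and h: "h \<in> polys_over N" "poly h \<beta> = 0"
    and unique: "\<And>\<gamma>. poly g \<gamma> = 0 \<Longrightarrow> poly h \<gamma> = 0 \<Longrightarrow> \<gamma> = \<beta>"
  shows "\<beta> \<in> N"
proof -
  obtain \<mu> where mu: "is_min_poly N \<beta> \<mu>" "rsquarefree \<mu>" using sep by (auto simp: separable_over_def)
  obtain r s where "g = \<mu> * r" "h = \<mu> * s"
    using min_poly_dvd[OF N mu(1) g] min_poly_dvd[OF N mu(1) h] by metis
  then have "{\<gamma>. poly \<mu> \<gamma> = 0} = {\<beta>}" using unique is_min_polyD(4)[OF mu(1)] by auto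
  then have "Polynomial.degree \<mu> = 1"
    using rsquarefree_monic_card_roots[OF mu(2) is_min_polyD(2)[OF mu(1)]] by simp
  then show ?thesis by (rule min_poly_linear_in_subfield[OF N mu(1)])
qed

lemma min_poly_degree_ge_2:
  assumes "is_subfield F" "is_min_poly F x p" "x \<notin> F"
  shows "Polynomial.degree p \<ge> 2"
proof -
  have "Polynomial.degree p \<noteq> 1" using min_poly_linear_in_subfield[OF assms(1,2)] assms(3) by blast
  then show ?thesis using min_poly_degree_pos[OF assms(1,2)] by simp
qed

lemma separable_in_galois_extension:
  fixes K0 K N :: "'a::alg_closed_field set"
  assumes sepK: "separable_algebraic_extension K0 K" and PAC: "PAC_extension K0 K" and "K0 \<noteq> K"
    and N: "galois_extension K0 N" "K \<subseteq> N" and \<alpha>: "separable_over K0 \<alpha>"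
  shows "\<alpha> \<in> N"
proof (cases "\<alpha> \<in> K0")
  case True
  then show ?thesis
    using N by (auto simp: galois_extension_def separable_algebraic_extension_def field_extension_def)
next
  case False
  have K0: "is_subfield K0" and K: "is_subfield K" and K0_K: "K0 \<subseteq> K"
    using sepK by (auto simp: separable_algebraic_extension_def field_extension_def)
  have sfN: "is_subfield N" using N(1)
    by (auto simp: galois_extension_def separable_algebraic_extension_def field_extension_def)
  have normal: "y \<in> N" if "x \<in> N" "is_min_poly K0 x q" "poly q y = 0" for x q y
    using N(1) that unfolding galois_extension_def normal_extension_def by blast
  obtain \<theta> where \<theta>: "\<theta> \<in> K" "\<theta> \<notin> K0" using K0_K \<open>K0 \<noteq> K\<close> by blast
  then obtain p where p: "is_min_poly K0 \<theta> p" "rsquarefree p"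
    using sepK unfolding separable_algebraic_extension_def separable_over_def by blast
  obtain f where f: "is_min_poly K0 \<alpha> f" "rsquarefree f" using \<alpha> by (auto simp: separable_over_def)
  define m d where "m = Polynomial.degree f" and "d = Polynomial.degree p"
  interpret tc: twisted_cover K0 K f p \<theta> m d
    using K0 K K0_K is_min_polyD[OF p(1)] is_min_polyD[OF f(1)] p(2) f(2) \<theta>(1)
      min_poly_degree_ge_2[OF K0 p(1) \<theta>(2)] min_poly_degree_ge_2[OF K0 f(1) False]
    by (intro twisted_cover.intro) (simp_all add: m_def d_def)
  obtain A W Y where A: "\<And>k. A k \<in> polys_over K0" and W: "W \<in> polys_over K" and Y: "Y \<in> polys_over K"
    and inj: "inj_on (poly W) tc.S"
    and gW: "Polynomial.monom 1 m + (\<Sum>k<m. Polynomial.monom (poly (A k) \<theta>) k) = (\<Prod>a\<in>tc.S. [:- poly W a, 1:])"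
    and gY: "\<And>t. t \<in> tc.T \<Longrightarrow> poly (Polynomial.monom 1 m + (\<Sum>k<m. Polynomial.monom (poly (A k) t) k)) (poly Y t) = 0"
    using tc.rational_point_of_cover[OF PAC] by blast
  define g where "g t = Polynomial.monom 1 m + (\<Sum>k<m. Polynomial.monom (poly (A k) t) k)" for t
  \<comment> \<open>A conjugate different from \<theta> exists because \<theta> is separable over
    \<open>K0\<close> and lies outside it.\<close>
  have "tc.T \<noteq> {}" using tc.card_T p(1) min_poly_degree_ge_2[OF K0 p(1) \<theta>(2)] unfolding d_def by auto
  then obtain t where t: "t \<in> tc.T" by blast
  then have pt: "poly p t = 0" "t \<noteq> \<theta>" by (auto simp: tc.T_def)

  have id: "subfield_hom K0 (\<lambda>x. x)" by (simp add: subfield_hom_def)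
  obtain \<sigma> where \<sigma>: "subfield_hom (adjoin K0 {\<theta>}) \<sigma>" "\<And>u. u \<in> K0 \<Longrightarrow> \<sigma> u = u" "\<sigma> \<theta> = t"
    using subfield_hom_extend_simple[OF K0 id p(1), of t] pt(1) by auto
  \<comment> \<open>\<open>K\<close> may be infinite over \<open>K0\<close>; the embedding only has
    to be defined on the conjugates of \<alpha> and the coefficients of \<open>W\<close>, which form
    a finite list.\<close>
  obtain xs where xs: "set xs = tc.S \<union> set (coeffs W)" using tc.finite_S by (metis finite_Un finite_list finite_set)
  define E where "E = adjoin (adjoin K0 {\<theta>}) (set xs)"
  have E: "is_subfield E" unfolding E_def by (rule is_subfield_adjoin)
  have algS: "algebraic_over K0 a" if "a \<in> tc.S" for a
    using that is_min_polyD[OF f(1)] unfolding tc.S_def algebraic_over_def by blast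
  have algK: "algebraic_over K0 u" if "u \<in> K" for u
    using that sepK separable_imp_algebraic[OF K0] by (auto simp: separable_algebraic_extension_def)
  have coeffs_K: "u \<in> K" if "u \<in> set (coeffs W)" for u
    using that polys_over_coeff[OF W] by (auto simp: coeffs_def split: if_splits)
  have "algebraic_over (adjoin K0 {\<theta>}) u" if "u \<in> set xs" for u
    by (rule algebraic_over_mono[of K0]) (use that algS algK coeffs_K xs adjoin_base in \<open>auto\<close>)
  then obtain \<tau> where \<tau>: "subfield_hom E \<tau>" "\<And>u. u \<in> adjoin K0 {\<theta>} \<Longrightarrow> \<tau> u = \<sigma> u"
    using subfield_hom_extend[OF is_subfield_adjoin \<sigma>(1)] unfolding E_def by blast
  have K0_E: "u \<in> E" and \<tau>K0: "\<tau> u = u" if "u \<in> K0" for u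
    using that \<tau>(2) \<sigma>(2) adjoin_base[of u K0 "{\<theta>}"] adjoin_base[of u "adjoin K0 {\<theta>}" "set xs"]
    by (auto simp: E_def)
  have polysE: "q \<in> polys_over E" if "q \<in> polys_over K0" for q
    using that K0_E by (auto simp: polys_over_def)
  have fix_polys: "map_poly \<tau> q = q" if "q \<in> polys_over K0" for q
    by (intro poly_eqI) (simp add: coeff_map_poly_hom[OF E \<tau>(1)] \<tau>K0 polys_over_coeff[OF that])
  have conj: "poly q (\<tau> u) = 0" if "q \<in> polys_over K0" "poly q u = 0" "u \<in> E" for q u
    using subfield_hom_poly[OF E \<tau>(1) polysE[OF that(1)] that(3)] that(2) fix_polys[OF that(1)]
      subfield_hom_zero[OF E \<tau>(1)] by simp
  have \<theta>E: "\<theta> \<in> E" and \<tau>\<theta>: "\<tau> \<theta> = t"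
    using \<tau>(2) \<sigma>(3) adjoin_gen[of \<theta> "{\<theta>}" K0] adjoin_base[of \<theta> "adjoin K0 {\<theta>}" "set xs"]
    by (auto simp: E_def)
  have SE: "a \<in> E" if "a \<in> tc.S" for a
    unfolding E_def by (rule adjoin_gen) (use that xs in simp)
  have WE: "W \<in> polys_over E"
  proof (rule polys_overI)
    fix i
    show "Polynomial.coeff W i \<in> E"
    proof (cases "Polynomial.coeff W i = 0")
      case False
      then have "Polynomial.coeff W i \<in> set (coeffs W)"
        by (metis coeff_in_coeffs le_degree coeff_0)
      then show ?thesis unfolding E_def using xs by (intro adjoin_gen) simp
    qed (simp add: subfield_zero[OF E])
  qed
  define W' where "W' = map_poly \<tau> W"
  have \<tau>W: "\<tau> (poly W a) = poly W' (\<tau> a)" if "a \<in> tc.S" for a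
    unfolding W'_def by (rule subfield_hom_poly[OF E \<tau>(1) WE SE[OF that]])
  have injW: "inj_on (\<lambda>a. \<tau> (poly W a)) tc.S"
    using inj subfield_hom_inj[OF E \<tau>(1)] poly_in_subfield[OF E WE] SE unfolding inj_on_def by blast
  have tau_S: "\<tau> ` tc.S = tc.S"
  proof (rule card_subset_eq[OF tc.finite_S])
    show "\<tau> ` tc.S \<subseteq> tc.S" using conj[OF is_min_polyD(1)[OF f(1)]] SE by (auto simp: tc.S_def)
    have "inj_on \<tau> tc.S" using subfield_hom_inj[OF E \<tau>(1)] SE by (auto simp: inj_on_def)
    then show "card (\<tau> ` tc.S) = card tc.S" by (rule card_image)
  qed

  have g\<theta>E: "g \<theta> \<in> polys_over E"
    unfolding g_def
    by (intro polys_over_add[OF E] polys_over_sum[OF E] polys_over_monom[OF E] subfield_one[OF E]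
        poly_in_subfield[OF E] polysE A \<theta>E)
  have "map_poly \<tau> (g \<theta>) = g t"
  proof (rule poly_eqI)
    fix i
    have "\<tau> (poly (A i) \<theta>) = poly (A i) t"
      using subfield_hom_poly[OF E \<tau>(1) polysE[OF A] \<theta>E] fix_polys[OF A] \<tau>\<theta> by simp
    then show "Polynomial.coeff (map_poly \<tau> (g \<theta>)) i = Polynomial.coeff (g t) i"
      unfolding coeff_map_poly_hom[OF E \<tau>(1)]
      by (simp add: g_def coeff_sum coeff_monom subfield_hom_one[OF E \<tau>(1)] subfield_hom_zero[OF E \<tau>(1)])
  qed
  then have groot: "poly (g t) (\<tau> (poly W a)) = 0" if "a \<in> tc.S" for a
  proof -
    have "poly (g \<theta>) (poly W a) = 0"
      using that tc.finite_S unfolding g_def gW by (auto simp: poly_prod prod_zero_iff)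
    then show ?thesis
      using subfield_hom_poly[OF E \<tau>(1) g\<theta>E poly_in_subfield[OF E WE SE[OF that]]]
        \<open>map_poly \<tau> (g \<theta>) = g t\<close> subfield_hom_zero[OF E \<tau>(1)] by simp
  qed
  \<comment> \<open>The \<open>m\<close> distinct elements found are roots of a monic polynomial of
    degree \<open>m\<close>, so they are all its roots, and \<open>poly Y t\<close> must be one of
    them.\<close>
  have "(\<lambda>a. \<tau> (poly W a)) ` tc.S = {z. poly (g t) z = 0}"
  proof (rule card_seteq)
    have "Polynomial.coeff (g t) m = 1" by (simp add: g_def coeff_sum coeff_monom)
    then have nz: "g t \<noteq> 0" by auto
    then show "finite {z. poly (g t) z = 0}" by (rule poly_roots_finite)
    have "Polynomial.degree (g t) \<le> m" by (rule degree_le) (auto simp: g_def coeff_sum coeff_monom)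
    then show "card {z. poly (g t) z = 0} \<le> card ((\<lambda>a. \<tau> (poly W a)) ` tc.S)"
      using card_poly_roots_bound[OF nz] card_image[OF injW] tc.card_S by simp
  qed (use groot in auto)
  moreover have "poly (g t) (poly Y t) = 0" using gY[OF t] by (simp add: g_def)
  ultimately obtain a where a: "a \<in> tc.S" "poly Y t = \<tau> (poly W a)" by blast

  define \<beta> where "\<beta> = \<tau> a"
  have beta_S: "\<beta> \<in> tc.S" using tau_S a(1) by (auto simp: \<beta>_def)
  then have minf: "is_min_poly K0 \<beta> f" using min_poly_conjugate[OF K0 f(1)] by (simp add: tc.S_def)
  have tN: "t \<in> N" using normal[OF _ p(1) pt(1)] \<theta>(1) N(2) by blast
  have YN: "poly Y t \<in> N" by (rule poly_in_subfield[OF sfN polys_over_mono[OF N(2) Y] tN])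
  \<comment> \<open>Nothing in the choice of \<open>\<tau>\<close> makes it map into
    \<open>N\<close>; but each coefficient of \<open>W'\<close> is a conjugate over
    \<open>K0\<close> of an element of \<open>K\<close>, and normality of \<open>N\<close> takes it
    in.\<close>
  have W'N: "W' \<in> polys_over N"
  proof (rule polys_overI)
    fix i
    define u where "u = Polynomial.coeff W i"
    have u: "u \<in> K" "u \<in> E" using polys_over_coeff[OF W] polys_over_coeff[OF WE] by (auto simp: u_def)
    obtain q where q: "is_min_poly K0 u q" using min_poly_exists[OF K0 algK[OF u(1)]] by blast
    have "poly q (\<tau> u) = 0" by (rule conj[OF is_min_polyD(1,4)[OF q] u(2)])
    then have "\<tau> u \<in> N" using normal[OF _ q] u(1) N(2) by blast
    then show "Polynomial.coeff W' i \<in> N"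
      unfolding W'_def coeff_map_poly_hom[OF E \<tau>(1)] u_def .
  qed
  have "K0 \<subseteq> N" using K0_K N(2) by blast
  \<comment> \<open>\<beta> is the only common root of \<open>f\<close> and
    \<open>W' - y(t)\<close>, both over \<open>N\<close>, because \<open>W'\<close> is injective on
    the conjugates of \<alpha>.\<close>
  have "\<beta> \<in> N"
  proof (rule unique_separable_root_in_subfield[OF sfN, of \<beta> f "W' - [:poly Y t:]"])
    have "separable_over K0 \<beta>" using minf f(2) by (auto simp: separable_over_def)
    then show "separable_over N \<beta>" by (rule separable_over_mono[OF K0 sfN \<open>K0 \<subseteq> N\<close>])
    show "f \<in> polys_over N" by (rule polys_over_mono[OF \<open>K0 \<subseteq> N\<close> is_min_polyD(1)[OF f(1)]])
    show "poly f \<beta> = 0" by (rule is_min_polyD(4)[OF minf])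
    show "W' - [:poly Y t:] \<in> polys_over N"
      by (intro polys_over_diff[OF sfN] polys_over_const[OF sfN] W'N YN)
    show "poly (W' - [:poly Y t:]) \<beta> = 0" using \<tau>W[OF a(1)] a(2) by (simp add: \<beta>_def)
    fix \<gamma> assume \<gamma>: "poly f \<gamma> = 0" "poly (W' - [:poly Y t:]) \<gamma> = 0"
    then obtain a' where a': "a' \<in> tc.S" "\<gamma> = \<tau> a'" using tau_S by (auto simp: tc.S_def)
    then have "\<tau> (poly W a') = \<tau> (poly W a)" using \<tau>W[OF a'(1)] \<gamma>(2) a(2) by simp
    then have "a' = a" using injW a(1) a'(1) by (auto simp: inj_on_def)
    then show "\<gamma> = \<beta>" by (simp add: a'(2) \<beta>_def)
  qed
  \<comment> \<open>\<alpha> and \<beta> are conjugate over \<open>K0\<close>, so normality leads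
    back from \<beta> to \<alpha>.\<close>
  then show ?thesis using normal minf is_min_polyD(4)[OF f(1)] by blast
qed

theorem theorem4p2p3:
  fixes K0 K :: "'a::alg_closed_field set"
  assumes "separable_algebraic_extension K0 K"
    and "K0 \<noteq> K"
    and "PAC_extension K0 K"
  shows "galois_closure K0 K = separable_closure K0"
proof
  have "is_subfield K0" "K \<subseteq> separable_closure K0"
    using assms(1) by (auto simp: separable_algebraic_extension_def field_extension_def separable_closure_def)
  \<comment> \<open>The separable closure is itself one of the Galois extensions in the
    intersection.\<close>
  then show "galois_closure K0 K \<subseteq> separable_closure K0"
    unfolding galois_closure_def using galois_extension_separable_closure by blast
  show "separable_closure K0 \<subseteq> galois_closure K0 K"
    unfolding galois_closure_def separable_closure_def
    using separable_in_galois_extension[OF assms(1,3,2)] by blast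
qed

end
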